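(* Let $\alpha_S(b)=SbS^*$. Then $\alpha_S$ is a monomorphism of $B_S$ into itself with hereditary range, and there is an isomorphism of C$^*$-algebras $$A_S\cong B_S\rtimes_{\alpha_S}\mathbb N.$$
   Context: Fix an integer $s\ge2$; $\mathbb Z_s$ is the compact ring of $s$-adic integers. Let $\mathcal V=\{(n,x): n\in\mathbb Z_{\ge0},\ x\in\mathbb Z,\ 0\le x<s^n\}$, $H=\ell^2(\mathcal V)$ with orthonormal basis $\{E_{(n,x)}\}$, $M_fE_{(n,x)}=f(x)E_{(n,x)}$. The Bernoulli shift is $SE_{(n,x)}=\frac1s\sum_{j=0}^{s-1}E_{(n+1,sx+j)}$ and $A_S=C^*(S,M_f:f\in C(\mathbb Z_s))$. $S_jE_{(n,x)}=E_{(n+1,sx+j)}$, $S_{(n,x)}=S_{x_0}\cdots S_{x_{n-1}}$ for $0\le x<s^n$ with base-$s$ digits $x_0,\dots,x_{n-1}$, and $B_S=C^*(S_{(n,x)}S_{(n,y)}^*: n\ge0,\ 0\le x,y<s^n)$. For a unital C$^*$-algebra $B$ and endomorphism $\alpha$, $B\rtimes_\alpha\mathbb N$ is the universal unital C$^*$-algebra generated by a copy of $B$ and an isometry $v$ with $vbv^*=\alpha(b)$ for $b\in B$.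
   Formalization: The Bernoulli shift is taken with factor 1/√s instead of 1/s: with 1/s one has S*S = (1/s)I, so α_S(1)² = (1/s)α_S(1), α_S is not multiplicative and S is no isometry; A_S and B_S are unchanged by the rescaling. *)

theory Defs
  imports "HOL-Analysis.Analysis"
begin

class cstar_alg = real_normed_algebra_1 + banach +
  fixes cstar :: "'a \<Rightarrow> 'a"
    and scaleC :: "complex \<Rightarrow> 'a \<Rightarrow> 'a"
  assumes scaleC_add_right: "scaleC c (x + y) = scaleC c x + scaleC c y"
    and scaleC_add_left: "scaleC (c + d) x = scaleC c x + scaleC d x"
    and scaleC_scaleC: "scaleC c (scaleC d x) = scaleC (c * d) x"
    and scaleC_one: "scaleC 1 x = x"
    and scaleC_of_real: "scaleC (complex_of_real r) x = scaleR r x"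
    and mult_scaleC_left: "scaleC c x * y = scaleC c (x * y)"
    and mult_scaleC_right: "x * scaleC c y = scaleC c (x * y)"
    and norm_scaleC: "norm (scaleC c x) = cmod c * norm x"
    and cstar_cstar: "cstar (cstar x) = x"
    and cstar_add: "cstar (x + y) = cstar x + cstar y"
    and cstar_scaleC: "cstar (scaleC c x) = scaleC (cnj c) (cstar x)"
    and cstar_mult: "cstar (x * y) = cstar y * cstar x"
    and cstar_identity: "norm (cstar x * x) = (norm x)\<^sup>2"

instantiation complex :: cstar_alg
begin
definition cstar_complex :: "complex \<Rightarrow> complex" where "cstar_complex = cnj"
definition scaleC_complex :: "complex \<Rightarrow> complex \<Rightarrow> complex" where "scaleC_complex = (*)"
instance
  by standard (auto simp: cstar_complex_def scaleC_complex_def algebra_simps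
      scaleR_conv_of_real norm_mult power2_eq_square)
end

type_synonym vtx = "nat \<times> int"
type_synonym vec = "vtx \<Rightarrow> complex"
type_synonym op = "vec \<Rightarrow> vec"

definition Vs :: "nat \<Rightarrow> vtx set" where
  "Vs s = {(n, x). 0 \<le> x \<and> x < int s ^ n}"

definition Hs :: "nat \<Rightarrow> vec set" where
  "Hs s = {\<xi>. (\<forall>v. v \<notin> Vs s \<longrightarrow> \<xi> v = 0) \<and> (\<lambda>v. (cmod (\<xi> v))\<^sup>2) summable_on UNIV}"

definition inner_l2 :: "vec \<Rightarrow> vec \<Rightarrow> complex" where
  "inner_l2 \<xi> \<eta> = (\<Sum>\<^sub>\<infinity>v. \<xi> v * cnj (\<eta> v))"

definition norm_l2 :: "vec \<Rightarrow> real" where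
  "norm_l2 \<xi> = sqrt (\<Sum>\<^sub>\<infinity>v. (cmod (\<xi> v))\<^sup>2)"

definition bop :: "nat \<Rightarrow> op set" where
  "bop s = {T. (\<forall>\<xi>\<in>Hs s. T \<xi> \<in> Hs s) \<and> (\<forall>\<xi>. \<xi> \<notin> Hs s \<longrightarrow> T \<xi> = (\<lambda>v. 0)) \<and>
     (\<forall>\<xi>\<in>Hs s. \<forall>\<eta>\<in>Hs s. \<forall>a b. T (\<lambda>v. a * \<xi> v + b * \<eta> v) = (\<lambda>v. a * T \<xi> v + b * T \<eta> v)) \<and>
     (\<exists>K. \<forall>\<xi>\<in>Hs s. norm_l2 (T \<xi>) \<le> K * norm_l2 \<xi>)}"

definition opnorm :: "nat \<Rightarrow> op \<Rightarrow> real" where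
  "opnorm s T = (SUP \<xi>\<in>{\<xi>\<in>Hs s. norm_l2 \<xi> \<le> 1}. norm_l2 (T \<xi>))"

definition idop :: "nat \<Rightarrow> op" where
  "idop s = (\<lambda>\<xi>. if \<xi> \<in> Hs s then \<xi> else (\<lambda>v. 0))"

definition op_add :: "op \<Rightarrow> op \<Rightarrow> op" where
  "op_add T U = (\<lambda>\<xi> v. T \<xi> v + U \<xi> v)"

definition op_scale :: "complex \<Rightarrow> op \<Rightarrow> op" where
  "op_scale c T = (\<lambda>\<xi> v. c * T \<xi> v)"

definition adj :: "nat \<Rightarrow> op \<Rightarrow> op" where
  "adj s T = (THE U. U \<in> bop s \<and>
      (\<forall>\<xi>\<in>Hs s. \<forall>\<eta>\<in>Hs s. inner_l2 (T \<xi>) \<eta> = inner_l2 \<xi> (U \<eta>)))"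

definition cstar_closed :: "nat \<Rightarrow> op set \<Rightarrow> bool" where
  "cstar_closed s C \<longleftrightarrow> C \<subseteq> bop s \<and>
     (\<forall>T\<in>C. \<forall>U\<in>C. op_add T U \<in> C \<and> T \<circ> U \<in> C) \<and>
     (\<forall>c. \<forall>T\<in>C. op_scale c T \<in> C) \<and>
     (\<forall>T\<in>C. adj s T \<in> C) \<and>
     (\<forall>T f. T \<in> bop s \<and> (\<forall>k. f k \<in> C) \<and>
        (\<lambda>k. opnorm s (op_add (f k) (op_scale (-1) T))) \<longlonglongrightarrow> 0 \<longrightarrow> T \<in> C)"

definition gen_cstar :: "nat \<Rightarrow> op set \<Rightarrow> op set" where
  "gen_cstar s G = \<Inter>{C. G \<subseteq> C \<and> cstar_closed s C}"

text \<open>Z_s is modelled (as a compact space) by digit sequences with the product topology;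
  a nonnegative integer is embedded via its base-s digit expansion.\<close>
definition Zs_top :: "nat \<Rightarrow> (nat \<Rightarrow> nat) topology" where
  "Zs_top s = product_topology (\<lambda>i. discrete_topology {..<s}) UNIV"

definition zemb :: "nat \<Rightarrow> int \<Rightarrow> (nat \<Rightarrow> nat)" where
  "zemb s x = (\<lambda>i. (nat x div s ^ i) mod s)"

definition Mop :: "nat \<Rightarrow> ((nat \<Rightarrow> nat) \<Rightarrow> complex) \<Rightarrow> op" where
  "Mop s f = (\<lambda>\<xi>. if \<xi> \<in> Hs s then (\<lambda>(n, x). f (zemb s x) * \<xi> (n, x)) else (\<lambda>v. 0))"

text \<open>Bernoulli shift S E(n,x) = s^(-1/2) sum_j E(n+1, s x + j) (isometric normalisation).\<close>
definition Sop :: "nat \<Rightarrow> op" where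
  "Sop s = (\<lambda>\<xi>. if \<xi> \<in> Hs s then
      (\<lambda>(m, y). if (m, y) \<in> Vs s \<and> 0 < m
                 then \<xi> (m - 1, y div int s) / complex_of_real (sqrt (real s)) else 0)
      else (\<lambda>v. 0))"

text \<open>S_j E(n,x) = E(n+1, s x + j).\<close>
definition Sj :: "nat \<Rightarrow> nat \<Rightarrow> op" where
  "Sj s j = (\<lambda>\<xi>. if \<xi> \<in> Hs s then
      (\<lambda>(m, y). if (m, y) \<in> Vs s \<and> 0 < m \<and> y mod int s = int j
                 then \<xi> (m - 1, y div int s) else 0)
      else (\<lambda>v. 0))"

definition Sword :: "nat \<Rightarrow> nat \<Rightarrow> nat \<Rightarrow> op" where
  "Sword s n x = foldr (\<lambda>i acc. Sj s ((x div s ^ i) mod s) \<circ> acc) [0..<n] (idop s)"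

definition A_S :: "nat \<Rightarrow> op set" where
  "A_S s = gen_cstar s (insert (Sop s) {Mop s f | f. continuous_map (Zs_top s) euclidean f})"

definition B_S :: "nat \<Rightarrow> op set" where
  "B_S s = gen_cstar s {Sword s n x \<circ> adj s (Sword s n y) | n x y. x < s ^ n \<and> y < s ^ n}"

definition alpha_S :: "nat \<Rightarrow> op \<Rightarrow> op" where
  "alpha_S s b = Sop s \<circ> b \<circ> adj s (Sop s)"

definition op_star_hom :: "nat \<Rightarrow> op set \<Rightarrow> (op \<Rightarrow> op) \<Rightarrow> bool" where
  "op_star_hom s C \<phi> \<longleftrightarrow>
     (\<forall>x\<in>C. \<forall>y\<in>C. \<phi> (op_add x y) = op_add (\<phi> x) (\<phi> y) \<and> \<phi> (x \<circ> y) = \<phi> x \<circ> \<phi> y) \<and>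
     (\<forall>c. \<forall>x\<in>C. \<phi> (op_scale c x) = op_scale c (\<phi> x)) \<and>
     (\<forall>x\<in>C. \<phi> (adj s x) = adj s (\<phi> x))"

definition pos_op :: "nat \<Rightarrow> op \<Rightarrow> bool" where
  "pos_op s T \<longleftrightarrow> T \<in> bop s \<and> adj s T = T \<and> (\<forall>\<xi>\<in>Hs s. 0 \<le> Re (inner_l2 (T \<xi>) \<xi>))"

definition hereditary_subalg :: "nat \<Rightarrow> op set \<Rightarrow> op set \<Rightarrow> bool" where
  "hereditary_subalg s C D \<longleftrightarrow> cstar_closed s C \<and> C \<subseteq> D \<and>
     (\<forall>a\<in>D. \<forall>b\<in>C. pos_op s a \<and> pos_op s (op_add b (op_scale (-1) a)) \<longrightarrow> a \<in> C)"

definition unital_star_hom_into :: "nat \<Rightarrow> op set \<Rightarrow> (op \<Rightarrow> 'd::cstar_alg) \<Rightarrow> bool" where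
  "unital_star_hom_into s C \<pi> \<longleftrightarrow>
     (\<forall>x\<in>C. \<forall>y\<in>C. \<pi> (op_add x y) = \<pi> x + \<pi> y \<and> \<pi> (x \<circ> y) = \<pi> x * \<pi> y) \<and>
     (\<forall>c. \<forall>x\<in>C. \<pi> (op_scale c x) = scaleC c (\<pi> x)) \<and>
     (\<forall>x\<in>C. \<pi> (adj s x) = cstar (\<pi> x)) \<and>
     \<pi> (idop s) = 1"

text \<open>A (with the inclusion of B and the isometry v) is the universal unital C*-algebra
  generated by a copy of B and an isometry v with v b v* = alpha b, tested against all
  unital C*-algebras of type 'd.\<close>
definition is_crossed_product ::
    "nat \<Rightarrow> op set \<Rightarrow> (op \<Rightarrow> op) \<Rightarrow> op set \<Rightarrow> op \<Rightarrow> 'd::cstar_alg itself \<Rightarrow> bool" where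
  "is_crossed_product s B \<alpha> A v _ \<longleftrightarrow>
     idop s \<in> B \<and> B \<subseteq> A \<and> v \<in> A \<and> adj s v \<circ> v = idop s \<and>
     (\<forall>b\<in>B. v \<circ> b \<circ> adj s v = \<alpha> b) \<and>
     A = gen_cstar s (insert v B) \<and>
     (\<forall>(\<pi> :: op \<Rightarrow> 'd) w. unital_star_hom_into s B \<pi> \<and> cstar w * w = 1 \<and>
        (\<forall>b\<in>B. w * \<pi> b * cstar w = \<pi> (\<alpha> b)) \<longrightarrow>
        (\<exists>\<rho> :: op \<Rightarrow> 'd. unital_star_hom_into s A \<rho> \<and> (\<forall>b\<in>B. \<rho> b = \<pi> b) \<and> \<rho> v = w))"

end

theory Submission
  imports Defs
begin

text \<open>
  The range of \<open>alpha_S\<close> is the corner of \<open>B_S\<close> cut down by the projection \<open>S S*\<close>, because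
  \<open>B_S\<close> is stable both under \<open>b \<mapsto> S b S*\<close> and under \<open>b \<mapsto> S* b S\<close>; this gives heredity.

  For the universal property let \<open>\<pi>\<close> and \<open>w\<close> be covariant. A unital *-homomorphism is contractive,
  since a self-adjoint \<open>h\<close> of norm below 1 is the real part of the unitary \<open>h + i sqrt (1 - h h)\<close>.
  On elements \<open>x\<close> of the form \<open>v*^m b v^n\<close>, which have degree \<open>n - m\<close> for the gauge action, the extension
  is therefore contractive, as \<open>x* x\<close> lies in \<open>B_S\<close>. A sum of such elements of degrees between \<open>-N\<close> and
  \<open>N\<close> is mapped with norm at most \<open>2 N + 1\<close>: averaging over roots of unity the gauge unitaries
  \<open>E(n,x) \<mapsto> z^n E(n,x)\<close> bounds each homogeneous component. Applying this to
  the powers \<open>(x* x)^(2^k)\<close> and taking roots improves the constant to 1, so the extension passes to the closure.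

  Operators on \<open>Hs s\<close> are treated as the corner, cut down by the projection onto \<open>Hs s\<close>, of the C*-algebra
  of all bounded operators on the square-summable families indexed by vertices; that algebra does not depend
  on \<open>s\<close> and hence is a type.
\<close>

section \<open>C*-algebras\<close>

text \<open>The concrete algebras sit in an ambient algebra whose unit is not theirs:
  \<open>B_S\<close> has the projection \<open>e\<close> onto \<open>Hs s\<close> as its unit.
  Keeping \<open>e\<close> and 1 apart is the price of working with type classes, and it shows
  wherever a unit or a zeroth power occurs. In return the gauge unitaries can be taken in the
  ambient algebra.

  The extension cannot be defined by a formula on sums of monomials, because one element has many
  such representations. It is built as a relation stable under the algebraic operations, and becomes
  single-valued only through the norm estimate.

  The estimate reduces to \<open>B_S\<close> because \<open>B_S\<close> is invariant under b -> S* b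
  S. This invariance is the delicate point: the generating isometries satisfy "sum of S_j S_j*
  equals the unit minus the projection onto the root vertex", so inserting the unit between two
  factors leaves an error term. That defect projection is central in \<open>B_S\<close> and is
  annihilated by the adjoint of every S_j, and therefore the error term vanishes.\<close>

lemma norm_cstar: "norm (cstar x) = norm (x :: 'a::cstar_alg)"
proof -
  have le: "norm y \<le> norm (cstar y)" for y :: 'a
  proof (cases "y = 0")
    case False
    have "norm y * norm y \<le> norm (cstar y) * norm y"
      using norm_mult_ineq[of "cstar y" y] by (simp add: cstar_identity power2_eq_square)
    then show ?thesis using False by simp
  qed simp
  show ?thesis using le[of x] le[of "cstar x"] by (simp add: cstar_cstar)
qed

lemma bounded_linear_cstar: "bounded_linear (cstar :: 'a::cstar_alg \<Rightarrow> 'a)"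
proof (rule bounded_linear_intro[where K = 1])
  show "cstar (r *\<^sub>R x) = r *\<^sub>R cstar x" for r and x :: 'a
    by (metis complex_cnj_complex_of_real cstar_scaleC scaleC_of_real)
qed (auto simp: cstar_add norm_cstar)

lemma bounded_linear_scaleC: "bounded_linear (scaleC c :: 'a::cstar_alg \<Rightarrow> 'a)"
proof (rule bounded_linear_intro[where K = "cmod c"])
  show "scaleC c (r *\<^sub>R x) = r *\<^sub>R scaleC c x" for r and x :: 'a
    by (metis mult.commute scaleC_of_real scaleC_scaleC)
qed (auto simp: scaleC_add_right norm_scaleC)

lemmas cstar_zero [simp] = linear_0[OF bounded_linear.linear, OF bounded_linear_cstar]
lemmas cstar_diff = linear_diff[OF bounded_linear.linear, OF bounded_linear_cstar]
lemmas cstar_scaleR = linear_scale[OF bounded_linear.linear, OF bounded_linear_cstar]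
lemmas cstar_sum = linear_sum[OF bounded_linear.linear, OF bounded_linear_cstar]
lemmas tendsto_cstar = bounded_linear.tendsto[OF bounded_linear_cstar]
lemmas tendsto_scaleC = bounded_linear.tendsto[OF bounded_linear_scaleC]
lemmas scaleC_sum_right = linear_sum[OF bounded_linear.linear, OF bounded_linear_scaleC]

lemma scaleC_zero_left [simp]: "scaleC 0 (x :: 'a::cstar_alg) = 0"
  using scaleC_of_real[of 0 x] by simp

lemma scaleC_minus_one: "scaleC (- 1) (x :: 'a::cstar_alg) = - x"
  using scaleC_of_real[of "- 1" x] by simp

lemma cstar_one [simp]: "cstar 1 = (1 :: 'a::cstar_alg)"
  by (metis cstar_cstar cstar_mult mult.right_neutral)

lemma cstar_power: "cstar (x ^ n) = cstar (x :: 'a::cstar_alg) ^ n"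
  by (induction n) (simp_all add: cstar_mult power_commutes)

lemma scaleC_sum_left: "scaleC (sum f A) (x :: 'a::cstar_alg) = (\<Sum>i\<in>A. scaleC (f i) x)"
  by (induction A rule: infinite_finite_induct) (auto simp: scaleC_add_left)

lemma norm_isometry:
  fixes u :: "'a::cstar_alg"
  assumes "cstar u * u = 1"
  shows "norm u = 1"
  using cstar_identity[of u] norm_ge_zero[of u] assms
  by (simp add: power2_eq_1_iff)

text \<open>Each doubling of the exponent is one use of the C*-identity, which is why only exponents
  \<open>2 ^ n\<close> occur; the root extraction in \<open>Graph_norm_le\<close> runs along the
  same exponents.\<close>

lemma norm_power_selfadjoint:
  fixes x :: "'a::cstar_alg"
  assumes "cstar x = x"
  shows "norm (x ^ 2 ^ n) = norm x ^ 2 ^ n"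
proof (induction n)
  case (Suc n)
  have "x ^ 2 ^ Suc n = cstar (x ^ 2 ^ n) * x ^ 2 ^ n"
    using assms by (simp add: cstar_power mult_2 power_add)
  then show ?case
    using Suc by (simp add: cstar_identity mult_2 power_add power2_eq_square)
qed simp

text \<open>Modelled on \<open>cstar_closed\<close>: neither a unit nor an element is demanded.
  Hence the empty set qualifies, facts that produce 0 start from a given element, and a subalgebra
  may have a unit other than 1.\<close>

definition cstar_subalg :: "'a::cstar_alg set \<Rightarrow> bool" where
  "cstar_subalg C \<longleftrightarrow> closed C \<and> (\<forall>x\<in>C. \<forall>y\<in>C. x + y \<in> C \<and> x * y \<in> C) \<and>
     (\<forall>c. \<forall>x\<in>C. scaleC c x \<in> C) \<and> (\<forall>x\<in>C. cstar x \<in> C)"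

definition cstar_generated :: "'a::cstar_alg set \<Rightarrow> 'a set" where
  "cstar_generated G = \<Inter>{C. G \<subseteq> C \<and> cstar_subalg C}"

lemma cstar_subalgI:
  "\<lbrakk>closed C; \<And>x y. x \<in> C \<Longrightarrow> y \<in> C \<Longrightarrow> x + y \<in> C; \<And>x y. x \<in> C \<Longrightarrow> y \<in> C \<Longrightarrow> x * y \<in> C;
    \<And>c x. x \<in> C \<Longrightarrow> scaleC c x \<in> C; \<And>x. x \<in> C \<Longrightarrow> cstar x \<in> C\<rbrakk> \<Longrightarrow> cstar_subalg C"
  unfolding cstar_subalg_def by simp

lemma cstar_subalgD:
  assumes "cstar_subalg C"
  shows "closed C" "x \<in> C \<Longrightarrow> y \<in> C \<Longrightarrow> x + y \<in> C" "x \<in> C \<Longrightarrow> y \<in> C \<Longrightarrow> x * y \<in> C"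
    "x \<in> C \<Longrightarrow> scaleC c x \<in> C" "x \<in> C \<Longrightarrow> cstar x \<in> C"
    "x \<in> C \<Longrightarrow> r *\<^sub>R x \<in> C" "x \<in> C \<Longrightarrow> - x \<in> C" "x \<in> C \<Longrightarrow> y \<in> C \<Longrightarrow> x - y \<in> C"
    "x \<in> C \<Longrightarrow> 0 \<in> C"
proof -
  show sc: "x \<in> C \<Longrightarrow> scaleC c x \<in> C" for c x
    using assms by (auto simp: cstar_subalg_def)
  show "x \<in> C \<Longrightarrow> r *\<^sub>R x \<in> C" for r x
    using sc[of x "complex_of_real r"] by (simp add: scaleC_of_real)
  show mi: "x \<in> C \<Longrightarrow> - x \<in> C" for x
    using sc[of x "- 1"] by (simp add: scaleC_minus_one)
  show ad: "x \<in> C \<Longrightarrow> y \<in> C \<Longrightarrow> x + y \<in> C" for x y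
    using assms by (auto simp: cstar_subalg_def)
  show "x \<in> C \<Longrightarrow> y \<in> C \<Longrightarrow> x - y \<in> C"
    using ad[OF _ mi, of x y] by simp
  show "x \<in> C \<Longrightarrow> 0 \<in> C"
    using sc[of x 0] by simp
qed (use assms in \<open>auto simp: cstar_subalg_def\<close>)

lemma cstar_subalg_sum:
  assumes "cstar_subalg C" "C \<noteq> {}" "\<And>i. i \<in> I \<Longrightarrow> f i \<in> C"
  shows "sum f I \<in> C"
  using assms(3)
proof (induction I rule: infinite_finite_induct)
  case (insert i I)
  then show ?case using cstar_subalgD(2)[OF assms(1)] by auto
qed (use assms cstar_subalgD(9) in auto)

lemma cstar_subalg_Inter: "(\<And>C. C \<in> F \<Longrightarrow> cstar_subalg C) \<Longrightarrow> cstar_subalg (\<Inter>F)"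
  unfolding cstar_subalg_def by (intro conjI closed_Inter) blast+

lemma cstar_subalg_generated: "cstar_subalg (cstar_generated G)"
  unfolding cstar_generated_def by (rule cstar_subalg_Inter) auto

lemma cstar_generated_subset: "G \<subseteq> cstar_generated G"
  unfolding cstar_generated_def by auto

lemma cstar_generated_least: "G \<subseteq> C \<Longrightarrow> cstar_subalg C \<Longrightarrow> cstar_generated G \<subseteq> C"
  unfolding cstar_generated_def by auto

text \<open>Preservation of the unit is stated separately, as \<open>\<pi> e = 1\<close>, since the
  domain has unit \<open>e\<close> and the target has unit 1.\<close>

definition star_hom_on :: "'a::cstar_alg set \<Rightarrow> ('a \<Rightarrow> 'd::cstar_alg) \<Rightarrow> bool" where
  "star_hom_on C \<pi> \<longleftrightarrow>
     (\<forall>x\<in>C. \<forall>y\<in>C. \<pi> (x + y) = \<pi> x + \<pi> y \<and> \<pi> (x * y) = \<pi> x * \<pi> y) \<and>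
     (\<forall>c. \<forall>x\<in>C. \<pi> (scaleC c x) = scaleC c (\<pi> x)) \<and>
     (\<forall>x\<in>C. \<pi> (cstar x) = cstar (\<pi> x))"

section \<open>Universal property of a corner endomorphism\<close>

text \<open>\<open>conj_in\<close> provides the endomorphism, and \<open>compress_in\<close> makes
  the elements of gauge degree 0 fall back into \<open>B\<close>. The element \<open>e\<close> is a
  unit for \<open>B\<close> only, whereas the \<open>u\<close> in \<open>gauge\<close> is unitary
  for the ambient unit 1.\<close>

locale corner_endomorphism =
  fixes B :: "'a::cstar_alg set" and e v :: 'a
  assumes B: "cstar_subalg B"
    and e_in: "e \<in> B" and e_left: "\<And>b. b \<in> B \<Longrightarrow> e * b = b" and e_right: "\<And>b. b \<in> B \<Longrightarrow> b * e = b"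
    and isometry: "cstar v * v = e" and v_e: "v * e = v" and e_v: "e * v = v"
    and conj_in: "\<And>b. b \<in> B \<Longrightarrow> v * b * cstar v \<in> B"
    and compress_in: "\<And>b. b \<in> B \<Longrightarrow> cstar v * b * v \<in> B"
    and gauge: "\<And>z. cmod z = 1 \<Longrightarrow> \<exists>u. cstar u * u = 1 \<and> u * cstar u = 1 \<and>
                  (\<forall>b\<in>B. u * b = b * u) \<and> u * v = scaleC z (v * u)"
begin

lemmas B_closed = cstar_subalgD[OF B]

lemma zero_in: "0 \<in> B"
  using B_closed(9)[OF e_in] .

lemma isometry_power:
  assumes "b \<in> B"
  shows "cstar (v ^ n) * v ^ n * b = b" "b * cstar (v ^ n) * v ^ n = b"
proof -
  \<comment> \<open>The zeroth power gives 1 and every higher power gives \<open>e\<close>; next to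
    an element of \<open>B\<close> the two act alike.\<close>
  have "cstar (v ^ n) * v ^ n = (if n = 0 then 1 else e)"
  proof (induction n)
    case (Suc n)
    have "cstar (v ^ Suc n) * v ^ Suc n = cstar v * (cstar (v ^ n) * v ^ n) * v"
      unfolding power_Suc2 cstar_mult by (simp only: mult.assoc)
    then show ?case using Suc isometry v_e by (auto simp: mult.assoc e_v)
  qed simp
  then show "cstar (v ^ n) * v ^ n * b = b" "b * cstar (v ^ n) * v ^ n = b"
    using assms e_left e_right by (auto simp: mult.assoc split: if_splits)
qed

text \<open>A square root without functional calculus: for z in \<open>B\<close>, y = e - z
  satisfies y y = e - h h exactly when z = (h h + z z) / 2. On the ball of radius
  \<open>norm h\<close> the right-hand side is a contraction with factor
  \<open>norm h\<close>.\<close>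

lemma sqrt_exists:
  assumes h: "h \<in> B" "cstar h = h" "norm h < 1"
  shows "\<exists>y\<in>B. cstar y = y \<and> y * h = h * y \<and> y * y = e - h * h"
proof -
  \<comment> \<open>Every property wanted of the root is put into this closed set, so the fixed
    point inherits it. Commuting with \<open>h\<close> will cancel the cross terms of h + i
    y.\<close>
  let ?K = "{z \<in> B. cstar z = z \<and> z * h = h * z \<and> norm z \<le> norm h}"
  let ?f = "\<lambda>z. (1/2) *\<^sub>R (h * h + z * z)"
  have "closed ?K"
  proof -
    have "?K = B \<inter> {z. cstar z = z} \<inter> {z. z * h = h * z} \<inter> {z. norm z \<le> norm h}" by auto
    moreover have "closed {z :: 'a. cstar z = z}"
      by (intro closed_Collect_eq bounded_linear.continuous_on[OF bounded_linear_cstar] continuous_intros)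
    moreover have "closed {z. z * h = h * z}" "closed {z :: 'a. norm z \<le> norm h}"
      by (intro closed_Collect_eq closed_Collect_le continuous_intros)+
    ultimately show ?thesis using B_closed(1) by (simp add: closed_Int)
  qed
  then have comp: "complete ?K" by (simp add: complete_eq_closed)
  have ne: "?K \<noteq> {}" using zero_in by (auto intro!: exI[of _ 0])
  have maps: "?f ` ?K \<subseteq> ?K"
  proof clarify
    fix z assume z: "z \<in> B" "cstar z = z" "z * h = h * z" "norm z \<le> norm h"
    have "norm (h * h + z * z) \<le> norm h * norm h + norm z * norm z"
      by (meson add_mono norm_mult_ineq norm_triangle_le)
    also have "\<dots> \<le> norm h * 1 + norm h * 1"
      using z(4) h(3) by (intro add_mono mult_mono) auto
    finally have "norm (?f z) \<le> norm h" by simp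
    moreover have "?f z \<in> B" using z h(1) by (intro B_closed)
    moreover have "cstar (?f z) = ?f z" using z h by (simp add: cstar_scaleR cstar_add cstar_mult)
    moreover have "?f z * h = h * ?f z"
      using z(3) by (simp add: algebra_simps) (metis mult.assoc)
    ultimately show "?f z \<in> B \<and> cstar (?f z) = ?f z \<and> ?f z * h = h * ?f z \<and> norm (?f z) \<le> norm h" by blast
  qed
  have contr: "dist (?f x) (?f y) \<le> norm h * dist x y" if "x \<in> ?K" "y \<in> ?K" for x y
  proof -
    have "?f x - ?f y = (1/2) *\<^sub>R (x * (x - y) + (x - y) * y)" by (simp add: algebra_simps)
    then have "norm (?f x - ?f y) \<le> (1/2) * (norm x * norm (x - y) + norm (x - y) * norm y)"
      by (simp add: norm_triangle_le add_mono norm_mult_ineq)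
    also have "\<dots> \<le> (1/2) * (norm h * norm (x - y) + norm (x - y) * norm h)"
      using that by (intro mult_left_mono add_mono mult_mono) auto
    finally show ?thesis by (simp add: dist_norm)
  qed
  obtain z where z: "z \<in> ?K" "?f z = z"
    using Banach_fix[OF comp ne _ h(3) maps] contr by auto
  have zz: "z * z = z + z - h * h"
  proof -
    have "h * h + z * z = 2 *\<^sub>R ?f z" by (simp del: scaleR_add_right)
    also have "\<dots> = z + z" unfolding z(2) by (simp add: scaleR_2)
    finally show ?thesis by (simp add: eq_diff_eq add.commute)
  qed
  show ?thesis
  proof (intro bexI conjI)
    show "e - z \<in> B" using z e_in by (auto intro: B_closed)
    have "cstar e = e"
      by (metis B_closed(5) cstar_cstar cstar_mult e_in e_left)
    then show "cstar (e - z) = e - z" using z by (simp add: cstar_diff)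
    show "(e - z) * h = h * (e - z)" using z h(1) by (simp add: algebra_simps e_left e_right)
    have "(e - z) * (e - z) = e - z - z + z * z"
      using z e_in by (simp add: algebra_simps e_left e_right)
    then show "(e - z) * (e - z) = e - h * h" using zz by simp
  qed
qed

text \<open>The self-adjoint case carries over to a general \<open>b\<close> by the C*-identity,
  applied to b* b divided by the square of any t above \<open>norm b\<close>; the square root needs
  this strict inequality.\<close>

lemma star_hom_contractive:
  fixes \<pi> :: "'a \<Rightarrow> 'd::cstar_alg"
  assumes \<pi>: "star_hom_on B \<pi>" "\<pi> e = 1" and b: "b \<in> B"
  shows "norm (\<pi> b) \<le> norm b"
proof -
  have hom: "x \<in> B \<Longrightarrow> y \<in> B \<Longrightarrow> \<pi> (x + y) = \<pi> x + \<pi> y" "x \<in> B \<Longrightarrow> y \<in> B \<Longrightarrow> \<pi> (x * y) = \<pi> x * \<pi> y"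
    "x \<in> B \<Longrightarrow> \<pi> (scaleC c x) = scaleC c (\<pi> x)" "x \<in> B \<Longrightarrow> \<pi> (cstar x) = cstar (\<pi> x)" for x y c
    using \<pi> by (auto simp: star_hom_on_def)
  have sa: "norm (\<pi> h) \<le> 1" if h: "h \<in> B" "cstar h = h" "norm h < 1" for h
  proof -
    obtain y where y: "y \<in> B" "cstar y = y" "y * h = h * y" "y * y = e - h * h"
      using sqrt_exists[OF h] by blast
    define H where "H = \<pi> h"
    define Y where "Y = \<pi> y"
    have "e = h * h + y * y" using y(4) by simp
    then have 1: "1 = H * H + Y * Y"
      unfolding H_def Y_def using \<pi>(2) h(1) y(1) by (metis B_closed(3) hom(1,2))
    have 2: "Y * H = H * Y" unfolding H_def Y_def using y h by (metis hom(2))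
    have 3: "cstar H = H" "cstar Y = Y" unfolding H_def Y_def using y h by (metis hom(4))+
    \<comment> \<open>The unitary is assembled in the target, from the images of \<open>h\<close>
      and of its companion root, because there the unit is 1.\<close>
    define u where "u = H + scaleC \<i> Y"
    have cu: "cstar u = H + scaleC (- \<i>) Y"
      unfolding u_def by (simp add: cstar_add cstar_scaleC 3)
    have "cstar u * u = H * H + scaleC \<i> (H * Y) + scaleC (- \<i>) (Y * H) + Y * Y"
      unfolding cu unfolding u_def
      by (simp add: algebra_simps mult_scaleC_left mult_scaleC_right scaleC_scaleC scaleC_one scaleC_add_right)
    also have "\<dots> = 1"
      using 1 2 scaleC_add_left[of \<i> "- \<i>" "H * Y"] by (simp add: algebra_simps)
    finally have "norm u = 1" by (rule norm_isometry)
    moreover have "2 *\<^sub>R H = u + cstar u"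
      unfolding cu unfolding u_def using scaleC_add_left[of \<i> "- \<i>" Y] by (simp add: algebra_simps scaleR_2)
    ultimately have "2 * norm H \<le> 1 + 1"
      by (metis abs_numeral norm_cstar norm_scaleR norm_triangle_ineq)
    then show ?thesis unfolding H_def by simp
  qed
  have "norm (\<pi> b) \<le> t" if t: "t > norm b" for t
  proof -
    have t0: "t > 0" using t norm_ge_zero[of b] by linarith
    define h where "h = (1 / t\<^sup>2) *\<^sub>R (cstar b * b)"
    have h: "h \<in> B" unfolding h_def using b by (intro B_closed)
    have "cstar h = h" unfolding h_def by (simp add: cstar_scaleR cstar_mult cstar_cstar)
    moreover have "norm h < 1"
      unfolding h_def using t t0 by (simp add: cstar_identity divide_less_eq power_strict_mono)
    ultimately have "norm (\<pi> h) \<le> 1" using sa h by blast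
    moreover have "\<pi> h = (1 / t\<^sup>2) *\<^sub>R (cstar (\<pi> b) * \<pi> b)"
      unfolding h_def scaleC_of_real[symmetric] using b by (simp add: hom B_closed)
    ultimately have "(norm (\<pi> b))\<^sup>2 \<le> t\<^sup>2"
      using t0 by (simp add: cstar_identity divide_le_eq)
    then show ?thesis using t0 by (simp add: power2_le_iff_abs_le)
  qed
  then show ?thesis by (meson dense_ge)
qed

end

locale covariant_rep = corner_endomorphism B e v for B :: "'a::cstar_alg set" and e v +
  fixes \<pi> :: "'a \<Rightarrow> 'd::cstar_alg" and w :: 'd
  assumes \<pi>_hom: "star_hom_on B \<pi>" and \<pi>_e: "\<pi> e = 1"
    and w_isometry: "cstar w * w = 1"
    and covariance: "\<And>b. b \<in> B \<Longrightarrow> w * \<pi> b * cstar w = \<pi> (v * b * cstar v)"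
begin

section \<open>Consequences of covariance for powers of \<open>v\<close> and
  \<open>w\<close>\<close>

lemma \<pi>_simps:
  "x \<in> B \<Longrightarrow> y \<in> B \<Longrightarrow> \<pi> (x + y) = \<pi> x + \<pi> y"
  "x \<in> B \<Longrightarrow> y \<in> B \<Longrightarrow> \<pi> (x * y) = \<pi> x * \<pi> y"
  "x \<in> B \<Longrightarrow> \<pi> (scaleC c x) = scaleC c (\<pi> x)"
  "x \<in> B \<Longrightarrow> \<pi> (cstar x) = cstar (\<pi> x)"
  using \<pi>_hom by (auto simp: star_hom_on_def)

lemma \<pi>_zero: "\<pi> 0 = 0"
  using \<pi>_simps(3)[OF e_in, of 0] by simp

lemma w_isometry_power: "cstar (w ^ n) * w ^ n = 1"
proof (induction n)
  case (Suc n)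
  have "cstar (w ^ Suc n) * w ^ Suc n = cstar w * (cstar (w ^ n) * w ^ n) * w"
    unfolding power_Suc2 cstar_mult by (simp only: mult.assoc)
  then show ?case using Suc w_isometry by simp
qed simp

text \<open>Covariance at \<open>e\<close> shows that the range projection of \<open>w\<close> is
  the image of \<open>v * cstar v\<close>. So \<open>\<pi> b\<close> cut down by it is the image of
  an element of the form v c v* with c = v* b v, covariance applies to c, and the outer factors
  cancel since \<open>w\<close> is an isometry.\<close>

lemma \<pi>_compress:
  assumes b: "b \<in> B"
  shows "\<pi> (cstar v * b * v) = cstar w * \<pi> b * w"
proof -
  have p: "v * cstar v \<in> B" using conj_in[OF e_in] by (simp add: v_e)
  have wp: "w * cstar w = \<pi> (v * cstar v)" using covariance[OF e_in] by (simp add: v_e \<pi>_e)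
  have wc: "cstar w * (w * t) = t" for t
    using w_isometry by (metis mult.assoc mult_1_left)
  have "cstar w * \<pi> b * w = cstar w * ((w * cstar w) * \<pi> b * (w * cstar w)) * w"
    by (simp add: mult.assoc wc w_isometry)
  also have "(w * cstar w) * \<pi> b * (w * cstar w) = \<pi> (v * (cstar v * b * v) * cstar v)"
  proof -
    have "v * (cstar v * b * v) * cstar v = (v * cstar v) * b * (v * cstar v)"
      by (simp only: mult.assoc)
    then show ?thesis unfolding wp using b p by (simp only: \<pi>_simps B_closed)
  qed
  also have "\<dots> = w * \<pi> (cstar v * b * v) * cstar w"
    using covariance[OF compress_in[OF b]] by simp
  finally show ?thesis
    by (simp add: mult.assoc wc w_isometry)
qed

lemma conj_power:
  assumes "b \<in> B"
  shows "v ^ n * b * cstar (v ^ n) \<in> B \<and> \<pi> (v ^ n * b * cstar (v ^ n)) = w ^ n * \<pi> b * cstar (w ^ n)"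
proof (induction n)
  case (Suc n)
  have "x ^ Suc n * c * cstar (x ^ Suc n) = x * (x ^ n * c * cstar (x ^ n)) * cstar x"
    for x c :: "'z::cstar_alg" by (simp add: cstar_mult mult.assoc)
  then show ?case using Suc conj_in covariance by metis
qed (simp add: assms)

lemma compress_power:
  assumes "b \<in> B"
  shows "cstar (v ^ n) * b * v ^ n \<in> B \<and> \<pi> (cstar (v ^ n) * b * v ^ n) = cstar (w ^ n) * \<pi> b * w ^ n"
proof (induction n)
  case (Suc n)
  have "cstar (x ^ Suc n) * c * x ^ Suc n = cstar x * (cstar (x ^ n) * c * x ^ n) * x"
    for x c :: "'z::cstar_alg" unfolding power_Suc2 by (simp add: cstar_mult mult.assoc)
  then show ?case using Suc compress_in \<pi>_compress by metis
qed (simp add: assms)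

text \<open>This is the middle part of a product of two monomials whose inner exponents
  agree.\<close>

lemma sandwich:
  assumes "b \<in> B" "c \<in> B"
  shows "b * v ^ n * cstar (v ^ n) * c \<in> B \<and>
    \<pi> (b * v ^ n * cstar (v ^ n) * c) = \<pi> b * w ^ n * cstar (w ^ n) * \<pi> c"
proof -
  \<comment> \<open>The unit is inserted so that \<open>conj_power\<close> applies: for positive n
    it is absorbed by \<open>v\<close>, for n = 0 by \<open>b\<close>.\<close>
  have "b * v ^ n = b * (v ^ n * e)"
  proof (cases n)
    case (Suc k)
    then show ?thesis by (metis mult.assoc power_Suc2 v_e)
  qed (simp add: assms e_right)
  then have eq: "b * v ^ n * cstar (v ^ n) * c = b * (v ^ n * e * cstar (v ^ n)) * c"
    by (simp add: mult.assoc)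
  define q where "q = v ^ n * e * cstar (v ^ n)"
  have q: "q \<in> B" "\<pi> q = w ^ n * cstar (w ^ n)"
    using conj_power[OF e_in, of n] by (simp_all add: q_def \<pi>_e)
  show ?thesis unfolding eq q_def[symmetric]
    using q assms by (simp add: B_closed \<pi>_simps mult.assoc)
qed

text \<open>\<open>Rel d\<close> is the part of degree \<open>d\<close>, for the gauge action, of the graph of the homomorphism
  under construction. Replacing \<open>b\<close> by \<open>v * b * cstar v\<close> raises \<open>m\<close> and \<open>n\<close> simultaneously.\<close>

definition Rel :: "int \<Rightarrow> ('a \<times> 'd) set" where
  "Rel d = {(cstar (v ^ m) * b * v ^ n, cstar (w ^ m) * \<pi> b * w ^ n) | m n b.
      b \<in> B \<and> int n - int m = d}"

lemma RelI:
  "b \<in> B \<Longrightarrow> int n - int m = d \<Longrightarrow> x = cstar (v ^ m) * b * v ^ n \<Longrightarrow>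
    y = cstar (w ^ m) * \<pi> b * w ^ n \<Longrightarrow> (x, y) \<in> Rel d"
  unfolding Rel_def by blast

lemma Rel_raise:
  assumes "b \<in> B"
  shows "\<exists>b'\<in>B. cstar (v ^ m) * b * v ^ n = cstar (v ^ (i + m)) * b' * v ^ (i + n) \<and>
    cstar (w ^ m) * \<pi> b * w ^ n = cstar (w ^ (i + m)) * \<pi> b' * w ^ (i + n)"
proof (intro bexI conjI)
  let ?b = "v ^ i * b * cstar (v ^ i)"
  show "?b \<in> B" using conj_power[OF assms] by blast
  have "cstar (v ^ (i + m)) * ?b * v ^ (i + n) =
      cstar (v ^ m) * (cstar (v ^ i) * v ^ i * b * cstar (v ^ i) * v ^ i) * v ^ n"
    by (simp add: power_add cstar_mult mult.assoc)
  then show "cstar (v ^ m) * b * v ^ n = cstar (v ^ (i + m)) * ?b * v ^ (i + n)"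
    using assms by (simp add: isometry_power)
  have "cstar (w ^ (i + m)) * (w ^ i * \<pi> b * cstar (w ^ i)) * w ^ (i + n) =
      cstar (w ^ m) * ((cstar (w ^ i) * w ^ i) * \<pi> b * (cstar (w ^ i) * w ^ i)) * w ^ n"
    by (simp add: power_add cstar_mult mult.assoc)
  then show "cstar (w ^ m) * \<pi> b * w ^ n = cstar (w ^ (i + m)) * \<pi> ?b * w ^ (i + n)"
    using conj_power[OF assms, of i] by (simp add: w_isometry_power)
qed

lemma Rel_zero: "(0, 0) \<in> Rel d"
  by (rule RelI[OF zero_in, of "nat d" "nat (- d)"]) (auto simp: \<pi>_zero)

text \<open>Raising the first monomial by the left exponent of the second, and conversely, makes the
  left exponents agree; the right exponents then agree because the degrees do. The two middle
  factors can now be added.\<close>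

lemma Rel_add:
  assumes "(x, y) \<in> Rel d" "(x', y') \<in> Rel d"
  shows "(x + x', y + y') \<in> Rel d"
proof -
  obtain m n b where 1: "b \<in> B" "int n - int m = d" "x = cstar (v ^ m) * b * v ^ n"
    "y = cstar (w ^ m) * \<pi> b * w ^ n" using assms(1) unfolding Rel_def by blast
  obtain k l c where 2: "c \<in> B" "int l - int k = d" "x' = cstar (v ^ k) * c * v ^ l"
    "y' = cstar (w ^ k) * \<pi> c * w ^ l" using assms(2) unfolding Rel_def by blast
  obtain b' where 3: "b' \<in> B" "x = cstar (v ^ (k + m)) * b' * v ^ (k + n)"
    "y = cstar (w ^ (k + m)) * \<pi> b' * w ^ (k + n)" using Rel_raise[OF 1(1), of m n k] 1 by metis
  obtain c' where 4: "c' \<in> B" "x' = cstar (v ^ (m + k)) * c' * v ^ (m + l)"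
    "y' = cstar (w ^ (m + k)) * \<pi> c' * w ^ (m + l)" using Rel_raise[OF 2(1), of k l m] 2 by metis
  have ml: "m + l = k + n" using 1(2) 2(2) by linarith
  show ?thesis
  proof (rule RelI)
    show "b' + c' \<in> B" using 3 4 by (simp add: B_closed)
    show "int (k + n) - int (k + m) = d" using 1(2) by simp
    show "x + x' = cstar (v ^ (k + m)) * (b' + c') * v ^ (k + n)"
      unfolding 3(2) 4(2) ml add.commute[of m k] by (simp only: distrib_left distrib_right)
    show "y + y' = cstar (w ^ (k + m)) * \<pi> (b' + c') * w ^ (k + n)"
      unfolding 3(3) 4(3) ml add.commute[of m k] \<pi>_simps(1)[OF 3(1) 4(1)]
      by (simp only: distrib_left distrib_right)
  qed
qed

text \<open>Here it is the two inner exponents that are matched, by raising each monomial by the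
  inner exponent of the other; \<open>sandwich\<close> absorbs what stands between the middle
  factors.\<close>

lemma Rel_mult:
  assumes "(x, y) \<in> Rel d" "(x', y') \<in> Rel d'"
  shows "(x * x', y * y') \<in> Rel (d + d')"
proof -
  obtain m n b where 1: "b \<in> B" "int n - int m = d" "x = cstar (v ^ m) * b * v ^ n"
    "y = cstar (w ^ m) * \<pi> b * w ^ n" using assms(1) unfolding Rel_def by blast
  obtain k l c where 2: "c \<in> B" "int l - int k = d'" "x' = cstar (v ^ k) * c * v ^ l"
    "y' = cstar (w ^ k) * \<pi> c * w ^ l" using assms(2) unfolding Rel_def by blast
  obtain b' where 3: "b' \<in> B" "x = cstar (v ^ (k + m)) * b' * v ^ (k + n)"
    "y = cstar (w ^ (k + m)) * \<pi> b' * w ^ (k + n)" using Rel_raise[OF 1(1), of m n k] 1 by metis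
  obtain c' where 4: "c' \<in> B" "x' = cstar (v ^ (n + k)) * c' * v ^ (n + l)"
    "y' = cstar (w ^ (n + k)) * \<pi> c' * w ^ (n + l)" using Rel_raise[OF 2(1), of k l n] 2 by metis
  have nk: "n + k = k + n" by simp
  note s = sandwich[OF 3(1) 4(1), of "k + n"]
  show ?thesis
  proof (rule RelI)
    show "b' * v ^ (k + n) * cstar (v ^ (k + n)) * c' \<in> B" using s by blast
    show "int (n + l) - int (k + m) = d + d'" using 1(2) 2(2) by simp
    show "x * x' = cstar (v ^ (k + m)) * (b' * v ^ (k + n) * cstar (v ^ (k + n)) * c') * v ^ (n + l)"
      unfolding 3(2) 4(2) nk by (simp only: mult.assoc)
    show "y * y' = cstar (w ^ (k + m)) * \<pi> (b' * v ^ (k + n) * cstar (v ^ (k + n)) * c') * w ^ (n + l)"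
      unfolding 3(3) 4(3) nk conjunct2[OF s] by (simp only: mult.assoc)
  qed
qed

lemma Rel_scaleC:
  assumes "(x, y) \<in> Rel d"
  shows "(scaleC c x, scaleC c y) \<in> Rel d"
proof -
  obtain m n b where 1: "b \<in> B" "int n - int m = d" "x = cstar (v ^ m) * b * v ^ n"
    "y = cstar (w ^ m) * \<pi> b * w ^ n" using assms(1) unfolding Rel_def by blast
  show ?thesis
  proof (rule RelI)
    show "scaleC c b \<in> B" using 1 by (simp add: B_closed)
    show "int n - int m = d" by fact
    show "scaleC c x = cstar (v ^ m) * scaleC c b * v ^ n"
      unfolding 1(3) by (simp only: mult_scaleC_left mult_scaleC_right)
    show "scaleC c y = cstar (w ^ m) * \<pi> (scaleC c b) * w ^ n"
      unfolding 1(4) \<pi>_simps(3)[OF 1(1)] by (simp only: mult_scaleC_left mult_scaleC_right)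
  qed
qed

lemma Rel_cstar:
  assumes "(x, y) \<in> Rel d"
  shows "(cstar x, cstar y) \<in> Rel (- d)"
proof -
  obtain m n b where 1: "b \<in> B" "int n - int m = d" "x = cstar (v ^ m) * b * v ^ n"
    "y = cstar (w ^ m) * \<pi> b * w ^ n" using assms(1) unfolding Rel_def by blast
  show ?thesis
  proof (rule RelI)
    show "cstar b \<in> B" using 1 by (simp add: B_closed)
    show "int m - int n = - d" using 1(2) by simp
    show "cstar x = cstar (v ^ n) * cstar b * v ^ m"
      unfolding 1(3) by (simp only: cstar_mult cstar_cstar mult.assoc)
    show "cstar y = cstar (w ^ n) * \<pi> (cstar b) * w ^ m"
      unfolding 1(4) \<pi>_simps(4)[OF 1(1)] by (simp only: cstar_mult cstar_cstar mult.assoc)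
  qed
qed

text \<open>In degree 0 both exponents coincide, so the monomial is a compression of an element of
  \<open>B\<close> and the relation is the graph of \<open>\<pi>\<close>.\<close>

lemma Rel_0: "(x, y) \<in> Rel 0 \<Longrightarrow> x \<in> B \<and> y = \<pi> x"
  unfolding Rel_def using compress_power by auto

lemma Rel_norm_le:
  assumes "(x, y) \<in> Rel d"
  shows "norm y \<le> norm x"
proof -
  have "(cstar x * x, cstar y * y) \<in> Rel 0"
    using Rel_mult[OF Rel_cstar[OF assms] assms] by simp
  then have "norm (cstar y * y) \<le> norm (cstar x * x)"
    using star_hom_contractive[OF \<pi>_hom \<pi>_e] by (metis Rel_0)
  then show ?thesis by (simp add: cstar_identity power2_le_iff_abs_le)
qed

text \<open>Conjugation by \<open>u\<close> fixes the middle factor and multiplies each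
  \<open>v\<close> by z and each adjoint of \<open>v\<close> by the conjugate of z, which is the
  inverse of z on the unit circle.\<close>

lemma Rel_gauge:
  assumes z: "cmod z = 1" and u: "cstar u * u = 1" "u * cstar u = 1" "\<And>b. b \<in> B \<Longrightarrow> u * b = b * u"
    "u * v = scaleC z (v * u)" and xy: "(x, y) \<in> Rel d"
  shows "u * x * cstar u = scaleC (z powi d) x"
proof -
  obtain m n b where 1: "b \<in> B" "int n - int m = d" "x = cstar (v ^ m) * b * v ^ n"
    using xy unfolding Rel_def by blast
  have vn: "u * v ^ n * cstar u = scaleC (z ^ n) (v ^ n)" for n
  proof (induction n)
    case (Suc n)
    have "u * v ^ Suc n * cstar u = (u * v) * v ^ n * cstar u" by (simp add: mult.assoc)
    also have "\<dots> = scaleC z (v * (u * v ^ n * cstar u))"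
      unfolding u(4) by (simp add: mult_scaleC_left mult.assoc)
    finally show ?case using Suc by (simp add: mult_scaleC_right scaleC_scaleC)
  qed (simp add: u scaleC_one)
  have vm: "u * cstar (v ^ m) * cstar u = scaleC (cnj z ^ m) (cstar (v ^ m))"
    using arg_cong[OF vn[of m], of cstar] by (simp add: cstar_mult cstar_scaleC cstar_cstar mult.assoc)
  have b: "u * b * cstar u = b" using u 1 by (simp add: mult.assoc)
  have "u * x * cstar u = (u * cstar (v ^ m) * cstar u) * (u * b * cstar u) * (u * v ^ n * cstar u)"
  proof -
    have c: "cstar u * (u * t) = t" for t using u(1) by (simp add: mult.assoc[symmetric])
    show ?thesis unfolding 1(3) by (simp add: mult.assoc c)
  qed
  also have "\<dots> = scaleC (cnj z ^ m * z ^ n) x"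
    unfolding vm vn b 1(3) by (simp add: mult_scaleC_left mult_scaleC_right scaleC_scaleC mult.assoc mult.commute)
  also have "cnj z ^ m * z ^ n = z powi d"
  proof -
    have z0: "z \<noteq> 0" using z by auto
    have "cnj z * z = 1" using z complex_norm_square[of z] by (simp add: mult.commute)
    then have "cnj z = inverse z" using z0 by (simp add: field_simps)
    moreover have "z powi d = z powi int n / z powi int m"
      using z0 1(2) by (metis power_int_diff)
    ultimately show ?thesis by (simp add: divide_inverse power_inverse mult.commute)
  qed
  finally show ?thesis .
qed

end

text \<open>Orthogonality of the characters of a cyclic group of order M. The bound on q excludes
  nonzero multiples of M, so for q other than 0 the sum is geometric with ratio different from 1 and
  vanishes.\<close>

lemma sum_roots_of_unity:
  fixes q :: int
  assumes "0 < M" "\<bar>q\<bar> < int M"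
  shows "(\<Sum>j<M. cis (2 * pi * real j / real M) powi q) = (if q = 0 then of_nat M else 0)"
proof (cases "q = 0")
  case False
  define a where "a = cis (2 * pi * real_of_int q / real M)"
  have eq: "cis (2 * pi * real j / real M) powi q = a ^ j" for j
    unfolding a_def cis_power_int Complex.DeMoivre by (simp add: mult.commute mult.left_commute)
  have "a \<noteq> 1"
  proof
    assume "a = 1"
    then have "cos (2 * pi * real_of_int q / real M) = 1"
      by (metis a_def cis.simps(1) one_complex.simps(1))
    then obtain n :: int where "2 * pi * real_of_int q / real M = of_int n * 2 * pi"
      by (auto simp: cos_one_2pi_int)
    then have "real_of_int q = of_int n * real M" using assms(1) by (simp add: field_simps)
    then have "q = n * int M" by (metis of_int_eq_iff of_int_mult of_int_of_nat_eq)
    moreover have "n \<noteq> 0" using False \<open>q = n * int M\<close> by auto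
    ultimately have "int M \<le> \<bar>q\<bar>"
      by (metis abs_mult abs_of_nat mult_le_cancel_right1 abs_ge_zero int_one_le_iff_zero_less
          not_less zero_less_abs_iff)
    then show False using assms(2) by simp
  qed
  moreover have "a ^ M = 1"
    unfolding a_def Complex.DeMoivre using assms(1) by simp
  ultimately show ?thesis using False
    by (simp add: eq sum_gp_strict)
qed simp

text \<open>If c / a = 1 + \<delta> with \<delta> > 0, Bernoulli's inequality only gives growth
  linear in the exponent, which is no contradiction yet. Squaring it compares the bound at n with
  the hypothesis at n + 1: quadratic growth against a linear bound.\<close>

lemma le_if_powers_le_linear:
  fixes a c :: real and K :: nat
  assumes "0 \<le> a" "0 \<le> c" and le: "\<And>n. c ^ 2 ^ n \<le> (real K * 2 ^ n + 1) * a ^ 2 ^ n"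
  shows "c \<le> a"
proof (rule ccontr)
  assume "\<not> c \<le> a"
  then have ca: "a < c" by simp
  \<comment> \<open>For a = 0 the hypothesis at n = 0 already forces c to be at most 0.\<close>
  have a0: "a > 0"
  proof (rule ccontr)
    assume "\<not> a > 0"
    then show False using le[of 0] ca assms by simp
  qed
  define \<delta> where "\<delta> = c / a - 1"
  have \<delta>: "\<delta> > 0" using ca a0 by (simp add: \<delta>_def)
  have bound: "2 ^ n * \<delta>\<^sup>2 \<le> 2 * real K + 1" for n
  proof -
    have "c / a = 1 + \<delta>" by (simp add: \<delta>_def)
    have "(2 ^ n * \<delta>)\<^sup>2 \<le> (1 + real (2 ^ n) * \<delta>)\<^sup>2"
      using \<delta> by (intro power_mono) auto
    also have "\<dots> \<le> ((1 + \<delta>) ^ 2 ^ n)\<^sup>2"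
      using \<delta> Bernoulli_inequality[of \<delta> "2 ^ n"] by (intro power_mono) auto
    also have "\<dots> = (c / a) ^ 2 ^ Suc n"
      unfolding \<open>c / a = 1 + \<delta>\<close> by (simp add: power_mult mult.commute[of 2])
    also have "\<dots> \<le> real K * 2 ^ Suc n + 1"
      using le[of "Suc n"] a0 by (simp add: power_divide divide_le_eq)
    also have "\<dots> \<le> 2 ^ n * (2 * real K + 1)"
      using one_le_power[of "2::real" n] by (simp add: algebra_simps)
    finally have "2 ^ n * (2 ^ n * \<delta>\<^sup>2) \<le> 2 ^ n * (2 * real K + 1)"
      by (simp add: power2_eq_square algebra_simps)
    then show ?thesis by simp
  qed
  obtain n where "(2 * real K + 1) / \<delta>\<^sup>2 < 2 ^ n"
    using real_arch_pow[of 2 "(2 * real K + 1) / \<delta>\<^sup>2"] by auto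
  then show False using bound[of n] \<delta> by (simp add: divide_less_eq)
qed

lemma sum_fun_upd_add:
  fixes h :: "'i \<Rightarrow> 'z::ab_group_add"
  assumes "d \<in> A" "finite A"
  shows "sum (h(d := t + h d)) A = t + sum h A"
  using assms by (simp add: sum.remove[of _ d] add.assoc)

section \<open>The graph on finite sums of homogeneous elements\<close>

context covariant_rep
begin

text \<open>The index bounds the absolute degrees, not the number of summands, and a degree may
  occur repeatedly. A relation is used since well-definedness of a map is still open here.\<close>

inductive_set Graph :: "nat \<Rightarrow> ('a \<times> 'd) set" for N where
  zero: "(0, 0) \<in> Graph N"
| add: "\<lbrakk>(x, y) \<in> Rel d; \<bar>d\<bar> \<le> int N; (x', y') \<in> Graph N\<rbrakk> \<Longrightarrow> (x + x', y + y') \<in> Graph N"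

text \<open>Summands of equal degree are merged by \<open>Rel_add\<close>, leaving one pair per
  degree; the count 2 N + 1 in the norm bound depends on this.\<close>

lemma Graph_decompose:
  assumes "(x, y) \<in> Graph N"
  shows "\<exists>f g. (\<forall>d. (f d, g d) \<in> Rel d) \<and> x = (\<Sum>d = - int N..int N. f d) \<and>
    y = (\<Sum>d = - int N..int N. g d)"
  using assms
proof induction
  case zero
  show ?case by (rule exI[of _ "\<lambda>_. 0"], rule exI[of _ "\<lambda>_. 0"]) (auto simp: Rel_zero)
next
  case (add x y d x' y')
  then obtain f g where fg: "\<And>d. (f d, g d) \<in> Rel d" "x' = (\<Sum>d = - int N..int N. f d)"
    "y' = (\<Sum>d = - int N..int N. g d)" by blast
  have d: "d \<in> {- int N..int N}" using add.hyps by auto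
  let ?f = "f(d := x + f d)" and ?g = "g(d := y + g d)"
  have "\<forall>d. (?f d, ?g d) \<in> Rel d" using fg(1) add.hyps Rel_add by auto
  then show ?case using fg d sum_fun_upd_add[of d "{- int N..int N}" f x] sum_fun_upd_add[of d "{- int N..int N}" g y] by (metis finite_atLeastAtMost_int)
qed

lemma Graph_norm_le_linear:
  assumes "(x, y) \<in> Graph N"
  shows "norm y \<le> (2 * real N + 1) * norm x"
proof -
  obtain f g where fg: "\<And>d. (f d, g d) \<in> Rel d" "x = (\<Sum>d = - int N..int N. f d)"
    "y = (\<Sum>d = - int N..int N. g d)" using Graph_decompose[OF assms] by blast
  \<comment> \<open>Two degrees in the range differ by at most 2 N, so the roots of unity of order 2
    N + 1 separate them all.\<close>
  define M where "M = 2 * N + 1"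
  have M: "0 < M" by (simp add: M_def)
  define z where "z j = cis (2 * pi * real j / real M)" for j
  have z1: "cmod (z j) = 1" for j by (simp add: z_def)
  obtain u where u: "\<And>j. cstar (u j) * u j = 1" "\<And>j. u j * cstar (u j) = 1"
    "\<And>j b. b \<in> B \<Longrightarrow> u j * b = b * u j" "\<And>j. u j * v = scaleC (z j) (v * u j)"
    using gauge[OF z1] by metis
  \<comment> \<open>Discrete Fourier inversion: the conjugates of \<open>x\<close> under the gauge
    unitaries, weighted by z_j to the power -k and summed, give M times the component of degree k,
    while each conjugate has norm at most \<open>norm x\<close>.\<close>
  have comp: "norm (f k) \<le> norm x" if k: "k \<in> {- int N..int N}" for k
  proof -
    have "(\<Sum>j<M. scaleC (z j powi (- k)) (u j * x * cstar (u j))) =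
        (\<Sum>j<M. \<Sum>d = - int N..int N. scaleC (z j powi (d - k)) (f d))"
    proof (rule sum.cong[OF refl])
      fix j
      have z0: "z j \<noteq> 0" using z1[of j] by auto
      have "u j * x * cstar (u j) = (\<Sum>d = - int N..int N. u j * f d * cstar (u j))"
        unfolding fg(2) by (simp add: sum_distrib_left sum_distrib_right)
      also have "\<dots> = (\<Sum>d = - int N..int N. scaleC (z j powi d) (f d))"
        using Rel_gauge[OF z1 u(1) u(2) u(3) u(4) fg(1)] by simp
      finally show "scaleC (z j powi (- k)) (u j * x * cstar (u j)) =
          (\<Sum>d = - int N..int N. scaleC (z j powi (d - k)) (f d))"
        using z0 by (simp add: scaleC_sum_right scaleC_scaleC power_int_add[symmetric])
    qed
    also have "\<dots> = (\<Sum>d = - int N..int N. scaleC (\<Sum>j<M. z j powi (d - k)) (f d))"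
      by (subst sum.swap) (simp add: scaleC_sum_left)
    also have "\<dots> = (\<Sum>d = - int N..int N. if d = k then scaleC (of_nat M) (f k) else 0)"
    proof (rule sum.cong[OF refl])
      fix d assume "d \<in> {- int N..int N}"
      then have "\<bar>d - k\<bar> < int M" using k by (auto simp: M_def)
      then show "scaleC (\<Sum>j<M. z j powi (d - k)) (f d) = (if d = k then scaleC (of_nat M) (f k) else 0)"
        unfolding z_def using sum_roots_of_unity[OF M, of "d - k"] by simp
    qed
    also have "\<dots> = scaleC (of_nat M) (f k)" using k by simp
    finally have "norm (scaleC (of_nat M) (f k)) \<le>
        (\<Sum>j<M. norm (scaleC (z j powi (- k)) (u j * x * cstar (u j))))"
      by (metis norm_sum)
    also have "\<dots> \<le> (\<Sum>j<M. norm x)"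
    proof (rule sum_mono)
      fix j
      have "norm (u j) = 1" using u(1) by (rule norm_isometry)
      then have "norm (u j * x * cstar (u j)) \<le> norm x"
        by (metis mult.left_neutral mult.right_neutral norm_cstar norm_mult_ineq order_trans)
      then show "norm (scaleC (z j powi (- k)) (u j * x * cstar (u j))) \<le> norm x"
        using z1 by (simp add: norm_scaleC norm_power_int)
    qed
    finally show ?thesis using M by (simp add: norm_scaleC)
  qed
  have "norm y \<le> (\<Sum>d = - int N..int N. norm (g d))" unfolding fg(3) by (rule norm_sum)
  also have "\<dots> \<le> (\<Sum>d = - int N..int N. norm x)"
    using Rel_norm_le[OF fg(1)] comp by (intro sum_mono) (meson order_trans)
  finally show ?thesis by (simp add: nat_add_distrib algebra_simps)
qed

lemma Graph_add:
  assumes "(x, y) \<in> Graph N" "(x', y') \<in> Graph M"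
  shows "(x + x', y + y') \<in> Graph (N + M)"
  using assms
proof induction
  \<comment> \<open>The base case is monotonicity of \<open>Graph\<close> in its bound and takes an
    induction of its own.\<close>
  case zero
  from zero show ?case
  proof induction
    case (add x y d x' y')
    then show ?case using Graph.add[of x y d "N + M" "0 + x'" "0 + y'"] by simp
  qed (simp add: Graph.zero)
next
  case (add x y d x'' y'')
  then show ?case using Graph.add[of x y d "N + M" "x'' + x'" "y'' + y'"] by (simp add: add.assoc)
qed

lemma Graph_Rel:
  assumes "(x, y) \<in> Rel d"
  shows "(x, y) \<in> Graph (nat \<bar>d\<bar>)"
  using Graph.add[OF assms _ Graph.zero, of "nat \<bar>d\<bar>"] by simp

text \<open>Unlike \<open>Graph_add\<close> this leaves the bound unchanged, as is required when the
  terms of a product are collected in \<open>Graph_mult\<close>.\<close>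

lemma Graph_add_same:
  assumes "(x, y) \<in> Graph N" "(x', y') \<in> Graph N"
  shows "(x + x', y + y') \<in> Graph N"
  using assms
proof induction
  case (add x y d x'' y'')
  then show ?case using Graph.add[of x y d N "x'' + x'" "y'' + y'"] by (simp add: add.assoc)
qed simp

lemma Graph_mult:
  assumes "(x, y) \<in> Graph N" "(x', y') \<in> Graph M"
  shows "(x * x', y * y') \<in> Graph (N + M)"
  using assms
proof induction
  case (add x y d x'' y'')
  have "(x * x', y * y') \<in> Graph (N + M)"
    using add.prems
  proof induction
    case (add p q d' p' q')
    then show ?case
      using Graph.add[OF Rel_mult[OF \<open>(x, y) \<in> Rel d\<close> add.hyps(1)], of "N + M" "x * p'" "y * q'"]
        \<open>\<bar>d\<bar> \<le> int N\<close> by (simp add: distrib_left)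
  qed (simp add: Graph.zero)
  then show ?case using add.IH[OF add.prems] Graph_add_same by (simp add: distrib_right)
qed (simp add: Graph.zero)

lemma Graph_scaleC: "(x, y) \<in> Graph N \<Longrightarrow> (scaleC c x, scaleC c y) \<in> Graph N"
proof (induction rule: Graph.induct)
  case zero
  show ?case using Graph.zero by (metis mult_scaleC_left mult_zero_right mult_scaleC_right)
next
  case (add x y d x' y')
  then show ?case using Graph.add[OF Rel_scaleC] by (simp add: scaleC_add_right)
qed

lemma Graph_cstar: "(x, y) \<in> Graph N \<Longrightarrow> (cstar x, cstar y) \<in> Graph N"
proof (induction rule: Graph.induct)
  case (add x y d x' y')
  then show ?case using Graph.add[OF Rel_cstar] by (simp add: cstar_add)
qed (simp add: Graph.zero)

text \<open>Positive powers only: the zeroth power is the ambient unit 1, while degree 0 consists of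
  elements of \<open>B\<close>.\<close>

lemma Graph_power: "(x, y) \<in> Graph N \<Longrightarrow> (x ^ Suc k, y ^ Suc k) \<in> Graph (N * Suc k)"
proof (induction k)
  case (Suc k)
  then show ?case using Graph_mult[of x y N "x ^ Suc k" "y ^ Suc k" "N * Suc k"] by simp
qed simp

lemma Graph_norm_le:
  assumes "(x, y) \<in> Graph N"
  shows "norm y \<le> norm x"
proof -
  define a where "a = cstar x * x"
  define c where "c = cstar y * y"
  have ac: "(a, c) \<in> Graph (N + N)"
    unfolding a_def c_def by (rule Graph_mult[OF Graph_cstar[OF assms] assms])
  have sa: "cstar a = a" "cstar c = c"
    by (simp_all add: a_def c_def cstar_mult cstar_cstar)
  have "norm c \<le> norm a"
  \<comment> \<open>Since \<open>a\<close> has bound 2 N, its power with exponent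
    \<open>2 ^ n\<close> has bound 2 N times \<open>2 ^ n\<close>; the linear estimate doubles this
    once more, whence 4 N.\<close>
  proof (rule le_if_powers_le_linear[where K = "4 * N"])
    fix n :: nat
    have "(a ^ 2 ^ n, c ^ 2 ^ n) \<in> Graph ((N + N) * 2 ^ n)"
      using Graph_power[OF ac, of "2 ^ n - 1"] by simp
    from Graph_norm_le_linear[OF this]
    show "norm c ^ 2 ^ n \<le> (real (4 * N) * 2 ^ n + 1) * norm a ^ 2 ^ n"
      using sa by (simp add: norm_power_selfadjoint algebra_simps)
  qed auto
  then show ?thesis by (simp add: a_def c_def cstar_identity power2_le_iff_abs_le)
qed

text \<open>The closure is taken in the product space. The estimate \<open>Graph_norm_le\<close>
  survives limits, so the closed relation is still single-valued.\<close>

definition GraphC :: "('a \<times> 'd) set" where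
  "GraphC = closure (\<Union>N. Graph N)"

lemma GraphC_iff: "(x, y) \<in> GraphC \<longleftrightarrow>
    (\<exists>X Y. (\<forall>k. \<exists>N. (X k, Y k) \<in> Graph N) \<and> X \<longlonglongrightarrow> x \<and> Y \<longlonglongrightarrow> y)"
proof
  assume "(x, y) \<in> GraphC"
  then obtain Z where Z: "\<And>k. Z k \<in> (\<Union>N. Graph N)" "Z \<longlonglongrightarrow> (x, y)"
    unfolding GraphC_def closure_sequential by blast
  have "(\<lambda>k. fst (Z k)) \<longlonglongrightarrow> x" "(\<lambda>k. snd (Z k)) \<longlonglongrightarrow> y"
    using tendsto_fst[OF Z(2)] tendsto_snd[OF Z(2)] by simp_all
  then show "\<exists>X Y. (\<forall>k. \<exists>N. (X k, Y k) \<in> Graph N) \<and> X \<longlonglongrightarrow> x \<and> Y \<longlonglongrightarrow> y"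
    using Z(1) by (intro exI[of _ "\<lambda>k. fst (Z k)"] exI[of _ "\<lambda>k. snd (Z k)"]) auto
next
  assume "\<exists>X Y. (\<forall>k. \<exists>N. (X k, Y k) \<in> Graph N) \<and> X \<longlonglongrightarrow> x \<and> Y \<longlonglongrightarrow> y"
  then obtain X Y where "\<forall>k. \<exists>N. (X k, Y k) \<in> Graph N" "X \<longlonglongrightarrow> x" "Y \<longlonglongrightarrow> y" by blast
  then show "(x, y) \<in> GraphC"
    unfolding GraphC_def closure_sequential
    by (intro exI[of _ "\<lambda>k. (X k, Y k)"]) (auto intro: tendsto_Pair)
qed

lemma GraphC_ops:
  assumes "(x, y) \<in> GraphC"
  shows "norm y \<le> norm x"
    and "(scaleC c x, scaleC c y) \<in> GraphC"
    and "(cstar x, cstar y) \<in> GraphC"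
    and "(x', y') \<in> GraphC \<Longrightarrow> (x + x', y + y') \<in> GraphC"
    and "(x', y') \<in> GraphC \<Longrightarrow> (x * x', y * y') \<in> GraphC"
proof -
  obtain X Y where XY: "\<forall>k. \<exists>N. (X k, Y k) \<in> Graph N" "X \<longlonglongrightarrow> x" "Y \<longlonglongrightarrow> y"
    using assms by (auto simp: GraphC_iff)
  show "norm y \<le> norm x"
  proof (rule LIMSEQ_le[OF tendsto_norm[OF XY(3)] tendsto_norm[OF XY(2)]])
    show "\<exists>N. \<forall>n\<ge>N. norm (Y n) \<le> norm (X n)" using XY(1) Graph_norm_le by blast
  qed
  show "(scaleC c x, scaleC c y) \<in> GraphC"
    unfolding GraphC_iff
    by (rule exI[of _ "\<lambda>k. scaleC c (X k)"], rule exI[of _ "\<lambda>k. scaleC c (Y k)"])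
      (intro conjI allI tendsto_scaleC XY, metis XY(1) Graph_scaleC)
  show "(cstar x, cstar y) \<in> GraphC"
    unfolding GraphC_iff
    by (rule exI[of _ "\<lambda>k. cstar (X k)"], rule exI[of _ "\<lambda>k. cstar (Y k)"])
      (intro conjI allI tendsto_cstar XY, metis XY(1) Graph_cstar)
  assume "(x', y') \<in> GraphC"
  then obtain X' Y' where XY': "\<forall>k. \<exists>N. (X' k, Y' k) \<in> Graph N" "X' \<longlonglongrightarrow> x'" "Y' \<longlonglongrightarrow> y'"
    by (auto simp: GraphC_iff)
  show "(x + x', y + y') \<in> GraphC"
    unfolding GraphC_iff
    by (rule exI[of _ "\<lambda>k. X k + X' k"], rule exI[of _ "\<lambda>k. Y k + Y' k"])
      (intro conjI allI tendsto_add XY XY', metis XY(1) XY'(1) Graph_add)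
  show "(x * x', y * y') \<in> GraphC"
    unfolding GraphC_iff
    by (rule exI[of _ "\<lambda>k. X k * X' k"], rule exI[of _ "\<lambda>k. Y k * Y' k"])
      (intro conjI allI tendsto_mult XY XY', metis XY(1) XY'(1) Graph_mult)
qed

lemma GraphC_diff:
  assumes "(x, y) \<in> GraphC" "(x', y') \<in> GraphC"
  shows "(x - x', y - y') \<in> GraphC"
  using GraphC_ops(4)[OF assms(1) GraphC_ops(2)[OF assms(2), of "- 1"]]
  by (simp add: scaleC_minus_one)

lemma GraphC_unique:
  assumes "(x, y) \<in> GraphC" "(x, y') \<in> GraphC"
  shows "y = y'"
  using GraphC_ops(1)[OF GraphC_diff[OF assms]] by simp

text \<open>Contractivity turns a convergent sequence of arguments into a Cauchy sequence of values,
  which converges since the target is complete; the limit pair lies in the closed relation.\<close>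

lemma closed_Domain_GraphC: "closed (Domain GraphC)"
  unfolding closed_sequential_limits
proof (intro allI impI, elim conjE)
  fix X x assume X: "\<forall>n. X n \<in> Domain GraphC" "X \<longlonglongrightarrow> x"
  then obtain Y where Y: "\<And>n. (X n, Y n) \<in> GraphC" by (simp add: Domain_iff) metis
  have "Cauchy Y"
  proof (rule metric_CauchyI)
    fix \<epsilon> :: real assume "\<epsilon> > 0"
    then obtain N where N: "\<And>m n. m \<ge> N \<Longrightarrow> n \<ge> N \<Longrightarrow> dist (X m) (X n) < \<epsilon>"
      using LIMSEQ_imp_Cauchy[OF X(2)] metric_CauchyD by blast
    have "dist (Y m) (Y n) \<le> dist (X m) (X n)" for m n
      using GraphC_ops(1)[OF GraphC_diff[OF Y Y]] by (simp add: dist_norm)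
    then show "\<exists>M. \<forall>m\<ge>M. \<forall>n\<ge>M. dist (Y m) (Y n) < \<epsilon>" using N by (meson le_less_trans)
  qed
  then obtain y where "Y \<longlonglongrightarrow> y" using Cauchy_convergent convergent_def by blast
  with X(2) have "(\<lambda>n. (X n, Y n)) \<longlonglongrightarrow> (x, y)" by (rule tendsto_Pair)
  moreover have "closed GraphC" by (simp add: GraphC_def)
  ultimately have "(x, y) \<in> GraphC" using closed_sequentially[OF _ Y] by simp
  then show "x \<in> Domain GraphC" by (rule DomainI)
qed

lemma subalg_Domain_GraphC: "cstar_subalg (Domain GraphC)"
  unfolding cstar_subalg_def
  by (intro conjI closed_Domain_GraphC ballI allI) (metis Domain_iff GraphC_ops(2-5))+

lemma Rel_GraphC: "(x, y) \<in> Rel d \<Longrightarrow> (x, y) \<in> GraphC"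
  unfolding GraphC_def by (rule subsetD[OF closure_subset], rule UN_I[OF UNIV_I], rule Graph_Rel)

text \<open>The domain of the closed relation is a C*-subalgebra containing \<open>v\<close> and
  \<open>B\<close>, hence the whole generated algebra.\<close>

theorem extension_exists:
  "\<exists>\<rho> :: 'a \<Rightarrow> 'd. star_hom_on (cstar_generated (insert v B)) \<rho> \<and> (\<forall>b\<in>B. \<rho> b = \<pi> b) \<and> \<rho> v = w"
proof -
  define \<rho> where "\<rho> x = (THE y. (x, y) \<in> GraphC)" for x
  have \<rho>I: "\<rho> x = y" if "(x, y) \<in> GraphC" for x y
    unfolding \<rho>_def using that GraphC_unique by blast
  have \<rho>: "(x, \<rho> x) \<in> GraphC" if "x \<in> Domain GraphC" for x
    using that \<rho>I by auto
  have bB: "(b, \<pi> b) \<in> GraphC" if "b \<in> B" for b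
    by (rule Rel_GraphC, rule RelI[OF that, of 0 0]) auto
  \<comment> \<open>\<open>v\<close> is the monomial with left exponent 0, middle factor
    \<open>e\<close> and right exponent 1.\<close>
  have vw: "(v, w) \<in> GraphC"
    by (rule Rel_GraphC, rule RelI[OF e_in, of 1 0]) (auto simp: e_v \<pi>_e)
  have "cstar_generated (insert v B) \<subseteq> Domain GraphC"
    using bB vw by (intro cstar_generated_least subalg_Domain_GraphC) auto
  moreover have "star_hom_on (Domain GraphC) \<rho>"
    unfolding star_hom_on_def by (intro conjI ballI allI \<rho>I GraphC_ops \<rho>)
  ultimately have "star_hom_on (cstar_generated (insert v B)) \<rho>"
    unfolding star_hom_on_def by (meson subsetD)
  then show ?thesis using \<rho>I[OF bB] \<rho>I[OF vw] by auto
qed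

end

section \<open>The Hilbert space of square-summable families\<close>

abbreviation sq_summable :: "('i \<Rightarrow> complex) \<Rightarrow> bool" where
  "sq_summable f \<equiv> (\<lambda>i. (cmod (f i))\<^sup>2) summable_on UNIV"

lemma sq_summableI:
  assumes "\<And>F. finite F \<Longrightarrow> (\<Sum>i\<in>F. (cmod (f i))\<^sup>2) \<le> C"
  shows "sq_summable f" "(\<Sum>\<^sub>\<infinity>i. (cmod (f i))\<^sup>2) \<le> C"
proof -
  show s: "sq_summable f"
    by (rule nonneg_bdd_above_summable_on) (use assms in \<open>auto intro!: bdd_aboveI2\<close>)
  show "(\<Sum>\<^sub>\<infinity>i. (cmod (f i))\<^sup>2) \<le> C"
    by (rule infsum_le_finite_sums[OF s]) (use assms in auto)
qed

lemma sq_summable_add: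
  assumes "sq_summable f" "sq_summable g"
  shows "sq_summable (\<lambda>i. f i + g i)"
proof (rule summable_on_comparison_test)
  show "(\<lambda>i. 2 * ((cmod (f i))\<^sup>2 + (cmod (g i))\<^sup>2)) summable_on UNIV"
    by (intro summable_on_cmult_right summable_on_add assms)
  show "(cmod (f i + g i))\<^sup>2 \<le> 2 * ((cmod (f i))\<^sup>2 + (cmod (g i))\<^sup>2)" for i
  proof -
    have "(cmod (f i + g i))\<^sup>2 \<le> (cmod (f i) + cmod (g i))\<^sup>2"
      by (intro power_mono norm_triangle_ineq) auto
    also have "\<dots> \<le> 2 * ((cmod (f i))\<^sup>2 + (cmod (g i))\<^sup>2)"
      using sum_squares_bound[of "cmod (f i)" "cmod (g i)"] by (simp add: power2_sum)
    finally show ?thesis .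
  qed
qed auto

lemma sq_summable_cmult: "sq_summable f \<Longrightarrow> sq_summable (\<lambda>i. c * f i)"
  by (simp add: norm_mult power_mult_distrib summable_on_cmult_right)

lemma summable_on_mult_cnj:
  assumes "sq_summable f" "sq_summable g"
  shows "(\<lambda>i. f i * cnj (g i)) summable_on UNIV"
proof (rule abs_summable_summable, rule summable_on_comparison_test)
  show "(\<lambda>i. (cmod (f i))\<^sup>2 + (cmod (g i))\<^sup>2) summable_on UNIV"
    by (intro summable_on_add assms)
  show "cmod (f i * cnj (g i)) \<le> (cmod (f i))\<^sup>2 + (cmod (g i))\<^sup>2" for i
  proof -
    have "2 * cmod (f i) * cmod (g i) \<le> (cmod (f i))\<^sup>2 + (cmod (g i))\<^sup>2"
      by (rule sum_squares_bound)
    moreover have "0 \<le> cmod (f i) * cmod (g i)" by simp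
    ultimately show ?thesis by (simp only: norm_mult complex_mod_cnj)
  qed
qed auto

typedef 'i ell2 = "{f :: 'i \<Rightarrow> complex. sq_summable f}"
  morphisms coord Ell2
  by (auto intro!: exI[of _ "\<lambda>_. 0"])

setup_lifting type_definition_ell2

lemma sq_summable_coord [simp]: "sq_summable (coord x)"
  using coord[of x] by simp

lemma ell2_eqI: "(\<And>i. coord x i = coord y i) \<Longrightarrow> x = y"
  by (simp add: coord_inject[symmetric] ext)

lemma coord_Ell2: "sq_summable f \<Longrightarrow> coord (Ell2 f) = f"
  by (simp add: Ell2_inverse)

lift_definition cscale :: "complex \<Rightarrow> 'i ell2 \<Rightarrow> 'i ell2" is "\<lambda>c f i. c * f i"
  by (rule sq_summable_cmult)

definition cinner :: "'i ell2 \<Rightarrow> 'i ell2 \<Rightarrow> complex" where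
  "cinner x y = (\<Sum>\<^sub>\<infinity>i. coord x i * cnj (coord y i))"

instantiation ell2 :: (type) real_inner
begin

lift_definition zero_ell2 :: "'a ell2" is "\<lambda>_. 0" by simp
lift_definition plus_ell2 :: "'a ell2 \<Rightarrow> 'a ell2 \<Rightarrow> 'a ell2" is "\<lambda>f g i. f i + g i"
  by (rule sq_summable_add)
lift_definition uminus_ell2 :: "'a ell2 \<Rightarrow> 'a ell2" is "\<lambda>f i. - f i" by simp
definition minus_ell2 :: "'a ell2 \<Rightarrow> 'a ell2 \<Rightarrow> 'a ell2" where "minus_ell2 x y = x + - y"
definition scaleR_ell2 :: "real \<Rightarrow> 'a ell2 \<Rightarrow> 'a ell2" where "scaleR_ell2 r x = cscale (complex_of_real r) x"
definition inner_ell2 :: "'a ell2 \<Rightarrow> 'a ell2 \<Rightarrow> real" where "inner_ell2 x y = Re (cinner x y)"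
definition norm_ell2 :: "'a ell2 \<Rightarrow> real" where "norm_ell2 x = sqrt (inner x x)"
definition sgn_ell2 :: "'a ell2 \<Rightarrow> 'a ell2" where "sgn_ell2 x = scaleR (inverse (norm x)) x"
definition dist_ell2 :: "'a ell2 \<Rightarrow> 'a ell2 \<Rightarrow> real" where "dist_ell2 x y = norm (x - y)"
definition "(uniformity :: ('a ell2 \<times> 'a ell2) filter) = (INF e\<in>{0 <..}. principal {(x, y). dist x y < e})"
definition open_ell2 :: "'a ell2 set \<Rightarrow> bool" where
  "open_ell2 S = (\<forall>x\<in>S. \<forall>\<^sub>F (x', y) in uniformity. x' = x \<longrightarrow> y \<in> S)"

lemma coord_simps:
  "coord (0 :: 'a ell2) i = 0" "coord (x + y) i = coord x i + coord y i"
  "coord (- x) i = - coord x i" "coord (x - y) i = coord x i - coord y i"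
  "coord (r *\<^sub>R x) i = complex_of_real r * coord x i" "coord (cscale c x) i = c * coord x i"
  for x y :: "'a ell2"
  by (simp_all add: zero_ell2.rep_eq plus_ell2.rep_eq uminus_ell2.rep_eq minus_ell2_def scaleR_ell2_def
      cscale.rep_eq)

lemma summable_cinner: "(\<lambda>i. coord x i * cnj (coord y i)) summable_on UNIV"
  by (rule summable_on_mult_cnj) simp_all

lemma cinner_commute: "cinner x y = cnj (cinner y x)"
  unfolding cinner_def by (subst infsum_cnj[symmetric]) (simp add: mult.commute)

lemma cinner_add_left: "cinner (x + y) z = cinner x z + cinner y z" for x y z :: "'a ell2"
  unfolding cinner_def by (simp add: coord_simps distrib_right infsum_add summable_cinner)

lemma cinner_cscale_left: "cinner (cscale c x) y = c * cinner x y" for x y :: "'a ell2"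
  unfolding cinner_def by (simp add: coord_simps mult.assoc infsum_cmult_right')

lemma cinner_self: "cinner x x = complex_of_real (\<Sum>\<^sub>\<infinity>i. (cmod (coord x i))\<^sup>2)"
proof -
  have "(\<lambda>i. coord x i * cnj (coord x i)) = (\<lambda>i. complex_of_real ((cmod (coord x i))\<^sup>2))"
    by (simp add: complex_norm_square[symmetric] del: of_real_power)
  then show ?thesis unfolding cinner_def
    by (simp only: infsumI[OF has_sum_of_real[OF has_sum_infsum[OF sq_summable_coord]]])
qed

instance
proof
  fix x y z :: "'a ell2" and r q :: real
  show "x + y + z = x + (y + z)" "x + y = y + x" "0 + x = x" "- x + x = 0"
    "r *\<^sub>R (x + y) = r *\<^sub>R x + r *\<^sub>R y" "(r + q) *\<^sub>R x = r *\<^sub>R x + q *\<^sub>R x"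
    "r *\<^sub>R q *\<^sub>R x = (r * q) *\<^sub>R x" "1 *\<^sub>R x = x"
    by (auto intro!: ell2_eqI simp: coord_simps algebra_simps)
  show "x - y = x + - y" by (simp add: minus_ell2_def)
  show "dist x y = norm (x - y)" by (simp add: dist_ell2_def)
  show "sgn x = inverse (norm x) *\<^sub>R x" by (simp add: sgn_ell2_def)
  show "inner x y = inner y x" unfolding inner_ell2_def by (subst cinner_commute) simp
  show "inner (x + y) z = inner x z + inner y z" by (simp add: inner_ell2_def cinner_add_left)
  show "inner (r *\<^sub>R x) y = r * inner x y" by (simp add: inner_ell2_def scaleR_ell2_def cinner_cscale_left)
  show "0 \<le> inner x x" by (simp add: inner_ell2_def cinner_self infsum_nonneg)
  show "(inner x x = 0) = (x = 0)"
  proof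
    assume "inner x x = 0"
    then have "(\<Sum>\<^sub>\<infinity>i. (cmod (coord x i))\<^sup>2) = 0" by (simp add: inner_ell2_def cinner_self)
    then have "(cmod (coord x i))\<^sup>2 = 0" for i
      by (intro nonneg_infsum_le_0D[of "\<lambda>i. (cmod (coord x i))\<^sup>2" UNIV]) auto
    then show "x = 0" by (intro ell2_eqI) (simp add: coord_simps)
  qed (simp add: inner_ell2_def cinner_self coord_simps)
  show "norm x = sqrt (inner x x)" by (simp add: norm_ell2_def)
qed (simp_all add: uniformity_ell2_def open_ell2_def)

end

lemma norm_ell2_eq: "norm x = sqrt (\<Sum>\<^sub>\<infinity>i. (cmod (coord x i))\<^sup>2)"
  by (simp add: norm_ell2_def inner_ell2_def cinner_self)

lemma norm_ell2_sq: "(norm x)\<^sup>2 = (\<Sum>\<^sub>\<infinity>i. (cmod (coord x i))\<^sup>2)"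
  by (simp add: norm_ell2_eq infsum_nonneg)

lemma cinner_self_norm: "cinner x x = complex_of_real ((norm x)\<^sup>2)"
  by (simp add: cinner_self norm_ell2_sq)

lemma finite_sum_le_norm:
  assumes "finite F"
  shows "(\<Sum>i\<in>F. (cmod (coord x i))\<^sup>2) \<le> (norm x)\<^sup>2"
  unfolding norm_ell2_sq using assms by (intro finite_sum_le_infsum) auto

lemma Ell2_bound:
  assumes "\<And>F. finite F \<Longrightarrow> (\<Sum>i\<in>F. (cmod (f i))\<^sup>2) \<le> C\<^sup>2" "0 \<le> C"
  shows "coord (Ell2 f) = f" "norm (Ell2 f) \<le> C"
proof -
  show c: "coord (Ell2 f) = f" using sq_summableI(1)[OF assms(1)] by (rule coord_Ell2)
  have "(norm (Ell2 f))\<^sup>2 \<le> C\<^sup>2" unfolding norm_ell2_sq c by (rule sq_summableI(2)[OF assms(1)])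
  then show "norm (Ell2 f) \<le> C" using assms(2) by (rule power2_le_imp_le)
qed

lemma coord_le_norm: "cmod (coord x i) \<le> norm x"
proof -
  have "(cmod (coord x i))\<^sup>2 \<le> (norm x)\<^sup>2" using finite_sum_le_norm[of "{i}" x] by simp
  then show ?thesis by (rule power2_le_imp_le) simp
qed

lemma cscale_simps:
  "cscale c (x + y) = cscale c x + cscale c y" "cscale (c + d) x = cscale c x + cscale d x"
  "cscale c (cscale d x) = cscale (c * d) x" "cscale 1 x = x" "cscale c 0 = 0"
  "cscale (complex_of_real r) x = r *\<^sub>R x" "cscale c (r *\<^sub>R x) = r *\<^sub>R cscale c x"
  by (auto intro!: ell2_eqI simp: coord_simps algebra_simps)

lemma norm_cscale: "norm (cscale c x) = cmod c * norm x"
  by (simp add: norm_ell2_eq coord_simps norm_mult power_mult_distrib infsum_cmult_right' real_sqrt_mult)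

lemma cinner_right:
  "cinner x (y + z) = cinner x y + cinner x z" "cinner x (cscale c y) = cnj c * cinner x y"
  by (metis cinner_add_left cinner_commute complex_cnj_add)
     (metis cinner_commute cinner_cscale_left complex_cnj_mult)

lemma cinner_zero [simp]: "cinner 0 x = 0" "cinner x 0 = 0"
  by (simp_all add: cinner_def coord_simps)

lemma cinner_le_norm: "cmod (cinner x y) \<le> norm x * norm y"
proof (cases "cinner x y = 0")
  case False
  define c where "c = cnj (cinner x y) / cmod (cinner x y)"
  have "c * cinner x y = complex_of_real (cmod (cinner x y))"
    using False complex_norm_square[of "cinner x y"]
    by (simp add: c_def field_simps power2_eq_square)
  then have "cmod (cinner x y) = inner (cscale c x) y"
    by (simp add: inner_ell2_def cinner_cscale_left)
  also have "\<dots> \<le> norm (cscale c x) * norm y" by (rule norm_cauchy_schwarz)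
  also have "norm (cscale c x) = norm x" using False by (simp add: norm_cscale c_def norm_divide)
  finally show ?thesis .
qed simp

lemma cinner_eqI: "(\<And>y. cinner x y = cinner x' y) \<Longrightarrow> x = x'"
proof -
  assume h: "\<And>y. cinner x y = cinner x' y"
  have "inner (x - x') (x - x') = 0"
    unfolding inner_diff_left unfolding inner_ell2_def using h by simp
  then show ?thesis by simp
qed

instance ell2 :: (type) banach
proof
  fix X :: "nat \<Rightarrow> 'a ell2"
  assume X: "Cauchy X"
  have "Cauchy (\<lambda>n. coord (X n) i)" for i
  proof (rule metric_CauchyI)
    fix \<epsilon> :: real assume "\<epsilon> > 0"
    then obtain N where "\<forall>m\<ge>N. \<forall>n\<ge>N. dist (X m) (X n) < \<epsilon>" using metric_CauchyD[OF X] by blast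
    moreover have "dist (coord (X m) i) (coord (X n) i) \<le> dist (X m) (X n)" for m n
      using coord_le_norm[of "X m - X n" i] by (simp add: dist_norm coord_simps)
    ultimately show "\<exists>M. \<forall>m\<ge>M. \<forall>n\<ge>M. dist (coord (X m) i) (coord (X n) i) < \<epsilon>"
      by (meson le_less_trans)
  qed
  then have "\<exists>l. (\<lambda>n. coord (X n) i) \<longlonglongrightarrow> l" for i by (simp add: Cauchy_convergent_iff convergent_def)
  then obtain f where f: "\<And>i. (\<lambda>n. coord (X n) i) \<longlonglongrightarrow> f i" by metis
  \<comment> \<open>Finite partial sums pass to the coordinatewise limit; the bound is uniform in F
    and so extends to the full sum.\<close>
  have bound: "(\<Sum>i\<in>F. (cmod (f i - coord (X n) i))\<^sup>2) \<le> \<epsilon>\<^sup>2"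
    if N: "\<And>m. m \<ge> N \<Longrightarrow> dist (X m) (X n) < \<epsilon>" and F: "finite F" for \<epsilon> N n F
  proof (rule tendsto_upperbound)
    show "(\<lambda>m. \<Sum>i\<in>F. (cmod (coord (X m) i - coord (X n) i))\<^sup>2) \<longlonglongrightarrow> (\<Sum>i\<in>F. (cmod (f i - coord (X n) i))\<^sup>2)"
      by (intro tendsto_intros f)
    have "(\<Sum>i\<in>F. (cmod (coord (X m) i - coord (X n) i))\<^sup>2) \<le> \<epsilon>\<^sup>2" if "m \<ge> N" for m
    proof -
      have "(\<Sum>i\<in>F. (cmod (coord (X m) i - coord (X n) i))\<^sup>2) \<le> (norm (X m - X n))\<^sup>2"
        using finite_sum_le_norm[OF F, of "X m - X n"] by (simp add: coord_simps)
      also have "\<dots> \<le> \<epsilon>\<^sup>2" using N[OF that] by (intro power_mono) (auto simp: dist_norm)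
      finally show ?thesis .
    qed
    then show "\<forall>\<^sub>F m in sequentially. (\<Sum>i\<in>F. (cmod (coord (X m) i - coord (X n) i))\<^sup>2) \<le> \<epsilon>\<^sup>2"
      by (auto simp: eventually_sequentially)
  qed simp
  obtain N where "\<And>m n. m \<ge> N \<Longrightarrow> n \<ge> N \<Longrightarrow> dist (X m) (X n) < 1"
    using metric_CauchyD[OF X, of 1] by auto
  then have "sq_summable (\<lambda>i. f i - coord (X N) i)"
    using bound[of N N 1] by (intro sq_summableI(1)[where C = "1\<^sup>2"]) auto
  then have "sq_summable (\<lambda>i. (f i - coord (X N) i) + coord (X N) i)" by (rule sq_summable_add) simp
  then have sf: "coord (Ell2 f) = f" by (simp add: coord_Ell2)
  have "X \<longlonglongrightarrow> Ell2 f"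
  proof (rule metric_LIMSEQ_I)
    fix \<epsilon> :: real assume e: "\<epsilon> > 0"
    then obtain N where N: "\<And>m n. m \<ge> N \<Longrightarrow> n \<ge> N \<Longrightarrow> dist (X m) (X n) < \<epsilon> / 2"
      using metric_CauchyD[OF X, of "\<epsilon> / 2"] by auto
    have "dist (X n) (Ell2 f) < \<epsilon>" if "n \<ge> N" for n
    proof -
      have "(norm (Ell2 f - X n))\<^sup>2 \<le> (\<epsilon> / 2)\<^sup>2"
        unfolding norm_ell2_sq coord_simps sf
        using bound[of N n "\<epsilon> / 2"] N that by (intro sq_summableI(2)) auto
      then have "norm (Ell2 f - X n) \<le> \<epsilon> / 2" by (rule power2_le_imp_le) (use e in simp)
      then show ?thesis using e by (simp add: dist_norm norm_minus_commute)
    qed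
    then show "\<exists>no. \<forall>n\<ge>no. dist (X n) (Ell2 f) < \<epsilon>" by blast
  qed
  then show "convergent X" by (auto simp: convergent_def)
qed

lift_definition basis :: "'i \<Rightarrow> 'i ell2" is "\<lambda>i j. if j = i then 1 else 0"
proof -
  show "sq_summable (\<lambda>j. if j = i then 1 else 0 :: complex)" for i :: 'i
    by (rule summable_on_cong_neutral[THEN iffD1, where f1 = "\<lambda>_. 1" and S1 = "{i}"]) auto
qed

lemma coord_basis: "coord (basis i) j = (if j = i then 1 else 0)"
  by (simp add: basis.rep_eq)

lemma cinner_basis: "cinner x (basis i) = coord x i"
proof -
  have "cinner x (basis i) = (\<Sum>\<^sub>\<infinity>j\<in>{i}. coord x j * cnj (coord (basis i) j))"
    unfolding cinner_def by (rule infsum_cong_neutral) (auto simp: coord_basis)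
  then show ?thesis by (simp add: coord_basis)
qed

lemma norm_basis: "norm (basis i) = 1"
proof -
  have "(norm (basis i))\<^sup>2 = 1"
    by (metis cinner_basis cinner_self_norm coord_basis of_real_eq_1_iff)
  then show ?thesis using norm_ge_zero[of "basis i"] by (simp add: power2_eq_1_iff)
qed

lemma coord_sum: "coord (sum f F) i = (\<Sum>k\<in>F. coord (f k) i)"
  by (induction F rule: infinite_finite_induct) (auto simp: coord_simps)

text \<open>The remainder after a finite set F has as squared norm the tail of the series, that is,
  the squared norm of x minus the partial sum over F.\<close>

lemma has_sum_basis_expansion: "((\<lambda>i. cscale (coord x i) (basis i)) has_sum x) UNIV"
proof -
  let ?p = "\<lambda>F. \<Sum>i\<in>F. cscale (coord x i) (basis i)"
  have c: "coord (?p F) j = (if j \<in> F then coord x j else 0)" if "finite F" for F j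
    using that by (simp add: coord_sum coord_simps coord_basis if_distrib if_distribR cong: if_cong)
  have n: "(norm (x - ?p F))\<^sup>2 = (norm x)\<^sup>2 - (\<Sum>i\<in>F. (cmod (coord x i))\<^sup>2)" if F: "finite F" for F
  proof -
    let ?h = "\<lambda>i. (cmod (coord x i))\<^sup>2"
    have "(norm (x - ?p F))\<^sup>2 = (\<Sum>\<^sub>\<infinity>i\<in>-F. ?h i)"
      unfolding norm_ell2_sq coord_simps by (rule infsum_cong_neutral) (auto simp: c[OF F])
    moreover have "infsum ?h (F \<union> - F) = infsum ?h F + infsum ?h (- F)"
    proof (rule infsum_Un_disjoint)
      show "?h summable_on - F" by (rule summable_on_subset_banach[OF sq_summable_coord]) auto
    qed (use F in auto)
    ultimately show ?thesis using F by (simp add: norm_ell2_sq)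
  qed
  have "((\<lambda>i. (cmod (coord x i))\<^sup>2) has_sum (norm x)\<^sup>2) UNIV" by (simp add: norm_ell2_sq)
  then have "(sum (\<lambda>i. (cmod (coord x i))\<^sup>2) \<longlongrightarrow> (norm x)\<^sup>2) (finite_subsets_at_top UNIV)"
    by (simp add: has_sum_def)
  then have "((\<lambda>F. sqrt ((norm x)\<^sup>2 - (\<Sum>i\<in>F. (cmod (coord x i))\<^sup>2))) \<longlongrightarrow> sqrt ((norm x)\<^sup>2 - (norm x)\<^sup>2))
      (finite_subsets_at_top UNIV)"
    by (intro tendsto_intros)
  moreover have "\<forall>\<^sub>F F in finite_subsets_at_top UNIV.
      sqrt ((norm x)\<^sup>2 - (\<Sum>i\<in>F. (cmod (coord x i))\<^sup>2)) = norm (?p F - x)"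
    by (rule eventually_finite_subsets_at_top_weakI)
       (simp add: n[symmetric] norm_minus_commute)
  ultimately have "((\<lambda>F. norm (?p F - x)) \<longlongrightarrow> 0) (finite_subsets_at_top UNIV)"
    by (simp add: tendsto_cong)
  then show ?thesis unfolding has_sum_def by (simp add: tendsto_norm_zero_iff LIM_zero_iff)
qed

section \<open>Bounded operators as a C*-algebra\<close>

text \<open>Bounded linear maps over the reals already carry a complete operator norm; commuting
  with \<open>cscale\<close> singles out the complex-linear ones.\<close>

typedef 'i l2op = "{T :: 'i ell2 \<Rightarrow>\<^sub>L 'i ell2. \<forall>c x. blinfun_apply T (cscale c x) = cscale c (blinfun_apply T x)}"
  morphisms blin Lop
  by (rule exI[of _ 0]) (simp add: cscale_simps)

setup_lifting type_definition_l2op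

definition app :: "'i l2op \<Rightarrow> 'i ell2 \<Rightarrow> 'i ell2" where
  "app T = blinfun_apply (blin T)"

lemma app_cscale: "app T (cscale c x) = cscale c (app T x)"
  using blin[of T] by (simp add: app_def)

lemma bounded_linear_app: "bounded_linear (app T)"
  unfolding app_def by (rule blinfun.bounded_linear_right)

lemmas app_add = linear_add[OF bounded_linear.linear, OF bounded_linear_app]
lemmas app_scaleR = linear_scale[OF bounded_linear.linear, OF bounded_linear_app]
lemmas app_zero [simp] = linear_0[OF bounded_linear.linear, OF bounded_linear_app]
lemmas app_sum = linear_sum[OF bounded_linear.linear, OF bounded_linear_app]

lemma l2op_eqI: "(\<And>x. app T x = app U x) \<Longrightarrow> T = U"
  by (metis app_def blin_inject blinfun_eqI)

lemma bounded_linear_cscale: "bounded_linear (cscale c)"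
  by (rule bounded_linear_intro[where K = "cmod c"]) (auto simp: cscale_simps norm_cscale)

definition mk_l2op :: "('i ell2 \<Rightarrow> 'i ell2) \<Rightarrow> 'i l2op" where
  "mk_l2op f = Lop (Blinfun f)"

lemma app_mk_l2op:
  assumes "\<And>x y. f (x + y) = f x + f y" "\<And>c x. f (cscale c x) = cscale c (f x)"
    "\<And>x. norm (f x) \<le> norm x * K"
  shows "app (mk_l2op f) = f"
proof -
  have "f (r *\<^sub>R x) = r *\<^sub>R f x" for r x using assms(2)[of "complex_of_real r" x] by (simp add: cscale_simps)
  then have "bounded_linear f" using assms by (intro bounded_linear_intro[where K = K]) auto
  then have "blinfun_apply (Blinfun f) = f" by (rule bounded_linear_Blinfun_apply)
  then show ?thesis using assms(2) unfolding app_def mk_l2op_def by (subst Lop_inverse) auto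
qed

instantiation l2op :: (type) real_normed_algebra_1
begin

lift_definition zero_l2op :: "'a l2op" is 0 by (simp add: cscale_simps)
lift_definition one_l2op :: "'a l2op" is id_blinfun by simp
lift_definition plus_l2op :: "'a l2op \<Rightarrow> 'a l2op \<Rightarrow> 'a l2op" is "(+)"
  by (simp add: cscale_simps blinfun.add_left)
lift_definition minus_l2op :: "'a l2op \<Rightarrow> 'a l2op \<Rightarrow> 'a l2op" is "(-)"
  by (auto simp: blinfun.diff_left intro!: ell2_eqI simp: coord_simps algebra_simps)
lift_definition uminus_l2op :: "'a l2op \<Rightarrow> 'a l2op" is "uminus"
  by (auto simp: blinfun.minus_left intro!: ell2_eqI simp: coord_simps)
lift_definition scaleR_l2op :: "real \<Rightarrow> 'a l2op \<Rightarrow> 'a l2op" is "scaleR"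
  by (simp add: cscale_simps blinfun.scaleR_left)
lift_definition times_l2op :: "'a l2op \<Rightarrow> 'a l2op \<Rightarrow> 'a l2op" is "(o\<^sub>L)" by simp
lift_definition norm_l2op :: "'a l2op \<Rightarrow> real" is norm .
definition sgn_l2op :: "'a l2op \<Rightarrow> 'a l2op" where "sgn_l2op x = scaleR (inverse (norm x)) x"
definition dist_l2op :: "'a l2op \<Rightarrow> 'a l2op \<Rightarrow> real" where "dist_l2op x y = norm (x - y)"
definition "(uniformity :: ('a l2op \<times> 'a l2op) filter) = (INF e\<in>{0 <..}. principal {(x, y). dist x y < e})"
definition open_l2op :: "'a l2op set \<Rightarrow> bool" where
  "open_l2op S = (\<forall>x\<in>S. \<forall>\<^sub>F (x', y) in uniformity. x' = x \<longrightarrow> y \<in> S)"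

lemma norm_id_blinfun_ell2: "norm (id_blinfun :: 'a ell2 \<Rightarrow>\<^sub>L 'a ell2) = 1"
  by (rule norm_blinfun_eqI[where x = "basis undefined"]) (auto simp: norm_basis)

instance
proof
  fix x y z :: "'a l2op" and r q :: real
  show "x + y + z = x + (y + z)" "x + y = y + x" "0 + x = x" "- x + x = 0" "x - y = x + - y"
    "r *\<^sub>R (x + y) = r *\<^sub>R x + r *\<^sub>R y" "(r + q) *\<^sub>R x = r *\<^sub>R x + q *\<^sub>R x"
    "r *\<^sub>R q *\<^sub>R x = (r * q) *\<^sub>R x" "1 *\<^sub>R x = x"
    by (transfer; simp add: algebra_simps)+
  show "x * y * z = x * (y * z)" "1 * x = x" "x * 1 = x" "(x + y) * z = x * z + y * z"
    "x * (y + z) = x * y + x * z" "r *\<^sub>R x * y = r *\<^sub>R (x * y)" "x * r *\<^sub>R y = r *\<^sub>R (x * y)"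
    by (transfer; auto intro!: blinfun_eqI simp: blinfun.bilinear_simps)+
  show n1: "norm (1 :: 'a l2op) = 1" by transfer (rule norm_id_blinfun_ell2)
  show n0: "norm x = 0 \<longleftrightarrow> x = 0" for x :: "'a l2op" by transfer simp
  show "norm (x + y) \<le> norm x + norm y" by transfer (rule norm_triangle_ineq)
  show "norm (r *\<^sub>R x) = \<bar>r\<bar> * norm x" by transfer simp
  show "norm (x * y) \<le> norm x * norm y" by transfer (rule norm_blinfun_compose)
  show "dist x y = norm (x - y)" by (simp add: dist_l2op_def)
  show "sgn x = inverse (norm x) *\<^sub>R x" by (simp add: sgn_l2op_def)
  show "(0 :: 'a l2op) \<noteq> 1" using n0[of 0] n1 by auto
qed (simp_all add: uniformity_l2op_def open_l2op_def)

end

lemma app_simps [simp]: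
  "app 0 x = 0" "app 1 x = x" "app (T + U) x = app T x + app U x" "app (T - U) x = app T x - app U x"
  "app (- T) x = - app T x" "app (r *\<^sub>R T) x = r *\<^sub>R app T x" "app (T * U) x = app T (app U x)"
  by (simp_all add: app_def zero_l2op.rep_eq one_l2op.rep_eq plus_l2op.rep_eq minus_l2op.rep_eq
      uminus_l2op.rep_eq scaleR_l2op.rep_eq times_l2op.rep_eq blinfun.bilinear_simps)

lemma norm_app: "norm (app T x) \<le> norm T * norm x"
  by (simp add: app_def norm_l2op.rep_eq norm_blinfun)

lemma norm_l2op_bound: "0 \<le> b \<Longrightarrow> (\<And>x. norm (app T x) \<le> b * norm x) \<Longrightarrow> norm T \<le> b"
  by (simp add: app_def norm_l2op.rep_eq norm_blinfun_bound)

instance l2op :: (type) banach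
proof
  fix X :: "nat \<Rightarrow> 'a l2op"
  assume X: "Cauchy X"
  have d: "dist (blin T) (blin U) = dist T U" for T U :: "'a l2op"
    by (simp add: dist_norm norm_l2op.rep_eq minus_l2op.rep_eq)
  have "Cauchy (\<lambda>n. blin (X n))" using X unfolding Cauchy_def d .
  then obtain L where L: "(\<lambda>n. blin (X n)) \<longlonglongrightarrow> L" using Cauchy_convergent convergent_def by blast
  have Lx: "(\<lambda>n. blinfun_apply (blin (X n)) x) \<longlonglongrightarrow> blinfun_apply L x" for x
    by (intro tendsto_intros L)
  have "blinfun_apply L (cscale c x) = cscale c (blinfun_apply L x)" for c x
  proof (rule LIMSEQ_unique[OF Lx])
    have "(\<lambda>n. cscale c (blinfun_apply (blin (X n)) x)) \<longlonglongrightarrow> cscale c (blinfun_apply L x)"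
      by (rule bounded_linear.tendsto[OF bounded_linear_cscale Lx])
    then show "(\<lambda>n. blinfun_apply (blin (X n)) (cscale c x)) \<longlonglongrightarrow> cscale c (blinfun_apply L x)"
      by (simp add: app_cscale[unfolded app_def])
  qed
  then have "blin (Lop L) = L" by (simp add: Lop_inverse)
  then have "(\<lambda>n. dist (X n) (Lop L)) = (\<lambda>n. dist (blin (X n)) L)" by (simp add: d[symmetric])
  then have "X \<longlonglongrightarrow> Lop L" using L unfolding tendsto_dist_iff[of _ L] tendsto_dist_iff[of X] by simp
  then show "convergent X" by (auto simp: convergent_def)
qed

lemma cinner_bounded_linear: "bounded_linear (\<lambda>x. cinner x y)"
  by (rule bounded_linear_intro[where K = "norm y"])
    (auto simp: cinner_add_left cinner_le_norm cinner_cscale_left scaleR_ell2_def scaleR_conv_of_real)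

lemma cinner_sum_right: "cinner x (sum f F) = (\<Sum>i\<in>F. cinner x (f i))"
  by (induction F rule: infinite_finite_induct) (auto simp: cinner_right)

text \<open>The i-th coordinate of T* y is its inner product with the i-th basis vector, so the
  orthonormal basis prescribes the adjoint directly.\<close>

definition adj_fun :: "'i l2op \<Rightarrow> 'i ell2 \<Rightarrow> 'i ell2" where
  "adj_fun T y = Ell2 (\<lambda>i. cinner y (app T (basis i)))"

text \<open>For finite F let x be the prescribed vector truncated to F. Pairing y with T x returns
  the squared norm of x, so Cauchy-Schwarz bounds \<open>norm x\<close> by
  \<open>norm y * norm T\<close>, independently of F.\<close>

lemma adj_fun_bound:
  "coord (adj_fun T y) i = cinner y (app T (basis i))" "norm (adj_fun T y) \<le> norm y * norm T"
proof -
  have "(\<Sum>i\<in>F. (cmod (cinner y (app T (basis i))))\<^sup>2) \<le> (norm y * norm T)\<^sup>2" if F: "finite F" for F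
  proof -
    define c where "c i = cinner y (app T (basis i))" for i
    define \<sigma> where "\<sigma> = (\<Sum>i\<in>F. (cmod (c i))\<^sup>2)"
    define x where "x = (\<Sum>i\<in>F. cscale (c i) (basis i))"
    have \<sigma>0: "0 \<le> \<sigma>" unfolding \<sigma>_def by (rule sum_nonneg) simp
    have "coord x j = (if j \<in> F then c j else 0)" for j
      using F unfolding x_def
      by (simp add: coord_sum coord_simps coord_basis if_distrib if_distribR cong: if_cong)
    then have "(norm x)\<^sup>2 = (\<Sum>\<^sub>\<infinity>i\<in>F. (cmod (c i))\<^sup>2)"
      unfolding norm_ell2_sq by (intro infsum_cong_neutral) auto
    then have nx: "(norm x)\<^sup>2 = \<sigma>" using F by (simp add: \<sigma>_def)
    have "cinner y (app T x) = (\<Sum>i\<in>F. cnj (c i) * c i)"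
      unfolding x_def by (simp add: app_sum app_cscale cinner_sum_right cinner_right c_def)
    also have "\<dots> = complex_of_real \<sigma>"
      unfolding \<sigma>_def of_real_sum by (simp only: complex_norm_square mult.commute)
    finally have "\<sigma> = cmod (cinner y (app T x))" using \<sigma>0 by simp
    also have "\<dots> \<le> norm y * (norm T * norm x)"
      by (meson cinner_le_norm mult_left_mono norm_app norm_ge_zero order_trans)
    finally have "norm x * norm x \<le> (norm y * norm T) * norm x"
      using nx by (simp add: power2_eq_square mult.assoc)
    then have "norm x \<le> norm y * norm T" by (cases "norm x = 0") auto
    then show ?thesis using nx unfolding \<sigma>_def c_def by (metis norm_ge_zero power_mono)
  qed
  note * = Ell2_bound[OF this mult_nonneg_nonneg[OF norm_ge_zero norm_ge_zero]]
  show "coord (adj_fun T y) i = cinner y (app T (basis i))" "norm (adj_fun T y) \<le> norm y * norm T"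
    unfolding adj_fun_def using * by simp_all
qed

lemma app_mk_adj_fun: "app (mk_l2op (adj_fun T)) = adj_fun T"
  by (rule app_mk_l2op[where K = "norm T"])
    (auto intro!: ell2_eqI simp: adj_fun_bound coord_simps cinner_add_left cinner_cscale_left)

lemma cinner_adj_fun: "cinner (app T x) y = cinner x (adj_fun T y)"
proof -
  have "bounded_linear (\<lambda>x. cinner (app T x) y)"
    by (rule bounded_linear_compose[OF cinner_bounded_linear bounded_linear_app])
  from has_sum_bounded_linear[OF this has_sum_basis_expansion[of x]]
  have "((\<lambda>i. coord x i * cnj (cinner y (app T (basis i)))) has_sum cinner (app T x) y) UNIV"
    by (simp add: app_cscale cinner_cscale_left cinner_commute[of "app T (basis _)" y])
  then show ?thesis unfolding cinner_def[of x] adj_fun_bound by (simp add: infsumI)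
qed

instantiation l2op :: (type) cstar_alg
begin

definition cstar_l2op :: "'a l2op \<Rightarrow> 'a l2op" where "cstar_l2op T = mk_l2op (adj_fun T)"
definition scaleC_l2op :: "complex \<Rightarrow> 'a l2op \<Rightarrow> 'a l2op" where
  "scaleC_l2op c T = mk_l2op (\<lambda>x. cscale c (app T x))"

lemma app_scaleC: "app (scaleC c T) x = cscale c (app T x)" for T :: "'a l2op"
proof -
  have "norm (cscale c (app T x)) \<le> norm x * (cmod c * norm T)" for x
    using mult_left_mono[OF norm_app[of T x] norm_ge_zero[of c]] by (simp add: norm_cscale mult.commute mult.left_commute)
  then have "app (mk_l2op (\<lambda>x. cscale c (app T x))) = (\<lambda>x. cscale c (app T x))"
    by (intro app_mk_l2op[where K = "cmod c * norm T"]) (auto simp: app_add app_cscale cscale_simps mult.commute)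
  then show ?thesis by (simp add: scaleC_l2op_def)
qed

lemma coord_app_cstar: "coord (app (cstar T) y) i = cinner y (app T (basis i))" for T :: "'a l2op"
  by (simp add: cstar_l2op_def app_mk_adj_fun adj_fun_bound)

lemma cinner_cstar: "cinner (app T x) y = cinner x (app (cstar T) y)" for T :: "'a l2op"
  by (simp add: cstar_l2op_def app_mk_adj_fun cinner_adj_fun)

lemma cstar_eqI:
  fixes T U :: "'a l2op"
  assumes "\<And>x y. cinner (app T x) y = cinner x (app U y)"
  shows "cstar T = U"
proof (rule l2op_eqI, rule cinner_eqI)
  fix x y
  show "cinner (app (cstar T) x) y = cinner (app U x) y"
    using assms[of y x] cinner_cstar[of T y x] by (metis cinner_commute)
qed

lemma norm_cstar_le: "norm (cstar T) \<le> norm T" for T :: "'a l2op"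
  by (rule norm_l2op_bound) (simp_all add: cstar_l2op_def app_mk_adj_fun adj_fun_bound mult.commute)

lemma cinner_cstar': "cinner (app (cstar T) x) y = cinner x (app T y)" for T :: "'a l2op"
  by (metis cinner_commute cinner_cstar)

instance
proof
  fix x y :: "'a l2op" and c d :: complex and r :: real
  show "scaleC c (x + y) = scaleC c x + scaleC c y" "scaleC (c + d) x = scaleC c x + scaleC d x"
    "scaleC c (scaleC d x) = scaleC (c * d) x" "scaleC 1 x = x"
    "scaleC (complex_of_real r) x = scaleR r x"
    "scaleC c x * y = scaleC c (x * y)" "x * scaleC c y = scaleC c (x * y)"
    by (auto intro!: l2op_eqI simp: app_scaleC cscale_simps app_cscale)
  have le: "norm (scaleC c x) \<le> cmod c * norm x" for c and x :: "'a l2op"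
    using mult_left_mono[OF norm_app norm_ge_zero[of c]]
    by (intro norm_l2op_bound) (auto simp: app_scaleC norm_cscale mult.assoc)
  show "norm (scaleC c x) = cmod c * norm x"
  proof (cases "c = 0")
    case True
    then show ?thesis using le[of c x] by simp
  next
    case False
    have "scaleC (inverse c) (scaleC c x) = x"
      using False by (intro l2op_eqI) (simp add: app_scaleC cscale_simps)
    then have "norm x \<le> inverse (cmod c) * norm (scaleC c x)"
      using le[of "inverse c" "scaleC c x"] by (simp add: norm_inverse)
    then have "cmod c * norm x \<le> norm (scaleC c x)" using False by (simp add: field_simps)
    then show ?thesis using le[of c x] by simp
  qed
  show "cstar (cstar x) = x" by (rule cstar_eqI) (rule cinner_cstar')
  show "cstar (x + y) = cstar x + cstar y"
    by (rule cstar_eqI) (simp add: cinner_add_left cinner_right cinner_cstar)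
  show "cstar (scaleC c x) = scaleC (cnj c) (cstar x)"
    by (rule cstar_eqI) (simp add: app_scaleC cinner_cscale_left cinner_right cinner_cstar)
  show "cstar (x * y) = cstar y * cstar x"
    by (rule cstar_eqI) (simp add: cinner_cstar)
  show "norm (cstar x * x) = (norm x)\<^sup>2"
  proof (rule antisym)
    show "norm (cstar x * x) \<le> (norm x)\<^sup>2"
      using norm_mult_ineq[of "cstar x" x] mult_right_mono[OF norm_cstar_le[of x] norm_ge_zero[of x]]
      by (simp add: power2_eq_square)
    have "norm (app x \<xi>) \<le> sqrt (norm (cstar x * x)) * norm \<xi>" for \<xi>
    proof -
      have "complex_of_real ((norm (app x \<xi>))\<^sup>2) = cinner (app (cstar x * x) \<xi>) \<xi>"
        unfolding cinner_self_norm[symmetric] by (simp add: cinner_cstar')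
      then have "(norm (app x \<xi>))\<^sup>2 = cmod (cinner (app (cstar x * x) \<xi>) \<xi>)"
        by (metis abs_of_nonneg norm_of_real zero_le_power2)
      also have "\<dots> \<le> norm (cstar x * x) * norm \<xi> * norm \<xi>"
        by (meson cinner_le_norm mult_right_mono norm_app norm_ge_zero order_trans)
      also have "\<dots> = (sqrt (norm (cstar x * x)) * norm \<xi>)\<^sup>2"
        by (simp add: power_mult_distrib power2_eq_square)
      finally show ?thesis by (rule power2_le_imp_le) simp
    qed
    then have "norm x \<le> sqrt (norm (cstar x * x))" by (intro norm_l2op_bound) auto
    then show "(norm x)\<^sup>2 \<le> norm (cstar x * x)"
      using real_le_rsqrt real_sqrt_le_iff by (metis norm_ge_zero power_mono real_sqrt_pow2)
  qed
qed

end

section \<open>Weighted composition operators\<close>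

text \<open>One shape for all concrete operators: projections, multiplications, gauge unitaries and
  shifts. Boundedness is established when the coordinates are computed.\<close>

definition wcomp :: "('i \<Rightarrow> complex) \<Rightarrow> ('i \<Rightarrow> 'i) \<Rightarrow> 'i l2op" where
  "wcomp g \<phi> = mk_l2op (\<lambda>x. Ell2 (\<lambda>i. g i * coord x (\<phi> i)))"

text \<open>Injectivity where the weight is nonzero means that each coordinate of x is used at most
  once, so the bound on the weights bounds the operator.\<close>

lemma coord_wcomp:
  assumes g: "\<And>i. cmod (g i) \<le> K" and inj: "inj_on \<phi> {i. g i \<noteq> 0}"
  shows "coord (app (wcomp g \<phi>) x) i = g i * coord x (\<phi> i)"
proof -
  have K: "0 \<le> K" using g norm_ge_zero order_trans by blast
  have "(\<Sum>i\<in>F. (cmod (g i * coord x (\<phi> i)))\<^sup>2) \<le> (norm x * K)\<^sup>2" if F: "finite F" for F x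
  proof -
    let ?F = "F \<inter> {i. g i \<noteq> 0}"
    have "(\<Sum>i\<in>F. (cmod (g i * coord x (\<phi> i)))\<^sup>2) = (\<Sum>i\<in>?F. (cmod (g i * coord x (\<phi> i)))\<^sup>2)"
      using F by (intro sum.mono_neutral_right) auto
    also have "\<dots> \<le> (\<Sum>i\<in>?F. K\<^sup>2 * (cmod (coord x (\<phi> i)))\<^sup>2)"
      using g K by (intro sum_mono) (auto simp: norm_mult power_mult_distrib intro!: mult_right_mono power_mono)
    also have "\<dots> = K\<^sup>2 * (\<Sum>i\<in>\<phi> ` ?F. (cmod (coord x i))\<^sup>2)"
      unfolding sum_distrib_left[symmetric]
      by (subst sum.reindex[OF inj_on_subset[OF inj]]) auto
    also have "\<dots> \<le> K\<^sup>2 * (norm x)\<^sup>2"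
      using F by (intro mult_left_mono finite_sum_le_norm) auto
    finally show ?thesis by (simp add: power_mult_distrib mult.commute)
  qed
  note * = Ell2_bound[OF this mult_nonneg_nonneg[OF norm_ge_zero K]]
  have "app (wcomp g \<phi>) = (\<lambda>x. Ell2 (\<lambda>i. g i * coord x (\<phi> i)))"
    unfolding wcomp_def
  proof (rule app_mk_l2op[where K = K])
    show "Ell2 (\<lambda>i. g i * coord (x + y) (\<phi> i)) = Ell2 (\<lambda>i. g i * coord x (\<phi> i)) + Ell2 (\<lambda>i. g i * coord y (\<phi> i))"
      "Ell2 (\<lambda>i. g i * coord (cscale c x) (\<phi> i)) = cscale c (Ell2 (\<lambda>i. g i * coord x (\<phi> i)))" for x y c
      by (rule ell2_eqI, simp only: *(1), simp add: coord_simps *(1) algebra_simps)+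
  qed (rule *(2))
  then show ?thesis using *(1) by simp
qed

section \<open>Operators on \<open>Hs s\<close> as a corner\<close>

definition vproj :: "nat \<Rightarrow> vtx l2op" where
  "vproj s = wcomp (\<lambda>v. if v \<in> Vs s then 1 else 0) id"

definition corner :: "nat \<Rightarrow> vtx l2op set" where
  "corner s = {X. vproj s * X = X \<and> X * vproj s = X}"

text \<open>The value 0 outside \<open>Hs s\<close> follows the convention of \<open>bop\<close>,
  under which equality of operators is equality of functions.\<close>

definition opr :: "nat \<Rightarrow> vtx l2op \<Rightarrow> op" where
  "opr s X = (\<lambda>\<xi>. if \<xi> \<in> Hs s then coord (app X (Ell2 \<xi>)) else (\<lambda>v. 0))"

lemma coord_vproj: "coord (app (vproj s) x) v = (if v \<in> Vs s then coord x v else 0)"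
  unfolding vproj_def by (subst coord_wcomp[where K = 1]) auto

lemma vproj_idem: "vproj s * vproj s = vproj s"
  by (rule l2op_eqI, rule ell2_eqI) (simp add: coord_vproj)

lemma app_vproj_idem [simp]: "app (vproj s) (app (vproj s) x) = app (vproj s) x"
  by (rule ell2_eqI) (simp add: coord_vproj)

lemma cstar_vproj: "cstar (vproj s) = vproj s"
proof (rule l2op_eqI, rule ell2_eqI)
  fix x i
  have "app (vproj s) (basis i) = (if i \<in> Vs s then basis i else 0)"
    by (rule ell2_eqI) (auto simp: coord_vproj coord_basis coord_simps)
  then show "coord (app (cstar (vproj s)) x) i = coord (app (vproj s) x) i"
    by (simp add: coord_app_cstar coord_vproj cinner_basis)
qed

lemma norm_vproj_le: "norm (app (vproj s) x) \<le> norm x"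
proof -
  have "(norm (app (vproj s) x))\<^sup>2 \<le> (norm x)\<^sup>2"
    unfolding norm_ell2_sq by (rule infsum_mono[OF sq_summable_coord sq_summable_coord]) (simp add: coord_vproj)
  then show ?thesis by (rule power2_le_imp_le) simp
qed

lemma coord_in_Hs: "coord x \<in> Hs s \<longleftrightarrow> app (vproj s) x = x"
proof
  assume "coord x \<in> Hs s"
  then show "app (vproj s) x = x" by (intro ell2_eqI) (auto simp: coord_vproj Hs_def)
next
  assume "app (vproj s) x = x"
  then have "coord x v = 0" if "v \<notin> Vs s" for v using that coord_vproj[of s x v] by simp
  then show "coord x \<in> Hs s" unfolding Hs_def by simp
qed

lemma HsE:
  assumes "\<xi> \<in> Hs s"
  obtains x where "\<xi> = coord x" "app (vproj s) x = x"
proof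
  have "sq_summable \<xi>" using assms by (simp add: Hs_def)
  then show c: "\<xi> = coord (Ell2 \<xi>)" by (simp add: coord_Ell2)
  show "app (vproj s) (Ell2 \<xi>) = Ell2 \<xi>" using assms c coord_in_Hs by metis
qed

lemma coord_vproj_in_Hs: "coord (app (vproj s) x) \<in> Hs s"
  unfolding coord_in_Hs by simp

lemma norm_l2_coord: "norm_l2 (coord x) = norm x"
  by (simp add: norm_l2_def norm_ell2_eq)

lemma inner_l2_coord: "inner_l2 (coord x) (coord y) = cinner x y"
  by (simp add: inner_l2_def cinner_def)

lemma opr_coord: "app (vproj s) x = x \<Longrightarrow> opr s X (coord x) = coord (app X x)"
  by (simp add: opr_def coord_in_Hs coord_inverse)

lemma opr_not_in: "\<xi> \<notin> Hs s \<Longrightarrow> opr s X \<xi> = (\<lambda>v. 0)"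
  by (simp add: opr_def)

lemma op_eqI:
  assumes "\<And>\<xi>. \<xi> \<notin> Hs s \<Longrightarrow> T \<xi> = U \<xi>" "\<And>x. app (vproj s) x = x \<Longrightarrow> T (coord x) = U (coord x)"
  shows "T = U"
proof
  fix \<xi> show "T \<xi> = U \<xi>" using assms by (cases "\<xi> \<in> Hs s") (auto elim: HsE)
qed

lemma cornerD:
  assumes "X \<in> corner s"
  shows "app (vproj s) (app X x) = app X x" "app X (app (vproj s) x) = app X x"
proof -
  have "vproj s * X = X" "X * vproj s = X" using assms by (simp_all add: corner_def)
  then show "app (vproj s) (app X x) = app X x" "app X (app (vproj s) x) = app X x"
    by (simp_all flip: app_simps(7))
qed

lemma cstar_subalg_corner: "cstar_subalg (corner s)"
proof -
  have "closed {X. vproj s * X = X}" "closed {X. X * vproj s = X}"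
    by (intro closed_Collect_eq continuous_intros)+
  then have "closed (corner s)" unfolding corner_def by (simp add: Collect_conj_eq closed_Int)
  moreover have "cstar X \<in> corner s" if "X \<in> corner s" for X
    using that unfolding corner_def by (metis (mono_tags, lifting) cstar_mult cstar_vproj mem_Collect_eq)
  moreover have "X + Y \<in> corner s \<and> X * Y \<in> corner s" if "X \<in> corner s" "Y \<in> corner s" for X Y
    using that unfolding corner_def by (simp add: distrib_left distrib_right mult.assoc) (metis mult.assoc)
  moreover have "scaleC c X \<in> corner s" if "X \<in> corner s" for c X
    using that unfolding corner_def by (simp add: mult_scaleC_left mult_scaleC_right)
  ultimately show ?thesis unfolding cstar_subalg_def by blast
qed

lemmas corner_closed = cstar_subalgD[OF cstar_subalg_corner]

lemma vproj_in_corner: "vproj s \<in> corner s"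
  by (simp add: corner_def vproj_idem)

lemma opr_in_bop:
  assumes X: "X \<in> corner s"
  shows "opr s X \<in> bop s"
  unfolding bop_def mem_Collect_eq
proof (intro conjI ballI allI impI)
  fix \<xi> assume "\<xi> \<in> Hs s"
  then show "opr s X \<xi> \<in> Hs s"
    by (metis HsE X coord_in_Hs cornerD(1) opr_coord)
next
  fix \<xi> assume "\<xi> \<notin> Hs s"
  then show "opr s X \<xi> = (\<lambda>v. 0)" by (rule opr_not_in)
next
  fix \<xi> \<eta> a b assume "\<xi> \<in> Hs s" "\<eta> \<in> Hs s"
  then obtain x y where xy: "\<xi> = coord x" "app (vproj s) x = x" "\<eta> = coord y" "app (vproj s) y = y"
    by (metis HsE)
  let ?z = "cscale a x + cscale b y"
  have "app (vproj s) ?z = ?z" by (simp add: app_add app_cscale xy)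
  moreover have "(\<lambda>v. a * \<xi> v + b * \<eta> v) = coord ?z" by (simp add: fun_eq_iff coord_simps xy)
  ultimately have "opr s X (\<lambda>v. a * \<xi> v + b * \<eta> v) = coord (app X ?z)" by (simp only: opr_coord)
  then show "opr s X (\<lambda>v. a * \<xi> v + b * \<eta> v) = (\<lambda>v. a * opr s X \<xi> v + b * opr s X \<eta> v)"
    by (simp only: opr_coord xy fun_eq_iff app_add app_cscale coord_simps simp_thms)
next
  have "norm_l2 (opr s X \<xi>) \<le> norm X * norm_l2 \<xi>" if "\<xi> \<in> Hs s" for \<xi>
    using that by (elim HsE) (simp add: opr_coord norm_l2_coord norm_app)
  then show "\<exists>K. \<forall>\<xi>\<in>Hs s. norm_l2 (opr s X \<xi>) \<le> K * norm_l2 \<xi>" by blast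
qed

text \<open>Precomposition with the projection extends the given operator to all square-summable
  families, and the result is cut down on both sides.\<close>

lemma bop_opr:
  assumes T: "T \<in> bop s"
  obtains X where "X \<in> corner s" "T = opr s X"
proof
  define f where "f x = Ell2 (T (coord (app (vproj s) x)))" for x
  define X where "X = mk_l2op f"
  from T obtain K where K: "\<And>\<xi>. \<xi> \<in> Hs s \<Longrightarrow> norm_l2 (T \<xi>) \<le> K * norm_l2 \<xi>" unfolding bop_def by blast
  have TH: "T \<xi> \<in> Hs s" if "\<xi> \<in> Hs s" for \<xi> using T that unfolding bop_def by blast
  have lin: "T (\<lambda>v. a * \<xi> v + b * \<eta> v) = (\<lambda>v. a * T \<xi> v + b * T \<eta> v)" if "\<xi> \<in> Hs s" "\<eta> \<in> Hs s" for \<xi> \<eta> a b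
    using T that unfolding bop_def by blast
  have sq: "sq_summable \<xi>" if "\<xi> \<in> Hs s" for \<xi> using that unfolding Hs_def by blast
  have cf: "coord (f x) = T (coord (app (vproj s) x))" for x
    unfolding f_def by (intro coord_Ell2 sq TH coord_vproj_in_Hs)
  have comb: "f (cscale a x + cscale b y) = cscale a (f x) + cscale b (f y)" for a b x y
  proof (rule ell2_eqI)
    fix i
    have "coord (app (vproj s) (cscale a x + cscale b y)) =
        (\<lambda>v. a * coord (app (vproj s) x) v + b * coord (app (vproj s) y) v)"
      by (simp add: fun_eq_iff app_add app_cscale coord_simps)
    then show "coord (f (cscale a x + cscale b y)) i = coord (cscale a (f x) + cscale b (f y)) i"
      by (simp add: cf coord_simps lin[OF coord_vproj_in_Hs coord_vproj_in_Hs])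
  qed
  have fb: "norm (f x) \<le> norm x * \<bar>K\<bar>" for x
  proof -
    have "norm (f x) \<le> K * norm (app (vproj s) x)"
      using K[OF coord_vproj_in_Hs[of s x]] unfolding cf[symmetric] norm_l2_coord .
    also have "\<dots> \<le> \<bar>K\<bar> * norm (app (vproj s) x)" by (intro mult_right_mono) auto
    also have "\<dots> \<le> \<bar>K\<bar> * norm x" by (intro mult_left_mono norm_vproj_le) auto
    finally show ?thesis by (simp add: mult.commute)
  qed
  have 0: "cscale 0 x = 0" for x :: "vtx ell2" by (rule ell2_eqI) (simp add: coord_simps)
  have appX: "app X = f" unfolding X_def
  proof (rule app_mk_l2op[OF _ _ fb])
    show "f (x + y) = f x + f y" for x y using comb[of 1 x 1 y] by (simp add: cscale_simps)
    show "f (cscale c x) = cscale c (f x)" for c x using comb[of c x 0 0] by (simp add: 0)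
  qed
  show "X \<in> corner s"
    unfolding corner_def
  proof (safe; intro l2op_eqI)
    fix x
    have "coord (f x) \<in> Hs s" unfolding cf by (intro TH coord_vproj_in_Hs)
    then show "app (vproj s * X) x = app X x" by (simp add: appX coord_in_Hs)
    show "app (X * vproj s) x = app X x" by (simp add: appX f_def)
  qed
  show "T = opr s X"
  proof (rule op_eqI)
    show "T \<xi> = opr s X \<xi>" if "\<xi> \<notin> Hs s" for \<xi> using T that by (auto simp: bop_def opr_not_in)
    show "T (coord x) = opr s X (coord x)" if "app (vproj s) x = x" for x
      using that by (simp add: opr_coord appX cf)
  qed
qed

lemma opr_inject:
  assumes "X \<in> corner s" "Y \<in> corner s" "opr s X = opr s Y"
  shows "X = Y"
proof (rule l2op_eqI)
  fix x
  have "coord (app X (app (vproj s) x)) = coord (app Y (app (vproj s) x))"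
    using assms(3) opr_coord[OF app_vproj_idem] by metis
  then show "app X x = app Y x" using assms by (simp add: coord_inject cornerD)
qed

lemma opr_add: "opr s (X + Y) = op_add (opr s X) (opr s Y)"
  by (rule op_eqI[of s]) (simp_all add: opr_not_in op_add_def opr_coord fun_eq_iff coord_simps)

lemma opr_scaleC: "opr s (scaleC c X) = op_scale c (opr s X)"
  by (rule op_eqI[of s]) (simp_all add: opr_not_in op_scale_def opr_coord fun_eq_iff coord_simps app_scaleC)

lemma opr_zero_vec: "opr s X (\<lambda>v. 0) = (\<lambda>v. 0)"
proof -
  have "coord (0 :: vtx ell2) = (\<lambda>v. 0)" by (simp add: fun_eq_iff coord_simps)
  then show ?thesis using opr_coord[of s 0 X] by simp
qed

lemma opr_mult: "Y \<in> corner s \<Longrightarrow> opr s (X * Y) = opr s X \<circ> opr s Y"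
  by (rule op_eqI[of s]) (simp_all add: opr_not_in opr_zero_vec opr_coord cornerD)

lemma opr_vproj: "opr s (vproj s) = idop s"
  by (rule op_eqI[of s]) (simp_all add: opr_not_in idop_def opr_coord coord_in_Hs)

text \<open>\<open>adj\<close> is a definite description, so uniqueness is due as well. A competitor
  comes from the corner by \<open>bop_opr\<close>, and the projections can be moved through the
  inner product, which extends the adjoint relation from \<open>Hs s\<close> to all vectors.\<close>

lemma opr_adjoint:
  assumes X: "X \<in> corner s"
  shows "adj s (opr s X) = opr s (cstar X)"
  unfolding adj_def
proof (rule the_equality)
  have cX: "cstar X \<in> corner s" using X by (rule corner_closed)
  have "inner_l2 (opr s X \<xi>) \<eta> = inner_l2 \<xi> (opr s (cstar X) \<eta>)" if "\<xi> \<in> Hs s" "\<eta> \<in> Hs s" for \<xi> \<eta>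
    using that by (elim HsE) (simp add: opr_coord inner_l2_coord cinner_cstar)
  then show "opr s (cstar X) \<in> bop s \<and>
      (\<forall>\<xi>\<in>Hs s. \<forall>\<eta>\<in>Hs s. inner_l2 (opr s X \<xi>) \<eta> = inner_l2 \<xi> (opr s (cstar X) \<eta>))"
    using opr_in_bop[OF cX] by blast
next
  fix U assume U: "U \<in> bop s \<and> (\<forall>\<xi>\<in>Hs s. \<forall>\<eta>\<in>Hs s. inner_l2 (opr s X \<xi>) \<eta> = inner_l2 \<xi> (U \<eta>))"
  then obtain Y where Y: "Y \<in> corner s" "U = opr s Y" using bop_opr by blast
  have "cstar X = Y"
  proof (rule cstar_eqI)
    fix x y
    have "cinner (app X (app (vproj s) x)) (app (vproj s) y) =
        cinner (app (vproj s) x) (app Y (app (vproj s) y))"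
      using U coord_vproj_in_Hs unfolding Y by (metis app_vproj_idem inner_l2_coord opr_coord)
    also have "cinner (app X (app (vproj s) x)) (app (vproj s) y) = cinner (app X x) y"
      by (metis X cinner_cstar cornerD cstar_vproj)
    also have "cinner (app (vproj s) x) (app Y (app (vproj s) y)) = cinner x (app Y y)"
      by (metis Y(1) cinner_cstar cornerD cstar_vproj)
    finally show "cinner (app X x) y = cinner x (app Y y)" .
  qed
  then show "U = opr s (cstar X)" using Y by simp
qed

text \<open>An element of the corner sees only the projection of a vector to \<open>Hs s\<close>,
  and projecting does not increase the norm; so the supremum over the unit ball of
  \<open>Hs s\<close> is the full operator norm.\<close>

lemma opnorm_opr:
  assumes X: "X \<in> corner s"
  shows "opnorm s (opr s X) = norm X"
proof -
  let ?U = "{\<xi> \<in> Hs s. norm_l2 \<xi> \<le> 1}"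
  have le: "norm_l2 (opr s X \<xi>) \<le> norm X" if "\<xi> \<in> ?U" for \<xi>
  proof -
    have h: "\<xi> \<in> Hs s" "norm_l2 \<xi> \<le> 1" using that by auto
    from h(1) obtain x where x: "\<xi> = coord x" "app (vproj s) x = x" by (rule HsE)
    have "norm (app X x) \<le> norm X * norm x" by (rule norm_app)
    also have "\<dots> \<le> norm X * 1" using h x by (intro mult_left_mono) (auto simp: norm_l2_coord)
    finally show ?thesis using x by (simp add: opr_coord norm_l2_coord)
  qed
  have "coord (0 :: vtx ell2) \<in> ?U" by (simp add: coord_in_Hs norm_l2_coord)
  then have ne: "?U \<noteq> {}" by blast
  have bdd: "bdd_above ((\<lambda>\<xi>. norm_l2 (opr s X \<xi>)) ` ?U)" using le by (intro bdd_aboveI2)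
  let ?S = "SUP \<xi>\<in>?U. norm_l2 (opr s X \<xi>)"
  have up: "norm (app X x) \<le> ?S" if "app (vproj s) x = x" "norm x \<le> 1" for x
    using cSUP_upper[OF _ bdd, of "coord x"] that by (simp add: coord_in_Hs norm_l2_coord opr_coord)
  have S0: "0 \<le> ?S" using up[of 0] by simp
  have "norm X \<le> ?S"
  proof (rule norm_l2op_bound[OF S0])
    fix x
    let ?y = "app (vproj s) x"
    have "norm (app X ?y) \<le> ?S * norm ?y"
    proof (cases "?y = 0")
      case False
      have "norm (app X (inverse (norm ?y) *\<^sub>R ?y)) \<le> ?S"
        using False by (intro up) (auto simp: app_scaleR)
      then show ?thesis using False by (simp add: app_scaleR field_simps)
    qed simp
    also have "\<dots> \<le> ?S * norm x" by (intro mult_left_mono norm_vproj_le S0)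
    finally show "norm (app X x) \<le> ?S * norm x" using X by (simp add: cornerD)
  qed
  moreover have "?S \<le> norm X" using ne le by (rule cSUP_least)
  ultimately show ?thesis unfolding opnorm_def by simp
qed

lemma cstar_closed_opr_image:
  assumes C: "cstar_subalg C" "C \<subseteq> corner s"
  shows "cstar_closed s (opr s ` C)"
  unfolding cstar_closed_def
proof (intro conjI ballI allI impI)
  note c = cstar_subalgD[OF C(1)]
  show "opr s ` C \<subseteq> bop s" using C opr_in_bop by blast
  fix T assume "T \<in> opr s ` C"
  then obtain X where X: "X \<in> C" "T = opr s X" by blast
  show "adj s T \<in> opr s ` C" using X C opr_adjoint[of X s] c(5) by auto
  show "op_scale a T \<in> opr s ` C" for a using X c(4) by (metis image_eqI opr_scaleC)
  fix U assume "U \<in> opr s ` C"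
  then obtain Y where Y: "Y \<in> C" "U = opr s Y" by blast
  show "op_add T U \<in> opr s ` C" using X Y c(2) by (metis image_eqI opr_add)
  show "T \<circ> U \<in> opr s ` C" using X Y C c(3) by (metis image_eqI opr_mult subsetD)
next
  fix T f
  assume a: "T \<in> bop s \<and> (\<forall>k. f k \<in> opr s ` C) \<and>
      (\<lambda>k. opnorm s (op_add (f k) (op_scale (- 1) T))) \<longlonglongrightarrow> 0"
  then obtain X where X: "X \<in> corner s" "T = opr s X" using bop_opr by blast
  from a have "\<forall>k. \<exists>Y. Y \<in> C \<and> f k = opr s Y" by blast
  then obtain F where F: "\<And>k. F k \<in> C" "\<And>k. f k = opr s (F k)" by metis
  have "opnorm s (op_add (f k) (op_scale (- 1) T)) = norm (F k - X)" for k
    unfolding F(2) X(2) opr_scaleC[symmetric] opr_add[symmetric] scaleC_minus_one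
    using F(1) C(2) X(1) by (subst opnorm_opr) (auto intro!: corner_closed)
  then have "(\<lambda>k. norm (F k - X)) \<longlonglongrightarrow> 0" using a by simp
  then have "F \<longlonglongrightarrow> X" by (simp add: tendsto_norm_zero_iff LIM_zero_iff)
  then have "X \<in> C" using closed_sequentially[OF cstar_subalgD(1)[OF C(1)] F(1)] by simp
  then show "T \<in> opr s ` C" using X by blast
qed

lemma cstar_subalg_opr_vimage:
  assumes C: "cstar_closed s C"
  shows "cstar_subalg {X \<in> corner s. opr s X \<in> C}"
  unfolding cstar_subalg_def
proof (intro conjI ballI allI)
  have cl: "op_add T U \<in> C" "T \<circ> U \<in> C" "op_scale c T \<in> C" "adj s T \<in> C" if "T \<in> C" "U \<in> C" for T U c
    using C that unfolding cstar_closed_def by blast+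
  have lim: "T \<in> bop s \<Longrightarrow> (\<forall>k. f k \<in> C) \<Longrightarrow>
      (\<lambda>k. opnorm s (op_add (f k) (op_scale (- 1) T))) \<longlonglongrightarrow> 0 \<Longrightarrow> T \<in> C" for T f
    using C unfolding cstar_closed_def by blast
  show "closed {X \<in> corner s. opr s X \<in> C}"
    unfolding closed_sequential_limits
  proof (intro allI impI, elim conjE)
    fix F X assume F: "\<forall>n. F n \<in> {X \<in> corner s. opr s X \<in> C}" "F \<longlonglongrightarrow> X"
    then have X: "X \<in> corner s" using closed_sequentially[OF corner_closed(1), of F s X] by simp
    have "opnorm s (op_add (opr s (F k)) (op_scale (- 1) (opr s X))) = norm (F k - X)" for k
      unfolding opr_scaleC[symmetric] opr_add[symmetric] scaleC_minus_one
      using F(1) X by (subst opnorm_opr) (auto intro!: corner_closed)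
    moreover have "(\<lambda>k. norm (F k - X)) \<longlonglongrightarrow> 0"
      using F(2) by (simp add: tendsto_norm_zero_iff LIM_zero_iff)
    ultimately have "(\<lambda>k. opnorm s (op_add (opr s (F k)) (op_scale (- 1) (opr s X)))) \<longlonglongrightarrow> 0" by simp
    moreover have "opr s X \<in> bop s" using X by (rule opr_in_bop)
    moreover have "\<forall>k. opr s (F k) \<in> C" using F(1) by blast
    ultimately have "opr s X \<in> C" using lim[of "opr s X" "\<lambda>k. opr s (F k)"] by blast
    then show "X \<in> {X \<in> corner s. opr s X \<in> C}" using X by simp
  qed
  fix X assume X: "X \<in> {X \<in> corner s. opr s X \<in> C}"
  then show "scaleC c X \<in> {X \<in> corner s. opr s X \<in> C}" for c
    using cl(3)[of "opr s X" "opr s X"] by (auto simp: opr_scaleC intro: corner_closed)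
  show "cstar X \<in> {X \<in> corner s. opr s X \<in> C}"
    using X cl(4)[of "opr s X" "opr s X"] opr_adjoint[of X s] by (auto intro: corner_closed)
  fix Y assume Y: "Y \<in> {X \<in> corner s. opr s X \<in> C}"
  show "X + Y \<in> {X \<in> corner s. opr s X \<in> C}"
    using X Y cl(1) by (auto simp: opr_add intro: corner_closed)
  show "X * Y \<in> {X \<in> corner s. opr s X \<in> C}"
    using X Y cl(2) by (auto simp: opr_mult intro: corner_closed)
qed

text \<open>Images of C*-subalgebras of the corner are \<open>cstar_closed\<close>, and preimages of
  \<open>cstar_closed\<close> sets are C*-subalgebras; each fact yields one inclusion.\<close>

lemma gen_cstar_opr:
  assumes G: "G \<subseteq> corner s"
  shows "gen_cstar s (opr s ` G) = opr s ` cstar_generated G"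
proof
  have sub: "cstar_generated G \<subseteq> corner s"
    using G by (rule cstar_generated_least) (rule cstar_subalg_corner)
  show "gen_cstar s (opr s ` G) \<subseteq> opr s ` cstar_generated G"
    unfolding gen_cstar_def
    using cstar_closed_opr_image[OF cstar_subalg_generated sub] cstar_generated_subset[of G] by blast
  show "opr s ` cstar_generated G \<subseteq> gen_cstar s (opr s ` G)"
    unfolding gen_cstar_def
  proof (intro Inter_greatest)
    fix C assume "C \<in> {C. opr s ` G \<subseteq> C \<and> cstar_closed s C}"
    then have "cstar_generated G \<subseteq> {X \<in> corner s. opr s X \<in> C}"
      using G by (intro cstar_generated_least cstar_subalg_opr_vimage) auto
    then show "opr s ` cstar_generated G \<subseteq> C" by blast
  qed
qed

lemma pos_opr:
  assumes X: "X \<in> corner s" and p: "pos_op s (opr s X)"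
  shows "cstar X = X" "0 \<le> Re (cinner (app X x) x)"
proof -
  have "opr s (cstar X) = opr s X" using p X by (simp add: pos_op_def opr_adjoint)
  then show "cstar X = X" using X corner_closed(5) by (metis opr_inject)
  have "0 \<le> Re (inner_l2 (opr s X (coord (app (vproj s) x))) (coord (app (vproj s) x)))"
    using p coord_vproj_in_Hs unfolding pos_op_def by blast
  then have "0 \<le> Re (cinner (app X (app (vproj s) x)) (app (vproj s) x))"
    by (simp add: opr_coord inner_l2_coord)
  also have "cinner (app X (app (vproj s) x)) (app (vproj s) x) = cinner (app X x) x"
    by (metis X cinner_cstar cornerD cstar_vproj)
  finally show "0 \<le> Re (cinner (app X x) x)" .
qed

text \<open>Perturbing x in the direction y = X x, the form at x + t y is 2 t times the squared norm
  of y plus a term quadratic in t. It is nonnegative for every real t, so the linear term must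
  vanish.\<close>

lemma positive_zero:
  fixes X :: "'i l2op"
  assumes sa: "cstar X = X" and pos: "\<And>x. 0 \<le> Re (cinner (app X x) x)" and z: "Re (cinner (app X x) x) = 0"
  shows "app X x = 0"
proof -
  define y where "y = app X x"
  define q where "q = Re (cinner (app X y) y)"
  have "0 \<le> 2 * t * (norm y)\<^sup>2 + t\<^sup>2 * q" for t
  proof -
    have xy: "cinner (app X y) x = cinner y y" by (metis cinner_cstar sa y_def)
    have "cinner (app X (x + t *\<^sub>R y)) (x + t *\<^sub>R y) =
      cinner y x + of_real t * cinner y y + of_real t * cinner (app X y) x + of_real t * of_real t * cinner (app X y) y"
      unfolding scaleR_ell2_def
      by (simp add: app_add app_cscale cinner_add_left cinner_cscale_left cinner_right y_def[symmetric] algebra_simps)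
    then have "Re (cinner (app X (x + t *\<^sub>R y)) (x + t *\<^sub>R y)) = 2 * t * (norm y)\<^sup>2 + t\<^sup>2 * q"
      using z unfolding xy by (simp add: y_def[symmetric] cinner_self_norm q_def power2_eq_square)
    then show ?thesis using pos[of "x + t *\<^sub>R y"] by simp
  qed
  then have h: "0 \<le> 2 * t * (norm y)\<^sup>2 + t\<^sup>2 * q" for t by blast
  have q: "0 \<le> q" unfolding q_def by (rule pos)
  have "(norm y)\<^sup>2 \<le> 0"
  proof (rule ccontr)
    assume "\<not> (norm y)\<^sup>2 \<le> 0"
    define n where "n = (norm y)\<^sup>2"
    have n: "n > 0" using \<open>\<not> (norm y)\<^sup>2 \<le> 0\<close> by (simp add: n_def)
    \<comment> \<open>The shift by 1 keeps the denominator positive, and then 2 n + t q = n + n / (q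
      + 1) > 0.\<close>
    define t where "t = - n / (q + 1)"
    have "t < 0" using n q by (simp add: t_def)
    moreover have "2 * n + t * q > 0"
    proof -
      have "t * q = n / (q + 1) - n" using q by (simp add: t_def field_simps)
      moreover have "n / (q + 1) > 0" using n q by simp
      ultimately show ?thesis using n by linarith
    qed
    ultimately have "t * (2 * n + t * q) < 0" by (rule mult_neg_pos)
    then show False using h[of t] unfolding n_def by (simp add: power2_eq_square algebra_simps)
  qed
  then show ?thesis by (simp add: y_def)
qed

section \<open>The shift operators\<close>

lemma app_sum_left: "app (sum f A) x = (\<Sum>i\<in>A. app (f i) x)"
  by (induction A rule: infinite_finite_induct) auto

definition shift :: "nat \<Rightarrow> nat \<Rightarrow> vtx l2op" where
  "shift s j = wcomp (\<lambda>v. if v \<in> Vs s \<and> 0 < fst v \<and> snd v mod int s = int j then 1 else 0)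
     (\<lambda>v. (fst v - 1, snd v div int s))"

text \<open>A sum of s isometries with orthogonal ranges becomes an isometry after division by sqrt
  s; \<open>opr_bshift\<close> identifies it with \<open>Sop\<close>.\<close>

definition bshift :: "nat \<Rightarrow> vtx l2op" where
  "bshift s = scaleC (complex_of_real (1 / sqrt (real s))) (\<Sum>j<s. shift s j)"

definition diag :: "nat \<Rightarrow> ((nat \<Rightarrow> nat) \<Rightarrow> complex) \<Rightarrow> vtx l2op" where
  "diag s f = wcomp (\<lambda>v. if v \<in> Vs s then f (zemb s (snd v)) else 0) id"

text \<open>The projection onto the root vertex, which is the only vertex outside the ranges of all
  \<open>shift s j\<close>.\<close>

definition vacuum :: "vtx l2op" where
  "vacuum = wcomp (\<lambda>v. if v = (0, 0) then 1 else 0) id"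

text \<open>It acts on all pairs and not just on \<open>Vs s\<close>, which makes it unitary in the
  ambient algebra.\<close>

definition gauge_op :: "complex \<Rightarrow> vtx l2op" where
  "gauge_op z = wcomp (\<lambda>v. z ^ fst v) id"

lemma Vs_succ:
  assumes "(n, x) \<in> Vs s" "j < s"
  shows "(Suc n, int s * x + int j) \<in> Vs s"
proof -
  have "int s * x + int j < int s * (x + 1)" using assms(2) by (simp add: algebra_simps)
  also have "\<dots> \<le> int s * int s ^ n" using assms(1) by (intro mult_left_mono) (auto simp: Vs_def)
  finally show ?thesis using assms(1) by (simp add: Vs_def)
qed

lemma Vs_pred:
  assumes "(m, y) \<in> Vs s" "0 < m" "0 < s"
  shows "(m - 1, y div int s) \<in> Vs s"
proof -
  obtain n where m: "m = Suc n" using assms(2) by (cases m) auto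
  have "y < int s * int s ^ n" using assms(1) by (simp add: Vs_def m)
  moreover have "int s * (y div int s) \<le> y"
    using assms(3) mult_div_mod_eq[of "int s" y] pos_mod_sign[of "int s" y] by linarith
  ultimately have "int s * (y div int s) < int s * int s ^ n" by linarith
  then have "y div int s < int s ^ n" by (simp add: mult_less_cancel_left)
  then show ?thesis using assms by (simp add: Vs_def m pos_imp_zdiv_nonneg_iff)
qed

lemma Vs_zero: "(0, y) \<in> Vs s \<longleftrightarrow> y = 0"
  by (auto simp: Vs_def)

lemma coord_shift: "coord (app (shift s j) x) (m, y) =
    (if (m, y) \<in> Vs s \<and> 0 < m \<and> y mod int s = int j then coord x (m - 1, y div int s) else 0)"
proof -
  have "inj_on (\<lambda>v. (fst v - 1, snd v div int s))
      {v. (if v \<in> Vs s \<and> 0 < fst v \<and> snd v mod int s = int j then 1 else 0 :: complex) \<noteq> 0}"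
  proof (rule inj_onI, clarsimp split: if_splits)
    fix a c :: nat and b d :: int
    assume "a - Suc 0 = c - Suc 0" "0 < a" "0 < c" "b div int s = d div int s"
      "b mod int s = int j" "d mod int s = int j"
    then show "a = c \<and> b = d" by (metis Suc_pred One_nat_def div_mult_mod_eq)
  qed
  then show ?thesis unfolding shift_def by (subst coord_wcomp[where K = 1]) auto
qed

lemma coord_vacuum: "coord (app vacuum x) v = (if v = (0, 0) then coord x v else 0)"
  unfolding vacuum_def by (subst coord_wcomp[where K = 1]) auto

lemma coord_gauge_op:
  assumes "cmod z = 1"
  shows "coord (app (gauge_op z) x) v = z ^ fst v * coord x v"
  unfolding gauge_op_def using assms by (subst coord_wcomp[where K = 1]) (auto simp: norm_power)

text \<open>The bound concerns the embedded integers alone. This is what \<open>diag\<close> needs,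
  and it is inherited by truncations of f and by f with a digit prefixed, without any appeal to
  continuity.\<close>

definition zbounded :: "nat \<Rightarrow> ((nat \<Rightarrow> nat) \<Rightarrow> complex) \<Rightarrow> bool" where
  "zbounded s f \<longleftrightarrow> (\<exists>K\<ge>0. \<forall>y\<ge>0. cmod (f (zemb s y)) \<le> K)"

lemma coord_diag:
  assumes "zbounded s f"
  shows "coord (app (diag s f) x) (m, y) = (if (m, y) \<in> Vs s then f (zemb s y) * coord x (m, y) else 0)"
proof -
  obtain K where "K \<ge> 0" "\<And>y. y \<ge> 0 \<Longrightarrow> cmod (f (zemb s y)) \<le> K"
    using assms unfolding zbounded_def by blast
  then show ?thesis unfolding diag_def by (subst coord_wcomp[where K = K]) (auto simp: Vs_def)
qed

lemma norm_diagonal_le: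
  fixes X :: "'i l2op"
  assumes "\<And>x i. coord (app X x) i = g i * coord x i" "\<And>i. cmod (g i) \<le> K" "0 \<le> K"
  shows "norm X \<le> K"
proof (rule norm_l2op_bound[OF assms(3)])
  fix x
  have "(norm (app X x))\<^sup>2 \<le> (\<Sum>\<^sub>\<infinity>i. K\<^sup>2 * (cmod (coord x i))\<^sup>2)"
    unfolding norm_ell2_sq
  proof (rule infsum_mono[OF sq_summable_coord summable_on_cmult_right[OF sq_summable_coord]])
    show "(cmod (coord (app X x) i))\<^sup>2 \<le> K\<^sup>2 * (cmod (coord x i))\<^sup>2" for i
      using assms by (auto simp: norm_mult power_mult_distrib intro!: mult_right_mono power_mono)
  qed
  also have "\<dots> = (K * norm x)\<^sup>2" by (simp add: infsum_cmult_right' norm_ell2_sq power_mult_distrib)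
  finally show "norm (app X x) \<le> K * norm x"
    by (rule power2_le_imp_le) (use assms(3) in simp)
qed

section \<open>Relations between the isometries \<open>shift s j\<close>\<close>

context
  fixes s :: nat
  assumes s2: "2 \<le> s"
begin

lemma s_pos: "0 < s" using s2 by simp

text \<open>The images of basis vectors are what \<open>coord_app_cstar\<close> needs to read off
  the adjoint.\<close>

lemma app_shift_basis:
  assumes "j < s"
  shows "app (shift s j) (basis (n, x)) = (if (n, x) \<in> Vs s then basis (Suc n, int s * x + int j) else 0)"
proof (rule ell2_eqI)
  fix v :: vtx
  obtain m y where v: "v = (m, y)" by (cases v)
  have 1: "(m, y) = (Suc n, int s * x + int j) \<longleftrightarrow> 0 < m \<and> y mod int s = int j \<and> (m - 1, y div int s) = (n, x)"
  proof
    assume "(m, y) = (Suc n, int s * x + int j)"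
    then show "0 < m \<and> y mod int s = int j \<and> (m - 1, y div int s) = (n, x)"
      using assms s_pos by auto
  next
    assume "0 < m \<and> y mod int s = int j \<and> (m - 1, y div int s) = (n, x)"
    then show "(m, y) = (Suc n, int s * x + int j)"
      using mult_div_mod_eq[of "int s" y] by auto
  qed
  have 2: "(m, y) \<in> Vs s \<longleftrightarrow> (n, x) \<in> Vs s" if "(m, y) = (Suc n, int s * x + int j)"
    using that Vs_succ[OF _ assms, of n x] Vs_pred[of m y s] s_pos 1 by auto
  show "coord (app (shift s j) (basis (n, x))) v =
      coord (if (n, x) \<in> Vs s then basis (Suc n, int s * x + int j) else 0) v"
    using 1 2 unfolding v by (auto simp: coord_shift coord_basis coord_simps)
qed

lemma coord_cstar_shift:
  assumes "j < s"
  shows "coord (app (cstar (shift s j)) x) (n, y) =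
    (if (n, y) \<in> Vs s then coord x (Suc n, int s * y + int j) else 0)"
  by (simp add: coord_app_cstar app_shift_basis[OF assms] cinner_basis)

lemma shift_in_corner: "shift s j \<in> corner s"
proof -
  have "vproj s * shift s j = shift s j"
    by (rule l2op_eqI, rule ell2_eqI) (auto simp: coord_vproj coord_shift)
  moreover have "shift s j * vproj s = shift s j"
    by (rule l2op_eqI, rule ell2_eqI) (auto simp: coord_vproj coord_shift Vs_pred[OF _ _ s_pos, unfolded One_nat_def])
  ultimately show ?thesis by (simp add: corner_def)
qed

lemma shift_vproj [simp]: "shift s j * vproj s = shift s j" "vproj s * shift s j = shift s j"
  using shift_in_corner[of j] by (simp_all add: corner_def)

lemma cstar_shift_shift:
  assumes "i < s" "j < s"
  shows "cstar (shift s i) * shift s j = (if i = j then vproj s else 0)"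
proof (rule l2op_eqI, rule ell2_eqI)
  fix x and v :: vtx
  obtain n y where v: "v = (n, y)" by (cases v)
  show "coord (app (cstar (shift s i) * shift s j) x) v = coord (app (if i = j then vproj s else 0) x) v"
    using assms Vs_succ[of n y s i]
    by (auto simp: v coord_cstar_shift coord_shift coord_vproj coord_simps)
qed

text \<open>A vertex of positive level has exactly one last digit and hence lies in the range of
  exactly one \<open>shift s j\<close>; the root lies in none.\<close>

lemma shift_decomposition: "(\<Sum>j<s. shift s j * cstar (shift s j)) + vacuum = vproj s"
proof (rule l2op_eqI, rule ell2_eqI)
  fix x and v :: vtx
  obtain m y where v: "v = (m, y)" by (cases v)
  have t: "coord (app (shift s j * cstar (shift s j)) x) (m, y) =
      (if int j = y mod int s then if (m, y) \<in> Vs s \<and> 0 < m then coord x (m, y) else 0 else 0)" if "j < s" for j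
    using that Vs_pred[of m y s] s_pos mult_div_mod_eq[of "int s" y]
    by (auto simp: coord_shift coord_cstar_shift)
  have "(\<Sum>j<s. coord (app (shift s j * cstar (shift s j)) x) (m, y)) =
      (\<Sum>j<s. if j = nat (y mod int s) then if (m, y) \<in> Vs s \<and> 0 < m then coord x (m, y) else 0 else 0)"
    by (rule sum.cong[OF refl]) (use t s_pos in \<open>auto simp: nat_eq_iff\<close>)
  also have "\<dots> = (if (m, y) \<in> Vs s \<and> 0 < m then coord x (m, y) else 0)"
  proof -
    have "nat (y mod int s) < s" using s_pos by (simp add: nat_less_iff)
    then show ?thesis by simp
  qed
  finally show "coord (app ((\<Sum>j<s. shift s j * cstar (shift s j)) + vacuum) x) v = coord (app (vproj s) x) v"
    using Vs_zero[of y s]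
    by (auto simp del: app_simps(7) simp: v coord_simps app_sum_left coord_sum coord_vacuum coord_vproj)
qed

lemma cstar_vacuum: "cstar vacuum = vacuum"
proof -
  have "(\<Sum>j<s. shift s j * cstar (shift s j)) + cstar vacuum = vproj s"
    using arg_cong[OF shift_decomposition, of cstar]
    by (simp add: cstar_add cstar_sum cstar_mult cstar_cstar cstar_vproj)
  then show ?thesis using shift_decomposition by (metis add_left_cancel)
qed


lemma opr_shift: "opr s (shift s j) = Sj s j"
proof (rule op_eqI[of s])
  show "opr s (shift s j) \<xi> = Sj s j \<xi>" if "\<xi> \<notin> Hs s" for \<xi> using that by (simp add: opr_not_in Sj_def)
  show "opr s (shift s j) (coord x) = Sj s j (coord x)" if "app (vproj s) x = x" for x
    using that by (auto simp: opr_coord Sj_def coord_in_Hs coord_shift fun_eq_iff)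
qed

lemma bshift_in_corner: "bshift s \<in> corner s"
  unfolding bshift_def
  by (intro corner_closed cstar_subalg_sum[OF cstar_subalg_corner] shift_in_corner) (use shift_in_corner in blast)

lemma coord_bshift: "coord (app (bshift s) x) (m, y) =
    (if (m, y) \<in> Vs s \<and> 0 < m then coord x (m - 1, y div int s) / complex_of_real (sqrt (real s)) else 0)"
proof -
  have "(\<Sum>j<s. coord (app (shift s j) x) (m, y)) =
      (\<Sum>j<s. if j = nat (y mod int s) then if (m, y) \<in> Vs s \<and> 0 < m then coord x (m - 1, y div int s) else 0 else 0)"
    by (rule sum.cong[OF refl]) (use s_pos in \<open>auto simp: coord_shift nat_eq_iff\<close>)
  also have "\<dots> = (if (m, y) \<in> Vs s \<and> 0 < m then coord x (m - 1, y div int s) else 0)"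
  proof -
    have "nat (y mod int s) < s" using s_pos by (simp add: nat_less_iff)
    then show ?thesis by simp
  qed
  finally show ?thesis by (simp add: bshift_def app_scaleC coord_simps app_sum_left coord_sum)
qed

lemma opr_bshift: "opr s (bshift s) = Sop s"
proof (rule op_eqI[of s])
  show "opr s (bshift s) \<xi> = Sop s \<xi>" if "\<xi> \<notin> Hs s" for \<xi> using that by (simp add: opr_not_in Sop_def)
  show "opr s (bshift s) (coord x) = Sop s (coord x)" if "app (vproj s) x = x" for x
    using that by (auto simp: opr_coord Sop_def coord_in_Hs coord_bshift fun_eq_iff)
qed

lemma bshift_isometry: "cstar (bshift s) * bshift s = vproj s"
proof -
  have "cstar (\<Sum>j<s. shift s j) * (\<Sum>j<s. shift s j) = (\<Sum>i<s. \<Sum>j<s. cstar (shift s i) * shift s j)"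
    by (simp add: cstar_sum sum_product)
  also have "\<dots> = (\<Sum>i<s. \<Sum>j<s. if i = j then vproj s else 0)"
    by (intro sum.cong refl) (simp add: cstar_shift_shift)
  also have "\<dots> = real s *\<^sub>R vproj s" by (simp add: sum_constant_scaleR del: sum_constant)
  finally have eq: "cstar (\<Sum>j<s. shift s j) * (\<Sum>j<s. shift s j) = real s *\<^sub>R vproj s" .
  have "cstar (bshift s) * bshift s = (1 / sqrt (real s) * (1 / sqrt (real s))) *\<^sub>R (real s *\<^sub>R vproj s)"
    unfolding bshift_def eq[symmetric] scaleC_of_real by (simp add: cstar_scaleR mult.commute)
  then show ?thesis using s_pos by simp
qed

fun sword :: "nat \<Rightarrow> nat \<Rightarrow> vtx l2op" where
  "sword 0 x = vproj s"
| "sword (Suc n) x = shift s (x mod s) * sword n (x div s)"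

lemma sword_in_corner: "sword n x \<in> corner s"
  by (induction n x rule: sword.induct) (auto intro: corner_closed shift_in_corner vproj_in_corner)

text \<open>Splitting off the lowest digit moves all other digit positions down by one, which is
  division of x by s.\<close>

lemma Sword_Suc: "Sword s (Suc n) x = Sj s (x mod s) \<circ> Sword s n (x div s)"
proof -
  have "[0..<Suc n] = 0 # map Suc [0..<n]" by (simp add: map_Suc_upt upt_conv_Cons)
  then show ?thesis unfolding Sword_def by (simp add: foldr_map comp_def div_mult2_eq)
qed

lemma opr_sword: "opr s (sword n x) = Sword s n x"
proof (induction n arbitrary: x)
  case 0
  show ?case by (simp add: Sword_def opr_vproj)
next
  case (Suc n)
  then show ?case by (simp add: Sword_Suc opr_mult sword_in_corner opr_shift)
qed

section \<open>The algebra \<open>B_S\<close> and its stability under conjugation by the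
  isometries\<close>

definition core_gens :: "vtx l2op set" where
  "core_gens = {sword n x * cstar (sword n y) | n x y. x < s ^ n \<and> y < s ^ n}"

definition core :: "vtx l2op set" where
  "core = cstar_generated core_gens"

lemma core_subalg: "cstar_subalg core"
  unfolding core_def by (rule cstar_subalg_generated)

lemmas core_closed = cstar_subalgD[OF core_subalg]

lemma core_gens_in_core: "g \<in> core_gens \<Longrightarrow> g \<in> core"
  unfolding core_def using cstar_generated_subset by blast

lemma core_gensI: "x < s ^ n \<Longrightarrow> y < s ^ n \<Longrightarrow> sword n x * cstar (sword n y) \<in> core_gens"
  unfolding core_gens_def by blast

lemma core_gens_corner: "core_gens \<subseteq> corner s"
  unfolding core_gens_def by (auto intro!: corner_closed sword_in_corner)

lemma core_corner: "core \<subseteq> corner s"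
  unfolding core_def by (rule cstar_generated_least[OF core_gens_corner cstar_subalg_corner])

lemma B_S_eq: "B_S s = opr s ` core"
proof -
  have "{Sword s n x \<circ> adj s (Sword s n y) | n x y. x < s ^ n \<and> y < s ^ n} = opr s ` core_gens"
  proof -
    have "opr s (sword n x * cstar (sword n y)) = Sword s n x \<circ> adj s (Sword s n y)" for n x y
      by (simp add: opr_mult corner_closed sword_in_corner opr_adjoint[symmetric] opr_sword)
    then show ?thesis unfolding core_gens_def by (auto simp: image_iff) metis+
  qed
  then show ?thesis unfolding B_S_def core_def using gen_cstar_opr[OF core_gens_corner] by simp
qed

lemma vproj_in_core: "vproj s \<in> core"
  using core_gens_in_core[OF core_gensI[of 0 0 0]] by (simp add: cstar_vproj vproj_idem)

lemma vproj_core: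
  assumes "b \<in> core"
  shows "vproj s * b = b" "b * vproj s = b"
  using assms core_corner by (auto simp: corner_def)

text \<open>Self-similarity: a generator with words of positive length is a shorter generator
  between a \<open>shift\<close> and the adjoint of a \<open>shift\<close>. A case split thereby
  replaces inductions over words.\<close>

lemma core_gens_cases:
  assumes "g \<in> core_gens"
  obtains "g = vproj s" | j k h where "j < s" "k < s" "h \<in> core_gens" "g = shift s j * h * cstar (shift s k)"
proof -
  obtain n x y where g: "g = sword n x * cstar (sword n y)" "x < s ^ n" "y < s ^ n"
    using assms unfolding core_gens_def by blast
  show thesis
  proof (cases n)
    case 0
    then show thesis using g that(1) by (simp add: cstar_vproj vproj_idem)
  next
    case (Suc k)
    have "x div s < s ^ k" "y div s < s ^ k"
      using g Suc s_pos by (auto simp: less_mult_imp_div_less mult.commute)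
    then have "sword k (x div s) * cstar (sword k (y div s)) \<in> core_gens" by (rule core_gensI)
    moreover have "g = shift s (x mod s) * (sword k (x div s) * cstar (sword k (y div s))) * cstar (shift s (y mod s))"
      using g Suc by (simp add: cstar_mult mult.assoc)
    ultimately show thesis
      using that(2)[of "x mod s" "y mod s"] mod_less_divisor[OF s_pos] by blast
  qed
qed

lemma shift_core_gens:
  assumes g: "g \<in> core_gens" and jk: "j < s" "k < s"
  shows "shift s j * g * cstar (shift s k) \<in> core_gens"
proof -
  obtain n x y where g: "g = sword n x * cstar (sword n y)" "x < s ^ n" "y < s ^ n"
    using assms unfolding core_gens_def by blast
  have lt: "s * x + j < s ^ Suc n" if "x < s ^ n" "j < s" for x j
  proof -
    have "s * x + j < s * (x + 1)" using that by simp
    also have "\<dots> \<le> s * s ^ n" using that by (intro mult_left_mono) auto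
    finally show ?thesis by simp
  qed
  have "sword (Suc n) (s * x + j) * cstar (sword (Suc n) (s * y + k)) \<in> core_gens"
    using g lt jk by (intro core_gensI)
  then show ?thesis using jk by (simp add: g cstar_mult mult.assoc)
qed

text \<open>All pairs j, k are treated in one set, since a product x y splits into a factor for the
  pair j, 0 and a factor for the pair 0, k. Membership in the corner lets the inserted S_0* S_0 be
  absorbed.\<close>

lemma core_shift:
  assumes b: "b \<in> core" and jk: "j < s" "k < s"
  shows "shift s j * b * cstar (shift s k) \<in> core"
proof -
  let ?C = "{b. \<forall>j<s. \<forall>k<s. shift s j * b * cstar (shift s k) \<in> core} \<inter> corner s"
  have "closed {b. \<forall>j<s. \<forall>k<s. shift s j * b * cstar (shift s k) \<in> core}"
  proof -
    have "{b. \<forall>j<s. \<forall>k<s. shift s j * b * cstar (shift s k) \<in> core} =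
        (\<Inter>j\<in>{..<s}. \<Inter>k\<in>{..<s}. (\<lambda>b. shift s j * b * cstar (shift s k)) -` core)" by auto
    moreover have "closed ((\<lambda>b. shift s j * b * cstar (shift s k)) -` core)" for j k
      by (intro closed_vimage core_closed continuous_intros)
    ultimately show ?thesis by (simp add: closed_INT)
  qed
  then have "closed ?C" by (intro closed_Int corner_closed)
  moreover have "x + y \<in> ?C" if "x \<in> ?C" "y \<in> ?C" for x y
    using that by (auto simp: distrib_left distrib_right intro: core_closed(2) corner_closed)
  moreover have "x * y \<in> ?C" if xy: "x \<in> ?C" "y \<in> ?C" for x y
  proof -
    have "shift s j * (x * y) * cstar (shift s k) =
        (shift s j * x * cstar (shift s 0)) * (shift s 0 * y * cstar (shift s k))" for j k
    proof -
      have "x * (cstar (shift s 0) * shift s 0) * y = x * y"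
        using xy s_pos by (simp add: cstar_shift_shift corner_def)
      then show ?thesis by (simp add: mult.assoc) (metis mult.assoc)
    qed
    moreover have "shift s j * x * cstar (shift s 0) \<in> core" "shift s 0 * y * cstar (shift s k) \<in> core"
      if "j < s" "k < s" for j k
      using xy s_pos that by blast+
    ultimately show ?thesis using xy by (auto intro: corner_closed core_closed(3))
  qed
  moreover have "scaleC c x \<in> ?C" if "x \<in> ?C" for c x
    using that by (auto simp: mult_scaleC_left mult_scaleC_right intro: core_closed(4) corner_closed)
  moreover have "cstar x \<in> ?C" if x: "x \<in> ?C" for x
  proof -
    have "shift s j * cstar x * cstar (shift s k) = cstar (shift s k * x * cstar (shift s j))" for j k
      by (simp add: cstar_mult cstar_cstar mult.assoc)
    then show ?thesis using x by (auto intro: core_closed(5) corner_closed)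
  qed
  ultimately have "cstar_subalg ?C" by (rule cstar_subalgI)
  moreover have "core_gens \<subseteq> ?C"
    using core_gens_corner by (auto intro: core_gens_in_core shift_core_gens)
  ultimately have "core \<subseteq> ?C" unfolding core_def by (rule cstar_generated_least[rotated])
  then show ?thesis using b jk by blast
qed

end

lemma commute_mult:
  fixes a x y :: "'a::semigroup_mult"
  assumes "a * x = x * a" "a * y = y * a"
  shows "a * (x * y) = x * y * a"
proof -
  have "a * (x * y) = x * (a * y)" using assms(1) by (simp only: mult.assoc[symmetric])
  then show ?thesis using assms(2) by (simp only: mult.assoc)
qed

section \<open>The defect projection and stability of \<open>B_S\<close> under compression\<close>

context
  fixes s :: nat
  assumes s2: "2 \<le> s"
begin

lemmas K_closed = core_closed[OF s2]

lemma K_ne: "core s \<noteq> {}"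
  using vproj_in_core[OF s2] by blast

lemma vacuum_shift:
  assumes "j < s"
  shows "vacuum * shift s j = 0" "cstar (shift s j) * vacuum = 0"
proof -
  have "(\<Sum>i<s. shift s i * cstar (shift s i)) * shift s j = (\<Sum>i<s. if i = j then shift s j else 0)"
    unfolding sum_distrib_right
    by (rule sum.cong[OF refl]) (use assms in \<open>auto simp: mult.assoc cstar_shift_shift[OF s2] shift_vproj[OF s2]\<close>)
  also have "\<dots> = shift s j" using assms by simp
  finally have "vproj s * shift s j = shift s j + vacuum * shift s j"
    using arg_cong[OF shift_decomposition[OF s2], of "\<lambda>t. t * shift s j"] by (simp add: distrib_right)
  then show 0: "vacuum * shift s j = 0" by (simp add: shift_vproj[OF s2])
  show "cstar (shift s j) * vacuum = 0"
    using arg_cong[OF 0, of cstar] by (simp add: cstar_mult cstar_vacuum[OF s2])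
qed

lemma vacuum_in_core: "vacuum \<in> core s"
proof -
  have "shift s j * cstar (shift s j) \<in> core s" if "j < s" for j
    using core_shift[OF s2 vproj_in_core[OF s2] that that] by (simp add: shift_vproj[OF s2])
  then have "(\<Sum>j<s. shift s j * cstar (shift s j)) \<in> core s"
    by (intro cstar_subalg_sum[OF core_subalg[OF s2] K_ne]) auto
  then have "vproj s - (\<Sum>j<s. shift s j * cstar (shift s j)) \<in> core s"
    by (intro K_closed vproj_in_core[OF s2])
  then show ?thesis using shift_decomposition[OF s2] by (metis add_diff_cancel_left')
qed

lemma subalg_commutant_vacuum: "cstar_subalg {b. vacuum * b = b * vacuum}"
proof (rule cstar_subalgI)
  show "closed {b. vacuum * b = b * vacuum}" by (intro closed_Collect_eq continuous_intros)
  show "cstar x \<in> {b. vacuum * b = b * vacuum}" if "x \<in> {b. vacuum * b = b * vacuum}" for x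
  proof -
    have "cstar (vacuum * x) = cstar (x * vacuum)" using that by simp
    then show ?thesis by (simp add: cstar_mult cstar_vacuum[OF s2])
  qed
  show "x * y \<in> {b. vacuum * b = b * vacuum}"
    if "x \<in> {b. vacuum * b = b * vacuum}" "y \<in> {b. vacuum * b = b * vacuum}" for x y
    using that commute_mult by blast
qed (auto simp: distrib_left distrib_right mult_scaleC_left mult_scaleC_right)

text \<open>A generator other than the unit begins with a \<open>shift\<close> and ends with the
  adjoint of one, so \<open>vacuum\<close> annihilates it from both sides.\<close>

lemma core_commute_vacuum:
  assumes "b \<in> core s"
  shows "vacuum * b = b * vacuum"
proof -
  have "core_gens s \<subseteq> {b. vacuum * b = b * vacuum}"
  proof clarify
    fix g assume "g \<in> core_gens s"
    then show "vacuum * g = g * vacuum"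
    proof (rule core_gens_cases[OF s2])
      assume "g = vproj s"
      then show ?thesis using vproj_core[OF s2 vacuum_in_core] by simp
    next
      fix j k h assume *: "j < s" "k < s" "g = shift s j * h * cstar (shift s k)"
      have "vacuum * g = (vacuum * shift s j) * h * cstar (shift s k)"
        unfolding *(3) by (simp only: mult.assoc)
      moreover have "g * vacuum = shift s j * h * (cstar (shift s k) * vacuum)"
        unfolding *(3) by (simp only: mult.assoc)
      ultimately show ?thesis using vacuum_shift *(1,2) by simp
    qed
  qed
  then have "core s \<subseteq> {b. vacuum * b = b * vacuum}"
    unfolding core_def[OF s2] using subalg_commutant_vacuum by (rule cstar_generated_least)
  then show ?thesis using assms by blast
qed

text \<open>To split the compression of x y, the unit is written between x and y as the sum of all
  S_i S_i* plus \<open>vacuum\<close>. The sum gives products of compressions, so all pairs j, k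
  must be handled together; the remaining term vanishes.\<close>

lemma core_unshift:
  assumes b: "b \<in> core s" and jk: "j < s" "k < s"
  shows "cstar (shift s j) * b * shift s k \<in> core s"
proof -
  let ?C = "{b. \<forall>j<s. \<forall>k<s. cstar (shift s j) * b * shift s k \<in> core s} \<inter> core s"
  have "closed {b. \<forall>j<s. \<forall>k<s. cstar (shift s j) * b * shift s k \<in> core s}"
  proof -
    have "{b. \<forall>j<s. \<forall>k<s. cstar (shift s j) * b * shift s k \<in> core s} =
        (\<Inter>j\<in>{..<s}. \<Inter>k\<in>{..<s}. (\<lambda>b. cstar (shift s j) * b * shift s k) -` core s)" by auto
    moreover have "closed ((\<lambda>b. cstar (shift s j) * b * shift s k) -` core s)" for j k
      by (intro closed_vimage K_closed continuous_intros)
    ultimately show ?thesis by (simp add: closed_INT)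
  qed
  then have "closed ?C" by (intro closed_Int K_closed)
  moreover have "x + y \<in> ?C" if "x \<in> ?C" "y \<in> ?C" for x y
    using that by (auto simp: distrib_left distrib_right intro: K_closed(2))
  moreover have "x * y \<in> ?C" if xy: "x \<in> ?C" "y \<in> ?C" for x y
  proof -
    have "cstar (shift s j) * (x * y) * shift s k =
        (\<Sum>i<s. (cstar (shift s j) * x * shift s i) * (cstar (shift s i) * y * shift s k))" if "j < s" for j k
    proof -
      \<comment> \<open>Centrality lets \<open>vacuum\<close> move past x to the adjoint of
        \<open>shift s j\<close>, which kills it; this is where the set is intersected with the
        core.\<close>
      have "cstar (shift s j) * (x * vacuum) = 0"
      proof -
        have "x * vacuum = vacuum * x" using core_commute_vacuum[of x] xy by simp
        then show ?thesis by (simp add: mult.assoc[symmetric] vacuum_shift[OF that])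
      qed
      then have 0: "cstar (shift s j) * x * vacuum * t = 0" for t by (simp add: mult.assoc[symmetric])
      have "cstar (shift s j) * (x * y) * shift s k = cstar (shift s j) * x * vproj s * (y * shift s k)"
      proof -
        have "x * vproj s = x" using vproj_core(2)[OF s2, of x] xy by simp
        moreover have "cstar (shift s j) * x * vproj s * (y * shift s k) =
            cstar (shift s j) * ((x * vproj s) * y) * shift s k" by (simp only: mult.assoc)
        ultimately show ?thesis by simp
      qed
      also have "\<dots> = cstar (shift s j) * x * (\<Sum>i<s. shift s i * cstar (shift s i)) * (y * shift s k)"
        unfolding shift_decomposition[OF s2, symmetric] by (simp add: distrib_left distrib_right 0)
      finally show ?thesis by (simp add: sum_distrib_left sum_distrib_right mult.assoc)
    qed
    moreover have "(\<Sum>i<s. (cstar (shift s j) * x * shift s i) * (cstar (shift s i) * y * shift s k)) \<in> core s"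
      if "j < s" "k < s" for j k
    proof (rule cstar_subalg_sum[OF core_subalg[OF s2] K_ne])
      fix i assume "i \<in> {..<s}"
      then have "cstar (shift s j) * x * shift s i \<in> core s" "cstar (shift s i) * y * shift s k \<in> core s"
        using that xy by auto
      then show "(cstar (shift s j) * x * shift s i) * (cstar (shift s i) * y * shift s k) \<in> core s"
        by (rule K_closed)
    qed
    ultimately show ?thesis using xy by (auto intro: K_closed(3))
  qed
  moreover have "scaleC c x \<in> ?C" if "x \<in> ?C" for c x
    using that by (auto simp: mult_scaleC_left mult_scaleC_right intro: K_closed(4))
  moreover have "cstar x \<in> ?C" if x: "x \<in> ?C" for x
  proof -
    have "cstar (shift s j) * cstar x * shift s k = cstar (cstar (shift s k) * x * shift s j)" for j k
      by (simp add: cstar_mult cstar_cstar mult.assoc)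
    then show ?thesis using x by (auto intro: K_closed(5))
  qed
  ultimately have C: "cstar_subalg ?C" by (rule cstar_subalgI)
  have "core_gens s \<subseteq> ?C"
  proof (intro subsetI IntI CollectI allI impI)
    fix g assume g: "g \<in> core_gens s"
    show "g \<in> core s" using core_gens_in_core[OF s2 g] .
    fix j k assume jk: "j < s" "k < s"
    from g show "cstar (shift s j) * g * shift s k \<in> core s"
    proof (rule core_gens_cases[OF s2])
      assume "g = vproj s"
      then show ?thesis
        using jk K_closed(9)[OF vproj_in_core[OF s2]] vproj_in_core[OF s2]
        by (simp add: mult.assoc shift_vproj[OF s2] cstar_shift_shift[OF s2])
    next
      fix i l h assume *: "i < s" "l < s" "h \<in> core_gens s" "g = shift s i * h * cstar (shift s l)"
      have h: "h \<in> core s" using core_gens_in_core[OF s2 *(3)] .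
      have "cstar (shift s j) * g * shift s k =
          (cstar (shift s j) * shift s i) * h * (cstar (shift s l) * shift s k)"
        unfolding *(4) by (simp only: mult.assoc)
      \<comment> \<open>Orthogonality of the ranges strips the outer letters exactly when they
        match.\<close>
      also have "\<dots> = (if j = i \<and> l = k then h else 0)"
        using * jk h by (simp add: cstar_shift_shift[OF s2] vproj_core[OF s2])
      finally show ?thesis using h K_closed(9)[OF h] by simp
    qed
  qed
  then have "core s \<subseteq> ?C" using C unfolding core_def[OF s2] by (rule cstar_generated_least)
  then show ?thesis using b jk by blast
qed

lemma core_bshift:
  assumes "b \<in> core s"
  shows "bshift s * b * cstar (bshift s) \<in> core s" "cstar (bshift s) * b * bshift s \<in> core s"
proof -
  have "(\<Sum>j<s. shift s j) * b * cstar (\<Sum>k<s. shift s k) = (\<Sum>j<s. \<Sum>k<s. shift s j * b * cstar (shift s k))"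
    unfolding cstar_sum by (simp only: sum_distrib_right[of _ _ b] sum_product)
  moreover have "\<dots> \<in> core s"
    by (intro cstar_subalg_sum[OF core_subalg[OF s2] K_ne] core_shift[OF s2 assms]) auto
  ultimately show "bshift s * b * cstar (bshift s) \<in> core s"
    unfolding bshift_def by (simp add: cstar_scaleC mult_scaleC_left mult_scaleC_right K_closed)
  have "cstar (\<Sum>j<s. shift s j) * b * (\<Sum>k<s. shift s k) = (\<Sum>j<s. \<Sum>k<s. cstar (shift s j) * b * shift s k)"
    unfolding cstar_sum by (simp only: sum_distrib_right[of _ _ b] sum_product)
  moreover have "\<dots> \<in> core s"
    by (intro cstar_subalg_sum[OF core_subalg[OF s2] K_ne] core_unshift[OF assms]) auto
  ultimately show "cstar (bshift s) * b * bshift s \<in> core s"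
    unfolding bshift_def by (simp add: cstar_scaleC mult_scaleC_left mult_scaleC_right K_closed)
qed

section \<open>The gauge action\<close>

lemma gauge_op_unitary:
  assumes z: "cmod z = 1"
  shows "cstar (gauge_op z) * gauge_op z = 1" "gauge_op z * cstar (gauge_op z) = 1"
proof -
  have zz: "z ^ n * (cnj z ^ n * t) = t" "cnj z ^ n * (z ^ n * t) = t" for n t
  proof -
    have "z * cnj z = 1" using z complex_norm_square[of z] by simp
    then have "z ^ n * cnj z ^ n = 1" by (metis power_mult_distrib power_one)
    then show "z ^ n * (cnj z ^ n * t) = t" "cnj z ^ n * (z ^ n * t) = t"
      by (simp_all only: mult.assoc[symmetric] mult.commute[of "cnj z ^ n" "z ^ n"] mult_1_left)
  qed
  have "app (gauge_op z) (basis v) = cscale (z ^ fst v) (basis v)" for v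
    by (rule ell2_eqI) (auto simp: coord_gauge_op[OF z] coord_basis coord_simps)
  then have c: "coord (app (cstar (gauge_op z)) x) v = cnj z ^ fst v * coord x v" for x v
    by (simp add: coord_app_cstar cinner_right cinner_basis)
  show "cstar (gauge_op z) * gauge_op z = 1" "gauge_op z * cstar (gauge_op z) = 1"
    by (rule l2op_eqI, rule ell2_eqI, simp add: c coord_gauge_op[OF z] zz)+
qed

lemma gauge_op_shift:
  assumes z: "cmod z = 1"
  shows "gauge_op z * shift s j = scaleC z (shift s j * gauge_op z)"
proof (rule l2op_eqI, rule ell2_eqI)
  fix x and v :: vtx
  obtain m y where v: "v = (m, y)" by (cases v)
  show "coord (app (gauge_op z * shift s j) x) v = coord (app (scaleC z (shift s j * gauge_op z)) x) v"
    by (cases m) (auto simp: v coord_gauge_op[OF z] coord_shift app_scaleC coord_simps)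
qed

lemma gauge_op_bshift:
  assumes z: "cmod z = 1"
  shows "gauge_op z * bshift s = scaleC z (bshift s * gauge_op z)"
proof -
  let ?r = "complex_of_real (1 / sqrt (real s))" and ?T = "\<Sum>j<s. shift s j"
  have "gauge_op z * ?T = scaleC z (?T * gauge_op z)"
    by (simp only: sum_distrib_left sum_distrib_right scaleC_sum_right gauge_op_shift[OF z])
  then have "gauge_op z * scaleC ?r ?T = scaleC (?r * z) (?T * gauge_op z)"
    by (simp only: mult_scaleC_right scaleC_scaleC)
  also have "\<dots> = scaleC z (scaleC ?r ?T * gauge_op z)"
    by (simp only: mult_scaleC_left scaleC_scaleC mult.commute)
  finally show ?thesis unfolding bshift_def .
qed

text \<open>Both words of a generator have the same length, so the phases z from the isometries
  cancel against the conjugate phases from the adjoints.\<close>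

lemma gauge_op_core:
  assumes z: "cmod z = 1" and b: "b \<in> core s"
  shows "gauge_op z * b = b * gauge_op z"
proof -
  let ?U = "gauge_op z"
  note u = gauge_op_unitary[OF z]
  have "cstar_subalg {b. ?U * b = b * ?U}"
  proof (rule cstar_subalgI)
    show "closed {b. ?U * b = b * ?U}" by (intro closed_Collect_eq continuous_intros)
    show "cstar x \<in> {b. ?U * b = b * ?U}" if "x \<in> {b. ?U * b = b * ?U}" for x
    proof -
      have eq: "cstar x * cstar ?U = cstar ?U * cstar x" 
        using that arg_cong[of "?U * x" "x * ?U" cstar] unfolding cstar_mult by simp
      have "?U * cstar x = ?U * (cstar x * cstar ?U) * ?U" using u(1) by (simp add: mult.assoc)
      also have "\<dots> = cstar x * ?U" unfolding eq using u(2) by (simp add: mult.assoc[symmetric])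
      finally show ?thesis by simp
    qed
    show "x * y \<in> {b. ?U * b = b * ?U}" if "x \<in> {b. ?U * b = b * ?U}" "y \<in> {b. ?U * b = b * ?U}" for x y
      using that commute_mult by blast
  qed (auto simp: distrib_left distrib_right mult_scaleC_left mult_scaleC_right)
  moreover have "core_gens s \<subseteq> {b. ?U * b = b * ?U}"
  proof -
    have cs: "?U * cstar (shift s k) = scaleC (cnj z) (cstar (shift s k) * ?U)" for k
    proof -
      have "cstar (shift s k) * cstar ?U = scaleC (cnj z) (cstar ?U * cstar (shift s k))"
        using arg_cong[OF gauge_op_shift[OF z, of k], of cstar] by (simp add: cstar_mult cstar_scaleC)
      then have "?U * (cstar (shift s k) * cstar ?U) * ?U = ?U * scaleC (cnj z) (cstar ?U * cstar (shift s k)) * ?U"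
        by simp
      then have "?U * cstar (shift s k) * (cstar ?U * ?U) = scaleC (cnj z) ((?U * cstar ?U) * cstar (shift s k) * ?U)"
        by (simp only: mult_scaleC_right mult_scaleC_left mult.assoc)
      then show ?thesis by (simp add: u)
    qed
    have zz: "z * cnj z = 1" using z complex_norm_square[of z] by simp
    have sw: "?U * (sword s n x * cstar (sword s n y)) = sword s n x * cstar (sword s n y) * ?U" for n x y
    proof (induction n arbitrary: x y)
      case 0
      have "?U * vproj s = vproj s * ?U"
        by (rule l2op_eqI, rule ell2_eqI) (auto simp: coord_gauge_op[OF z] coord_vproj)
      then show ?case by (simp add: sword.simps[OF s2] cstar_vproj vproj_idem)
    next
      case (Suc n)
      let ?g = "sword s n (x div s) * cstar (sword s n (y div s))"
      let ?j = "shift s (x mod s)" and ?k = "cstar (shift s (y mod s))"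
      have e: "sword s (Suc n) x * cstar (sword s (Suc n) y) = ?j * ?g * ?k"
        by (simp add: sword.simps[OF s2] cstar_mult mult.assoc)
      have "?U * (?j * ?g * ?k) = scaleC z (?j * (?U * ?g) * ?k)"
        by (simp add: gauge_op_shift[OF z] mult_scaleC_left mult.assoc[symmetric])
      also have "?U * ?g = ?g * ?U" by (rule Suc)
      also have "scaleC z (?j * (?g * ?U) * ?k) = scaleC z (?j * ?g * (?U * ?k))" by (simp add: mult.assoc)
      also have "\<dots> = ?j * ?g * ?k * ?U"
        unfolding cs by (simp add: mult_scaleC_right scaleC_scaleC zz scaleC_one mult.assoc)
      finally show ?case unfolding e .
    qed
    then show ?thesis unfolding core_gens_def[OF s2] by blast
  qed
  ultimately have "core s \<subseteq> {b. ?U * b = b * ?U}"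
    unfolding core_def[OF s2] by (rule cstar_generated_least[rotated])
  then show ?thesis using b by blast
qed

lemma corner_endomorphism_core: "corner_endomorphism (core s) (vproj s) (bshift s)"
proof
  show "cstar_subalg (core s)" by (rule core_subalg[OF s2])
  show "vproj s \<in> core s" by (rule vproj_in_core[OF s2])
  show "cstar (bshift s) * bshift s = vproj s" by (rule bshift_isometry[OF s2])
  show "bshift s * vproj s = bshift s" "vproj s * bshift s = bshift s"
    using bshift_in_corner[OF s2] by (simp_all add: corner_def)
  fix b assume b: "b \<in> core s"
  show "vproj s * b = b" "b * vproj s = b" using vproj_core[OF s2 b] by auto
  show "bshift s * b * cstar (bshift s) \<in> core s" "cstar (bshift s) * b * bshift s \<in> core s"
    using core_bshift[OF b] by auto
next
  fix z :: complex assume z: "cmod z = 1"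
  show "\<exists>u. cstar u * u = 1 \<and> u * cstar u = 1 \<and> (\<forall>b\<in>core s. u * b = b * u) \<and> u * bshift s = scaleC z (bshift s * u)"
    using gauge_op_unitary[OF z] gauge_op_core[OF z] gauge_op_bshift[OF z] by blast
qed

end

section \<open>Multiplication operators\<close>

lemma zemb_digit:
  assumes "0 < s"
  shows "zemb s x i < s"
  using assms by (simp add: zemb_def)

lemma zemb_cons:
  assumes "0 < s" "0 \<le> y" "j < s"
  shows "zemb s (int s * y + int j) = case_nat j (zemb s y)"
proof
  fix i
  have n: "nat (int s * y + int j) = s * nat y + j"
    using assms by (simp add: nat_add_distrib nat_mult_distrib)
  show "zemb s (int s * y + int j) i = case_nat j (zemb s y) i"
    using assms by (cases i) (auto simp: zemb_def n div_mult2_eq)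
qed

lemma zemb_split:
  assumes "0 < s" "0 \<le> y"
  shows "zemb s y = case_nat (nat (y mod int s)) (zemb s (y div int s))"
proof -
  have "nat (y mod int s) < s" using assms by (simp add: nat_less_iff)
  moreover have "0 \<le> y div int s" using assms by (simp add: pos_imp_zdiv_nonneg_iff)
  ultimately show ?thesis using zemb_cons[of s "y div int s" "nat (y mod int s)"] assms by simp
qed

lemma zemb_zero: "zemb s 0 = (\<lambda>_. 0)"
  by (simp add: zemb_def fun_eq_iff)

lemma topspace_Zs: "topspace (Zs_top s) = {a. \<forall>i. a i < s}"
  by (auto simp: Zs_top_def PiE_def Pi_def)

lemma compact_space_Zs: "compact_space (Zs_top s)"
  unfolding Zs_top_def by (simp add: compact_space_product_topology compact_space_discrete_topology)

lemma continuous_Zs_bounded: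
  assumes "continuous_map (Zs_top s) euclidean f" "0 < s"
  shows "zbounded s f"
proof -
  have "compactin euclidean (f ` topspace (Zs_top s))"
    using assms(1) compact_space_Zs by (intro image_compactin[of "Zs_top s"]) (auto simp: compact_space_def)
  then have "bounded (f ` topspace (Zs_top s))" by (simp add: compact_imp_bounded)
  then obtain K where "K > 0" "\<And>a. a \<in> topspace (Zs_top s) \<Longrightarrow> cmod (f a) \<le> K"
    unfolding bounded_pos by auto
  then show ?thesis
    unfolding zbounded_def using zemb_digit[OF assms(2)] by (intro exI[of _ K]) (auto simp: topspace_Zs)
qed

text \<open>Uniform continuity for the digit topology, with agreement of the first n digits in place
  of a metric. Cylinders on which f varies little are open, finitely many of them cover the compact
  space, and n is the largest length involved.\<close>

lemma continuous_Zs_uniform: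
  assumes f: "continuous_map (Zs_top s) euclidean f" and \<epsilon>: "0 < (\<epsilon> :: real)"
  shows "\<exists>n. \<forall>a\<in>topspace (Zs_top s). \<forall>b\<in>topspace (Zs_top s). (\<forall>i<n. a i = b i) \<longrightarrow> dist (f a) (f b :: complex) < \<epsilon>"
proof -
  define cyl where "cyl a n = {b \<in> topspace (Zs_top s). \<forall>i<n. b i = a i}" for a :: "nat \<Rightarrow> nat" and n
  have local: "\<exists>n. \<forall>b\<in>cyl a n. dist (f b) (f a) < \<epsilon> / 2" if a: "a \<in> topspace (Zs_top s)" for a
  proof -
    let ?S = "{b \<in> topspace (Zs_top s). f b \<in> ball (f a) (\<epsilon> / 2)}"
    have "openin (product_topology (\<lambda>i. discrete_topology {..<s}) UNIV) ?S"
      unfolding Zs_top_def[symmetric] by (intro openin_continuous_map_preimage[OF f]) simp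
    moreover have "a \<in> ?S" using a \<epsilon> by simp
    ultimately have "\<exists>X. a \<in> (\<Pi>\<^sub>E i\<in>UNIV. X i) \<and> (\<forall>i. openin (discrete_topology {..<s}) (X i)) \<and>
        finite {i. X i \<noteq> topspace (discrete_topology {..<s})} \<and> (\<Pi>\<^sub>E i\<in>UNIV. X i) \<subseteq> ?S"
      by (rule product_topology_open_contains_basis)
    then obtain X where X: "a \<in> (\<Pi>\<^sub>E i\<in>UNIV. X i)" "finite {i. X i \<noteq> topspace (discrete_topology {..<s})}"
      "(\<Pi>\<^sub>E i\<in>UNIV. X i) \<subseteq> ?S"
      by blast
    obtain n where n: "\<And>i. X i \<noteq> {..<s} \<Longrightarrow> i < n"
      using finite_nat_bounded[OF X(2)] by auto
    have "cyl a n \<subseteq> (\<Pi>\<^sub>E i\<in>UNIV. X i)"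
    proof
      fix b assume b: "b \<in> cyl a n"
      have "b i \<in> X i" for i
      proof (cases "X i = {..<s}")
        case True
        then show ?thesis using b by (simp add: cyl_def topspace_Zs)
      next
        case False
        then show ?thesis using b n X(1) by (auto simp: cyl_def PiE_def Pi_def)
      qed
      then show "b \<in> (\<Pi>\<^sub>E i\<in>UNIV. X i)" by auto
    qed
    then have "cyl a n \<subseteq> ?S" using X(3) by blast
    then show ?thesis by (auto simp: dist_commute intro!: exI[of _ n])
  qed
  have opn: "openin (Zs_top s) (cyl a n)" if "a \<in> topspace (Zs_top s)" for a n
  proof -
    let ?X = "\<lambda>i. if i < n then {a i} else {..<s}"
    have "cyl a n = (\<Pi>\<^sub>E i\<in>UNIV. ?X i)"
    proof (intro set_eqI iffI)
      fix b assume "b \<in> cyl a n"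
      then show "b \<in> (\<Pi>\<^sub>E i\<in>UNIV. ?X i)" by (auto simp: cyl_def topspace_Zs)
    next
      fix b assume "b \<in> (\<Pi>\<^sub>E i\<in>UNIV. ?X i)"
      then have b: "b i \<in> ?X i" for i by (rule PiE_mem) simp
      have "b i < s" for i using b[of i] that by (auto simp: topspace_Zs split: if_splits)
      moreover have "b i = a i" if "i < n" for i using b[of i] that by simp
      ultimately show "b \<in> cyl a n" by (auto simp: cyl_def topspace_Zs)
    qed
    moreover have "openin (Zs_top s) (\<Pi>\<^sub>E i\<in>UNIV. ?X i)"
      unfolding Zs_top_def
    proof (rule product_topology_basis)
      show "openin (discrete_topology {..<s}) (?X i)" for i using that by (auto simp: topspace_Zs)
      show "finite {i. ?X i \<noteq> topspace (discrete_topology {..<s})}"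
        by (rule finite_subset[of _ "{..<n}"]) auto
    qed
    ultimately show ?thesis by simp
  qed
  obtain N where N: "\<And>a b. a \<in> topspace (Zs_top s) \<Longrightarrow> b \<in> cyl a (N a) \<Longrightarrow> dist (f b) (f a) < \<epsilon> / 2"
    using local by metis
  let ?\<U> = "(\<lambda>a. cyl a (N a)) ` topspace (Zs_top s)"
  have "topspace (Zs_top s) \<subseteq> \<Union>?\<U>" by (auto simp: cyl_def)
  moreover have "\<forall>U\<in>?\<U>. openin (Zs_top s) U" using opn by blast
  moreover have "compactin (Zs_top s) (topspace (Zs_top s))" using compact_space_Zs by (simp add: compact_space_def)
  ultimately obtain F where F: "finite F" "F \<subseteq> ?\<U>" "topspace (Zs_top s) \<subseteq> \<Union>F"
    unfolding compactin_def by meson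
  obtain A where A: "finite A" "A \<subseteq> topspace (Zs_top s)" "F = (\<lambda>a. cyl a (N a)) ` A"
    using finite_subset_image[OF F(1,2)] by blast
  \<comment> \<open>The inserted 0 keeps the maximum defined when the cover is empty.\<close>
  define n where "n = Max (insert 0 (N ` A))"
  have n: "N c \<le> n" if "c \<in> A" for c unfolding n_def using that A(1) by (intro Max_ge) auto
  show ?thesis
  proof (intro exI ballI impI)
    fix a b assume ab: "a \<in> topspace (Zs_top s)" "b \<in> topspace (Zs_top s)" "\<forall>i<n. a i = b i"
    then obtain c where c: "c \<in> A" "a \<in> cyl c (N c)" using F(3) A(3) by blast
    then have "b \<in> cyl c (N c)" using ab n[OF c(1)] by (auto simp: cyl_def)
    then have "dist (f b) (f c) < \<epsilon> / 2" "dist (f a) (f c) < \<epsilon> / 2" using N c A(2) by blast+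
    then show "dist (f a) (f b) < \<epsilon>" using dist_triangle_half_l[of "f a" "f c" \<epsilon> "f b"] by (simp add: dist_commute)
  qed
qed

context
  fixes s :: nat
  assumes s2: "2 \<le> s"
begin

text \<open>Induction on the number of relevant digits: conjugation by \<open>shift s j\<close>
  strips the lowest digit, so f restricted to lowest digit j comes from a function of one digit
  fewer.\<close>

lemma diag_locally_constant_in_core:
  assumes "zbounded s f" "\<And>a b. (\<And>i. i < n \<Longrightarrow> a i = b i) \<Longrightarrow> f a = f b"
  shows "diag s f \<in> core s"
  using assms
proof (induction n arbitrary: f)
  case 0
  have f: "f a = f b" for a b by (rule 0) simp
  have "diag s f = scaleC (f (\<lambda>_. 0)) (vproj s)"
  proof (rule l2op_eqI, rule ell2_eqI)
    fix x and v :: vtx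
    obtain m y where v: "v = (m, y)" by (cases v)
    show "coord (app (diag s f) x) v = coord (app (scaleC (f (\<lambda>_. 0)) (vproj s)) x) v"
      using f[of "zemb s y" "\<lambda>_. 0"] by (simp add: v coord_diag[OF 0(1)] app_scaleC coord_simps coord_vproj)
  qed
  then show ?case using vproj_in_core[OF s2] core_closed[OF s2] by simp
next
  case (Suc n)
  have s0: "0 < s" using s2 by simp
  let ?f = "\<lambda>j a. f (case_nat j a)"
  have bd: "zbounded s (?f j)" if "j < s" for j
  proof -
    obtain K where K: "K \<ge> 0" "\<And>y. y \<ge> 0 \<Longrightarrow> cmod (f (zemb s y)) \<le> K"
      using Suc.prems(1) unfolding zbounded_def by blast
    have "cmod (?f j (zemb s y)) \<le> K" if "y \<ge> 0" for y
      using K(2)[of "int s * y + int j"] that zemb_cons[OF s0 that \<open>j < s\<close>] by simp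
    then show ?thesis unfolding zbounded_def using K(1) by blast
  qed
  have core: "diag s (?f j) \<in> core s" if "j < s" for j
  proof (rule Suc.IH[OF bd[OF that]])
    fix a b :: "nat \<Rightarrow> nat" assume "\<And>i. i < n \<Longrightarrow> a i = b i"
    then show "?f j a = ?f j b" by (intro Suc.prems(2)) (auto split: nat.split)
  qed
  \<comment> \<open>The root has no last letter and is missed by the sum; its label 0 is the zero
    digit sequence, which gives the coefficient of \<open>vacuum\<close>.\<close>
  have "diag s f = (\<Sum>j<s. shift s j * diag s (?f j) * cstar (shift s j)) + scaleC (f (\<lambda>_. 0)) vacuum"
  proof (rule l2op_eqI, rule ell2_eqI)
    fix x and v :: vtx
    obtain m y where v: "v = (m, y)" by (cases v)
    let ?t = "if (m, y) \<in> Vs s \<and> 0 < m then f (zemb s y) * coord x (m, y) else 0"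
    have t: "coord (app (shift s j * diag s (?f j) * cstar (shift s j)) x) (m, y) =
        (if j = nat (y mod int s) then ?t else 0)" if j: "j < s" for j
    proof (cases "(m, y) \<in> Vs s \<and> 0 < m \<and> y mod int s = int j")
      case True
      then have p: "(m - 1, y div int s) \<in> Vs s" using Vs_pred s0 by blast
      have y: "0 \<le> y" using True by (simp add: Vs_def)
      have "int s * (y div int s) + int j = y" using True mult_div_mod_eq[of "int s" y] by simp
      moreover have "case_nat j (zemb s (y div int s)) = zemb s y" using zemb_split[OF s0 y] True by simp
      ultimately show ?thesis
        using True p by (simp add: coord_shift coord_diag[OF bd[OF j]] coord_cstar_shift[OF s2 j])
    next
      case False
      have "j = nat (y mod int s) \<longleftrightarrow> y mod int s = int j" using s0 by (auto simp: nat_eq_iff)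
      then show ?thesis using False by (auto simp: coord_shift)
    qed
    have "(\<Sum>j<s. coord (app (shift s j * diag s (?f j) * cstar (shift s j)) x) (m, y)) =
        (\<Sum>j<s. if j = nat (y mod int s) then ?t else 0)"
      by (rule sum.cong[OF refl]) (rule t, simp)
    also have "\<dots> = ?t"
    proof -
      have "nat (y mod int s) < s" using s0 by (simp add: nat_less_iff)
      then show ?thesis by simp
    qed
    finally have S: "(\<Sum>j<s. coord (app (shift s j * diag s (?f j) * cstar (shift s j)) x) (m, y)) = ?t" .
    show "coord (app (diag s f) x) v =
        coord (app ((\<Sum>j<s. shift s j * diag s (?f j) * cstar (shift s j)) + scaleC (f (\<lambda>_. 0)) vacuum) x) v"
      unfolding v app_simps(3) coord_simps app_sum_left coord_sum S app_scaleC coord_vacuum coord_diag[OF Suc.prems(1)]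
      using Vs_zero[of y s] by (auto simp: zemb_zero)
  qed
  moreover have "(\<Sum>j<s. shift s j * diag s (?f j) * cstar (shift s j)) \<in> core s"
    using core by (intro cstar_subalg_sum[OF core_subalg[OF s2]] core_shift[OF s2]) (use vproj_in_core[OF s2] in auto)
  ultimately show ?case using vacuum_in_core[OF s2] by (simp add: core_closed[OF s2])
qed

lemma diag_in_core:
  assumes f: "continuous_map (Zs_top s) euclidean f"
  shows "diag s f \<in> core s"
proof -
  have s0: "0 < s" using s2 by simp
  have "\<exists>X\<in>core s. dist X (diag s f) < \<epsilon>" if \<epsilon>: "\<epsilon> > 0" for \<epsilon>
  proof -
    obtain n where n: "\<And>a b. a \<in> topspace (Zs_top s) \<Longrightarrow> b \<in> topspace (Zs_top s) \<Longrightarrow>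
        (\<forall>i<n. a i = b i) \<Longrightarrow> dist (f a) (f b) < \<epsilon> / 2"
      using continuous_Zs_uniform[OF f, of "\<epsilon> / 2"] \<epsilon> by (metis half_gt_zero)
    \<comment> \<open>Replacing all digits from position n on by 0 makes f locally constant and
      changes its values by less than half of \<epsilon>; the truncated sequence is still a point of
      the space.\<close>
    define g where "g a = f (\<lambda>i. if i < n then a i else 0)" for a
    have close: "dist (g (zemb s y)) (f (zemb s y)) < \<epsilon> / 2" for y
      unfolding g_def using zemb_digit[OF s0] s0 by (intro n) (auto simp: topspace_Zs)
    obtain K where K: "K \<ge> 0" "\<And>y. y \<ge> 0 \<Longrightarrow> cmod (f (zemb s y)) \<le> K"
      using continuous_Zs_bounded[OF f s0] unfolding zbounded_def by blast
    have gb: "zbounded s g"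
      unfolding zbounded_def
    proof (intro exI conjI allI impI)
      show "0 \<le> K + \<epsilon>" using K \<epsilon> by simp
      fix y :: int assume "0 \<le> y"
      then show "cmod (g (zemb s y)) \<le> K + \<epsilon>"
        using K(2)[of y] close[of y] \<epsilon> norm_triangle_sub[of "g (zemb s y)" "f (zemb s y)"]
        by (simp add: dist_norm)
    qed
    have "diag s g \<in> core s"
      by (rule diag_locally_constant_in_core[OF gb, of n]) (auto simp: g_def intro!: arg_cong[of _ _ f])
    moreover have "norm (diag s g - diag s f) \<le> \<epsilon> / 2"
    proof (rule norm_diagonal_le)
      let ?h = "\<lambda>v. if v \<in> Vs s then g (zemb s (snd v)) - f (zemb s (snd v)) else 0"
      show "coord (app (diag s g - diag s f) x) v = ?h v * coord x v" for x v
        by (cases v) (simp add: coord_simps coord_diag[OF gb] coord_diag[OF continuous_Zs_bounded[OF f s0]] algebra_simps)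
      show "cmod (?h v) \<le> \<epsilon> / 2" for v using close[of "snd v"] \<epsilon> by (simp add: dist_norm less_imp_le)
    qed (use \<epsilon> in simp)
    ultimately show ?thesis using \<epsilon> by (intro bexI[of _ "diag s g"]) (auto simp: dist_norm)
  qed
  then show ?thesis using core_closed(1)[OF s2] closed_approachable by blast
qed

section \<open>Two generating sets of \<open>A_S\<close>\<close>

definition alg_gens :: "vtx l2op set" where
  "alg_gens = insert (bshift s) {diag s f | f. continuous_map (Zs_top s) euclidean f}"

lemma alg_gens_corner: "alg_gens \<subseteq> corner s"
  unfolding alg_gens_def using bshift_in_corner[OF s2] diag_in_core core_corner[OF s2] by blast

lemma opr_diag:
  assumes "zbounded s f"
  shows "opr s (diag s f) = Mop s f"
proof (rule op_eqI[of s])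
  show "opr s (diag s f) \<xi> = Mop s f \<xi>" if "\<xi> \<notin> Hs s" for \<xi> using that by (simp add: opr_not_in Mop_def)
  fix x assume x: "app (vproj s) x = x"
  have "coord x v = 0" if "v \<notin> Vs s" for v using x that coord_vproj[of s x v] by simp
  then show "opr s (diag s f) (coord x) = Mop s f (coord x)"
    using x by (auto simp: opr_coord Mop_def coord_in_Hs coord_diag[OF assms] fun_eq_iff)
qed

lemma A_S_eq: "A_S s = opr s ` cstar_generated alg_gens"
proof -
  have s0: "0 < s" using s2 by simp
  have "insert (Sop s) {Mop s f | f. continuous_map (Zs_top s) euclidean f} = opr s ` alg_gens"
    unfolding alg_gens_def image_insert opr_bshift[OF s2]
    using opr_diag[OF continuous_Zs_bounded[OF _ s0]] by (auto simp: image_iff) metis+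
  then show ?thesis unfolding A_S_def using gen_cstar_opr[OF alg_gens_corner] by simp
qed

text \<open>The indicator of "lowest digit j" is continuous, and multiplying by it cuts the
  Bernoulli shift down to its j-th summand; the factor sqrt s undoes the normalisation.\<close>

lemma shift_in_alg:
  assumes j: "j < s"
  shows "shift s j \<in> cstar_generated alg_gens"
proof -
  have s0: "0 < s" using s2 by simp
  define f where "f a = (if a 0 = j then 1 else 0 :: complex)" for a :: "nat \<Rightarrow> nat"
  have "continuous_map (Zs_top s) euclidean ((\<lambda>k. if k = j then 1 else 0 :: complex) \<circ> (\<lambda>a. a 0))"
    unfolding Zs_top_def
    by (rule continuous_map_compose[OF continuous_map_product_projection[of 0]]) auto
  then have f: "continuous_map (Zs_top s) euclidean f" by (simp add: f_def[abs_def] comp_def)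
  have "diag s f * bshift s \<in> cstar_generated alg_gens"
    using f cstar_generated_subset[of alg_gens]
    by (intro cstar_subalgD(3)[OF cstar_subalg_generated]) (auto simp: alg_gens_def)
  then have "scaleC (complex_of_real (sqrt (real s))) (diag s f * bshift s) \<in> cstar_generated alg_gens"
    by (rule cstar_subalgD(4)[OF cstar_subalg_generated])
  also have "scaleC (complex_of_real (sqrt (real s))) (diag s f * bshift s) = shift s j"
  proof (rule l2op_eqI, rule ell2_eqI)
    fix x and v :: vtx
    obtain m y where v: "v = (m, y)" by (cases v)
    have "f (zemb s y) = (if y mod int s = int j then 1 else 0)" if "0 \<le> y"
      using zemb_split[OF s0 that] s0 by (auto simp: f_def nat_eq_iff)
    moreover have "0 \<le> y" if "(m, y) \<in> Vs s" using that by (simp add: Vs_def)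
    ultimately show "coord (app (scaleC (complex_of_real (sqrt (real s))) (diag s f * bshift s)) x) v =
        coord (app (shift s j) x) v"
      using s0 by (auto simp: v app_scaleC coord_simps coord_diag[OF continuous_Zs_bounded[OF f s0]]
          coord_bshift[OF s2] coord_shift)
  qed
  finally show ?thesis .
qed

lemma alg_generated_by_core: "cstar_generated alg_gens = cstar_generated (insert (bshift s) (core s))"
proof
  let ?A = "cstar_generated alg_gens"
  have v: "bshift s \<in> ?A" using cstar_generated_subset[of alg_gens] by (auto simp: alg_gens_def)
  have c: "x \<in> ?A \<Longrightarrow> y \<in> ?A \<Longrightarrow> x * y \<in> ?A" "x \<in> ?A \<Longrightarrow> cstar x \<in> ?A" for x y
    using cstar_subalgD[OF cstar_subalg_generated] by blast+
  have "vproj s \<in> ?A" using c(1)[OF c(2)[OF v] v] by (simp add: bshift_isometry[OF s2])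
  have w: "sword s n x \<in> ?A" for n x
  proof (induction n arbitrary: x)
    case 0
    show ?case using \<open>vproj s \<in> ?A\<close> by (simp add: sword.simps[OF s2])
  next
    case (Suc n)
    have "x mod s < s" using s2 by simp
    then show ?case using c(1)[OF shift_in_alg Suc] by (simp add: sword.simps[OF s2])
  qed
  have "core s \<subseteq> ?A"
    unfolding core_def[OF s2]
  proof (rule cstar_generated_least[OF _ cstar_subalg_generated])
    show "core_gens s \<subseteq> ?A" unfolding core_gens_def[OF s2] using c w by blast
  qed
  then show "cstar_generated (insert (bshift s) (core s)) \<subseteq> ?A"
    using v by (intro cstar_generated_least cstar_subalg_generated) auto
  have "alg_gens \<subseteq> insert (bshift s) (core s)" unfolding alg_gens_def using diag_in_core by blast
  then show "?A \<subseteq> cstar_generated (insert (bshift s) (core s))"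
    using cstar_generated_subset by (intro cstar_generated_least cstar_subalg_generated) blast
qed

end

section \<open>The crossed product\<close>

context
  fixes s :: nat
  assumes s2: "2 \<le> s"
begin

interpretation corner_endomorphism "core s" "vproj s" "bshift s"
  by (rule corner_endomorphism_core[OF s2])

lemma opr_core_in: "b \<in> core s \<Longrightarrow> b \<in> corner s"
  using core_corner[OF s2] by blast

lemma alpha_S_opr:
  assumes "b \<in> core s"
  shows "alpha_S s (opr s b) = opr s (bshift s * b * cstar (bshift s))"
  unfolding alpha_S_def opr_bshift[OF s2, symmetric]
  using bshift_in_corner[OF s2] opr_core_in[OF assms]
  by (simp add: opr_adjoint opr_mult corner_closed)

lemma conj_mult:
  assumes "x \<in> core s"
  shows "(bshift s * x * cstar (bshift s)) * (bshift s * y * cstar (bshift s)) = bshift s * (x * y) * cstar (bshift s)"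
proof -
  have "(bshift s * x * cstar (bshift s)) * (bshift s * y * cstar (bshift s)) =
      bshift s * (x * (cstar (bshift s) * bshift s)) * y * cstar (bshift s)"
    by (simp only: mult.assoc)
  then show ?thesis using e_right[OF assms] by (simp add: isometry mult.assoc)
qed

lemma op_star_hom_alpha_S: "op_star_hom s (B_S s) (alpha_S s)"
  unfolding op_star_hom_def B_S_eq[OF s2]
proof (intro conjI ballI allI)
  fix X assume "X \<in> opr s ` core s"
  then obtain x where x: "x \<in> core s" "X = opr s x" by blast
  have cx: "bshift s * x * cstar (bshift s) \<in> corner s" using opr_core_in[OF conj_in[OF x(1)]] .
  show "alpha_S s (op_scale c X) = op_scale c (alpha_S s X)" for c
    using x by (simp add: opr_scaleC[symmetric] alpha_S_opr B_closed mult_scaleC_left mult_scaleC_right)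
  have "alpha_S s (adj s X) = opr s (cstar (bshift s * x * cstar (bshift s)))"
    using x opr_core_in by (simp add: opr_adjoint alpha_S_opr B_closed cstar_mult cstar_cstar mult.assoc)
  then show "alpha_S s (adj s X) = adj s (alpha_S s X)" using x cx by (simp add: opr_adjoint alpha_S_opr)
  fix Y assume "Y \<in> opr s ` core s"
  then obtain y where y: "y \<in> core s" "Y = opr s y" by blast
  have cy: "bshift s * y * cstar (bshift s) \<in> corner s" using opr_core_in[OF conj_in[OF y(1)]] .
  show "alpha_S s (op_add X Y) = op_add (alpha_S s X) (alpha_S s Y)"
    using x y by (simp add: opr_add[symmetric] alpha_S_opr B_closed distrib_left distrib_right)
  have "alpha_S s (X \<circ> Y) = opr s (bshift s * (x * y) * cstar (bshift s))"
    using x y opr_core_in by (simp add: opr_mult[symmetric] alpha_S_opr B_closed)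
  then show "alpha_S s (X \<circ> Y) = alpha_S s X \<circ> alpha_S s Y"
    using x y cy by (simp add: conj_mult[symmetric] opr_mult alpha_S_opr)
qed

text \<open>Compression is a left inverse of the endomorphism, and injectivity follows.\<close>

lemma compress_conj:
  assumes "b \<in> core s"
  shows "cstar (bshift s) * (bshift s * b * cstar (bshift s)) * bshift s = b"
proof -
  have "cstar (bshift s) * (bshift s * b * cstar (bshift s)) * bshift s =
      (cstar (bshift s) * bshift s) * b * (cstar (bshift s) * bshift s)"
    by (simp only: mult.assoc)
  then show ?thesis using assms by (simp add: isometry e_left e_right)
qed

lemma inj_on_alpha_S: "inj_on (alpha_S s) (B_S s)"
  unfolding B_S_eq[OF s2]
proof (rule inj_onI)
  fix X Y assume "X \<in> opr s ` core s" "Y \<in> opr s ` core s" and eq: "alpha_S s X = alpha_S s Y"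
  then obtain x y where xy: "x \<in> core s" "X = opr s x" "y \<in> core s" "Y = opr s y" by blast
  have "bshift s * x * cstar (bshift s) = bshift s * y * cstar (bshift s)"
    using eq xy opr_core_in[OF conj_in] by (intro opr_inject) (simp_all add: alpha_S_opr)
  then have "x = y"
    using arg_cong[where f = "\<lambda>t. cstar (bshift s) * t * bshift s"] compress_conj[OF xy(1)] compress_conj[OF xy(3)]
    by metis
  then show "X = Y" using xy by simp
qed

section \<open>The range of \<open>alpha_S\<close> as a hereditary corner\<close>

abbreviation "range_proj \<equiv> bshift s * cstar (bshift s)"

lemma cstar_range_proj: "cstar range_proj = range_proj"
  by (simp add: cstar_mult cstar_cstar)

lemma range_iff: "(\<exists>b\<in>core s. x = bshift s * b * cstar (bshift s)) \<longleftrightarrow> x \<in> core s \<and> range_proj * x = x \<and> x * range_proj = x"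
proof (intro iffI conjI; (elim bexE conjE)?)
  fix b assume b: "b \<in> core s" and x: "x = bshift s * b * cstar (bshift s)"
  show "x \<in> core s" unfolding x using conj_in[OF b] .
  have "range_proj * x = bshift s * (cstar (bshift s) * bshift s) * b * cstar (bshift s)"
    unfolding x by (simp only: mult.assoc)
  then show "range_proj * x = x" by (simp add: isometry v_e x)
  have vstar: "vproj s * cstar (bshift s) = cstar (bshift s)"
    using arg_cong[OF v_e, of cstar] by (simp add: cstar_mult cstar_vproj)
  have "x * range_proj = bshift s * b * ((cstar (bshift s) * bshift s) * cstar (bshift s))"
    unfolding x by (simp only: mult.assoc)
  then show "x * range_proj = x" by (simp add: isometry vstar x)
next
  assume x: "x \<in> core s" "range_proj * x = x" "x * range_proj = x"
  have "x = range_proj * x * range_proj" using x by simp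
  also have "\<dots> = bshift s * (cstar (bshift s) * x * bshift s) * cstar (bshift s)" by (simp only: mult.assoc)
  finally show "\<exists>b\<in>core s. x = bshift s * b * cstar (bshift s)" using compress_in[OF x(1)] by blast
qed

lemma subalg_range: "cstar_subalg {x \<in> core s. range_proj * x = x \<and> x * range_proj = x}"
proof (rule cstar_subalgI)
  have "{x \<in> core s. range_proj * x = x \<and> x * range_proj = x} = core s \<inter> {x. range_proj * x = x} \<inter> {x. x * range_proj = x}" by blast
  moreover have "closed {x. range_proj * x = x}" "closed {x. x * range_proj = x}"
    by (intro closed_Collect_eq continuous_intros)+
  ultimately show "closed {x \<in> core s. range_proj * x = x \<and> x * range_proj = x}" using B_closed(1) by (simp add: closed_Int)
  fix x assume x: "x \<in> {x \<in> core s. range_proj * x = x \<and> x * range_proj = x}"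
  show "scaleC c x \<in> {x \<in> core s. range_proj * x = x \<and> x * range_proj = x}" for c
    using x by (auto simp: mult_scaleC_left mult_scaleC_right intro: B_closed(4))
  have "cstar (range_proj * x) = cstar x" "cstar (x * range_proj) = cstar x" using x by simp_all
  then have "cstar x * range_proj = cstar x" "range_proj * cstar x = cstar x" unfolding cstar_mult[of range_proj] cstar_mult[of x] cstar_range_proj .
  then show "cstar x \<in> {x \<in> core s. range_proj * x = x \<and> x * range_proj = x}" using x B_closed(5) by blast
  fix y assume y: "y \<in> {x \<in> core s. range_proj * x = x \<and> x * range_proj = x}"
  show "x + y \<in> {x \<in> core s. range_proj * x = x \<and> x * range_proj = x}"
    using x y by (auto simp: distrib_left distrib_right intro: B_closed(2))
  have "range_proj * (x * y) = (range_proj * x) * y" "x * y * range_proj = x * (y * range_proj)" by (simp_all only: mult.assoc)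
  then show "x * y \<in> {x \<in> core s. range_proj * x = x \<and> x * range_proj = x}" using x y B_closed(3) by auto
qed

lemma alpha_S_image: "alpha_S s ` B_S s = opr s ` {x \<in> core s. range_proj * x = x \<and> x * range_proj = x}"
proof -
  have "alpha_S s ` B_S s = opr s ` {x. \<exists>b\<in>core s. x = bshift s * b * cstar (bshift s)}"
    unfolding B_S_eq[OF s2] image_image using alpha_S_opr by (auto simp: image_iff)
  then show ?thesis unfolding range_iff .
qed

text \<open>Let p be the range projection. If a lies between 0 and b, and b vanishes on the range of
  e - p, then so does the quadratic form of a. By positivity a itself vanishes there, which gives a
  p = a, and p a = a by taking adjoints.\<close>

lemma hereditary_alpha_S: "hereditary_subalg s (alpha_S s ` B_S s) (B_S s)"
  unfolding hereditary_subalg_def alpha_S_image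
proof (intro conjI ballI impI; (elim conjE)?)
  show "cstar_closed s (opr s ` {x \<in> core s. range_proj * x = x \<and> x * range_proj = x})"
    using opr_core_in by (intro cstar_closed_opr_image subalg_range) auto
  show "opr s ` {x \<in> core s. range_proj * x = x \<and> x * range_proj = x} \<subseteq> B_S s" unfolding B_S_eq[OF s2] by blast
  fix A B assume A: "A \<in> B_S s" and B: "B \<in> opr s ` {x \<in> core s. range_proj * x = x \<and> x * range_proj = x}"
    and pos: "pos_op s A" "pos_op s (op_add B (op_scale (- 1) A))"
  obtain a where a: "a \<in> core s" "A = opr s a" using A unfolding B_S_eq[OF s2] by blast
  obtain b where b: "b \<in> core s" "b * range_proj = b" "B = opr s b" using B by blast
  have "op_add B (op_scale (- 1) A) = opr s (b - a)"
    unfolding a b opr_scaleC[symmetric] opr_add[symmetric] by (simp add: scaleC_minus_one)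
  then have ba: "0 \<le> Re (cinner (app (b - a) x) x)" for x
    using pos(2) pos_opr(2)[OF opr_core_in[OF B_closed(8)[OF b(1) a(1)]]] by simp
  have sa: "cstar a = a" and pa: "0 \<le> Re (cinner (app a x) x)" for x
    using pos_opr[of a s] pos(1) a opr_core_in by auto
  have "a * (vproj s - range_proj) = 0"
  proof (rule l2op_eqI)
    fix x
    define y where "y = app (vproj s - range_proj) x"
    have "b * (vproj s - range_proj) = 0" using b e_right[OF b(1)] by (simp add: right_diff_distrib)
    then have "app b y = 0" unfolding y_def by (metis app_simps(1) app_simps(7))
    then have "Re (cinner (app a y) y) \<le> 0"
      using ba[of y] by (simp add: inner_ell2_def[symmetric])
    then have "Re (cinner (app a y) y) = 0" using pa[of y] by simp
    then have "app a y = 0" using positive_zero[OF sa pa] by blast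
    then show "app (a * (vproj s - range_proj)) x = app 0 x" unfolding y_def by (simp only: app_simps)
  qed
  then have ap: "a * range_proj = a" using e_right[OF a(1)] by (simp add: right_diff_distrib)
  then have "cstar (a * range_proj) = cstar a" by simp
  then have "range_proj * a = a" unfolding cstar_mult[of a] cstar_range_proj sa .
  then show "A \<in> opr s ` {x \<in> core s. range_proj * x = x \<and> x * range_proj = x}" using a ap by blast
qed

text \<open>The abstract extension lives on the corner of the ambient algebra and is transported to
  operators on \<open>Hs s\<close> along \<open>opr\<close>.\<close>

lemma crossed_product: "is_crossed_product s (B_S s) (alpha_S s) (A_S s) (Sop s) TYPE('d::cstar_alg)"
proof -
  let ?A = "cstar_generated (insert (bshift s) (core s))"
  have A: "A_S s = opr s ` ?A" using A_S_eq[OF s2] alg_generated_by_core[OF s2] by simp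
  have gc: "insert (bshift s) (core s) \<subseteq> corner s" using bshift_in_corner[OF s2] opr_core_in by blast
  have Ac: "x \<in> corner s" if "x \<in> ?A" for x
    using cstar_generated_least[OF gc cstar_subalg_corner] that by blast
  have gen: "insert (bshift s) (core s) \<subseteq> ?A" by (rule cstar_generated_subset)
  note cl = cstar_subalgD[OF cstar_subalg_generated[of "insert (bshift s) (core s)"]]
  show ?thesis
    unfolding is_crossed_product_def
  proof (intro conjI ballI allI impI; (elim conjE)?)
    show "idop s \<in> B_S s" unfolding B_S_eq[OF s2] opr_vproj[symmetric] using e_in by blast
    show "B_S s \<subseteq> A_S s" unfolding A B_S_eq[OF s2] using gen by blast
    show "Sop s \<in> A_S s" unfolding A opr_bshift[OF s2, symmetric] using gen by blast
    show "adj s (Sop s) \<circ> Sop s = idop s"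
      unfolding opr_bshift[OF s2, symmetric] opr_adjoint[OF bshift_in_corner[OF s2]] opr_vproj[symmetric]
        opr_mult[OF bshift_in_corner[OF s2], symmetric] isometry ..
    show "Sop s \<circ> b \<circ> adj s (Sop s) = alpha_S s b" for b by (simp add: alpha_S_def)
    have "insert (Sop s) (B_S s) = opr s ` insert (bshift s) (core s)"
      by (simp add: B_S_eq[OF s2] opr_bshift[OF s2])
    then show "A_S s = gen_cstar s (insert (Sop s) (B_S s))" using A gen_cstar_opr[OF gc] by simp
  next
    fix \<pi> :: "op \<Rightarrow> 'd" and w
    assume \<pi>: "unital_star_hom_into s (B_S s) \<pi>" and w: "cstar w * w = 1"
      and cov: "\<forall>b\<in>B_S s. w * \<pi> b * cstar w = \<pi> (alpha_S s b)"
    have op_hom: "\<pi> (op_add (opr s x) (opr s y)) = \<pi> (opr s x) + \<pi> (opr s y)"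
      "\<pi> (opr s x \<circ> opr s y) = \<pi> (opr s x) * \<pi> (opr s y)"
      "\<pi> (op_scale c (opr s x)) = scaleC c (\<pi> (opr s x))"
      "\<pi> (adj s (opr s x)) = cstar (\<pi> (opr s x))" if "x \<in> core s" "y \<in> core s" for x y c
      using \<pi> that unfolding unital_star_hom_into_def B_S_eq[OF s2] by blast+
    interpret covariant_rep "core s" "vproj s" "bshift s" "\<lambda>x. \<pi> (opr s x)" w
    proof
      show "star_hom_on (core s) (\<lambda>x. \<pi> (opr s x))"
        unfolding star_hom_on_def using op_hom opr_core_in
        by (auto simp: opr_add opr_mult opr_scaleC opr_adjoint[symmetric])
      show "\<pi> (opr s (vproj s)) = 1" using \<pi> by (simp add: unital_star_hom_into_def opr_vproj)
      show "cstar w * w = 1" by (rule w)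
      fix b assume "b \<in> core s"
      then show "w * \<pi> (opr s b) * cstar w = \<pi> (opr s (bshift s * b * cstar (bshift s)))"
        using cov by (simp add: B_S_eq[OF s2] alpha_S_opr)
    qed
    obtain \<rho> :: "vtx l2op \<Rightarrow> 'd" where \<rho>: "star_hom_on ?A \<rho>" "\<And>b. b \<in> core s \<Longrightarrow> \<rho> b = \<pi> (opr s b)"
      "\<rho> (bshift s) = w"
      using extension_exists by blast
    \<comment> \<open>\<open>opr\<close> is injective on the corner only, so the preimage is chosen
      there.\<close>
    define \<sigma> where "\<sigma> T = \<rho> (inv_into (corner s) (opr s) T)" for T
    have inj: "inj_on (opr s) (corner s)" using opr_inject by (intro inj_onI)
    have \<sigma>: "\<sigma> (opr s x) = \<rho> x" if "x \<in> corner s" for x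
      unfolding \<sigma>_def using inv_into_f_f[OF inj that] by simp
    have hom: "\<rho> (x + y) = \<rho> x + \<rho> y" "\<rho> (x * y) = \<rho> x * \<rho> y" "\<rho> (scaleC c x) = scaleC c (\<rho> x)"
      "\<rho> (cstar x) = cstar (\<rho> x)" if "x \<in> ?A" "y \<in> ?A" for x y c
      using \<rho>(1) that unfolding star_hom_on_def by blast+
    have "unital_star_hom_into s (A_S s) \<sigma>"
      unfolding unital_star_hom_into_def A
    proof (intro conjI ballI allI)
      show "\<sigma> (idop s) = 1"
        using \<sigma>[OF vproj_in_corner] \<rho>(2)[OF e_in] \<pi>_e by (simp add: opr_vproj)
      fix X assume "X \<in> opr s ` ?A"
      then obtain x where x: "x \<in> ?A" "X = opr s x" by blast
      show "\<sigma> (op_scale c X) = scaleC c (\<sigma> X)" for c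
        unfolding x(2) opr_scaleC[symmetric] using x(1) hom(3)[OF x(1) x(1)] by (simp add: \<sigma> Ac cl)
      show "\<sigma> (adj s X) = cstar (\<sigma> X)"
        unfolding x(2) opr_adjoint[OF Ac[OF x(1)]] using x(1) hom(4)[OF x(1) x(1)] by (simp add: \<sigma> Ac cl)
      fix Y assume "Y \<in> opr s ` ?A"
      then obtain y where y: "y \<in> ?A" "Y = opr s y" by blast
      show "\<sigma> (op_add X Y) = \<sigma> X + \<sigma> Y"
        unfolding x(2) y(2) opr_add[symmetric] using x(1) y(1) hom(1)[OF x(1) y(1)] by (simp add: \<sigma> Ac cl)
      show "\<sigma> (X \<circ> Y) = \<sigma> X * \<sigma> Y"
        unfolding x(2) y(2) opr_mult[OF Ac[OF y(1)], symmetric]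
        using x(1) y(1) hom(2)[OF x(1) y(1)] by (simp add: \<sigma> Ac cl)
    qed
    moreover have "\<forall>b\<in>B_S s. \<sigma> b = \<pi> b"
      unfolding B_S_eq[OF s2] using \<sigma>[OF opr_core_in] \<rho>(2) by auto
    moreover have "\<sigma> (Sop s) = w"
      unfolding opr_bshift[OF s2, symmetric] using \<sigma>[OF bshift_in_corner[OF s2]] \<rho>(3) by simp
    ultimately show "\<exists>\<rho>. unital_star_hom_into s (A_S s) \<rho> \<and> (\<forall>b\<in>B_S s. \<rho> b = \<pi> b) \<and> \<rho> (Sop s) = w"
      by blast
  qed
qed

lemma alpha_S_in_B_S: "b \<in> B_S s \<Longrightarrow> alpha_S s b \<in> B_S s"
  unfolding B_S_eq[OF s2] using alpha_S_opr conj_in by auto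

end

theorem theorem6p7:
  fixes s :: nat
  assumes "2 \<le> s"
  shows "(\<forall>b\<in>B_S s. alpha_S s b \<in> B_S s) \<and>
         op_star_hom s (B_S s) (alpha_S s) \<and>
         inj_on (alpha_S s) (B_S s) \<and>
         hereditary_subalg s (alpha_S s ` B_S s) (B_S s) \<and>
         is_crossed_product s (B_S s) (alpha_S s) (A_S s) (Sop s) TYPE('d::cstar_alg)"
  using alpha_S_in_B_S[OF assms] op_star_hom_alpha_S[OF assms] inj_on_alpha_S[OF assms]
    hereditary_alpha_S[OF assms] crossed_product[OF assms] by blast

end
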